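(* Consider the non-autonomous parabolic equation $$\begin{cases}\partial_tu(x,t)=\Delta u(x,t)+V(x,t)u(x,t),& t\ge s,\ x\in\mathbb R^d,\\ u(x,s)=u_0(x),& x\in\mathbb R^d,\end{cases}$$ and suppose that $V\in\mathrm{BUC}(\mathbb R;W^{2,\infty}(\mathbb R^d))\cap\mathrm{BUC}^1(\mathbb R;L^\infty(\mathbb R^d))$. Let $(W(t,s))_{t\ge s}$ be the evolution family on $L^2(\mathbb R^d)$ solving this problem. Then for every $t_0>0$ there is a constant $C>0$ such that for all $u_0\in H^2(\mathbb R^d)$, all $s\le t$ with $t-s\le t_0$, and all $n\in\mathbb N$, $n\ge1$, $$\Bigl\|W(t,s)u_0-\prod_{p=0}^{n-1}e^{\frac{t-s}{n}V(s+\frac{p(t-s)}{n})}e^{\frac{t-s}{n}\Delta}u_0\Bigr\|_{L^2}\le\frac{C(t-s)^2}{n}\,\|u_0\|_{H^2}.$$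
   Context: $V(t):=V(\cdot,t)$ acts on $L^2(\mathbb R^d)$ as a multiplication operator and $e^{\tau V(t)}$ is multiplication by the exponential; $(e^{t\Delta})_{t\ge0}$ is the heat semigroup on $L^2(\mathbb R^d)$. $\mathrm{BUC}(\mathbb R;Y)$ is the space of bounded uniformly continuous functions $\mathbb R\to Y$; $\mathrm{BUC}^1(\mathbb R;Y)$ is the space of $f\in C^1(\mathbb R;Y)$ with $f,f'\in\mathrm{BUC}(\mathbb R;Y)$. The product is ordered: $\prod_{p=0}^{n-1}U_p:=U_{n-1}\cdots U_1U_0$. The evolution family $W$ solving the problem is the strongly continuous family $(W(t,s))_{t\ge s}$ of bounded operators on $L^2(\mathbb R^d)$ with $W(t,r)W(r,s)=W(t,s)$, $W(t,t)=I$, determined by $W(t,s)x=e^{(t-s)\Delta}x+\int_s^te^{(t-r)\Delta}V(r)W(r,s)x\,dr$. *)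

theory Defs
  imports "HOL-Probability.Probability"
begin

section \<open>The Hilbert space \<open>L\<^sup>2\<close>\<close>

definition square_int :: "('a::euclidean_space \<Rightarrow> complex) \<Rightarrow> bool" where
  "square_int f \<longleftrightarrow> f \<in> borel_measurable lborel \<and> integrable lborel (\<lambda>x. (cmod (f x))\<^sup>2)"

definition l2_rel :: "('a::euclidean_space \<Rightarrow> complex) \<Rightarrow> ('a \<Rightarrow> complex) \<Rightarrow> bool" where
  "l2_rel f g \<longleftrightarrow> square_int f \<and> square_int g \<and> (AE x in lborel. f x = g x)"

text \<open>Elements of \<open>L\<^sup>2\<close> are classes of complex-valued functions modulo equality almost everywhere.
  Using Borel rather than Lebesgue measurable representatives gives the same classes up to
  null sets.\<close>

quotient_type (overloaded) 'a l2 = "'a::euclidean_space \<Rightarrow> complex" / partial: l2_rel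
proof (rule part_equivpI)
  show "\<exists>f::'a \<Rightarrow> complex. l2_rel f f"
    by (rule exI[of _ "\<lambda>_. 0"]) (simp add: l2_rel_def square_int_def)
  show "symp (l2_rel :: ('a \<Rightarrow> complex) \<Rightarrow> _)"
    by (auto simp: symp_def l2_rel_def)
  show "transp (l2_rel :: ('a \<Rightarrow> complex) \<Rightarrow> _)"
    unfolding transp_def l2_rel_def by auto
qed

lemma square_int_add:
  assumes "square_int f" "square_int g"
  shows "square_int (\<lambda>x. f x + g x)"
proof -
  have [measurable]: "f \<in> borel_measurable lborel" "g \<in> borel_measurable lborel"
    using assms by (auto simp: square_int_def)
  have "integrable lborel (\<lambda>x. 2 * (cmod (f x))\<^sup>2 + 2 * (cmod (g x))\<^sup>2)"
    using assms by (auto simp: square_int_def)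
  then have "integrable lborel (\<lambda>x. (cmod (f x + g x))\<^sup>2)"
  proof (rule Bochner_Integration.integrable_bound)
    have "(cmod (f x + g x))\<^sup>2 \<le> 2 * (cmod (f x))\<^sup>2 + 2 * (cmod (g x))\<^sup>2" for x
    proof -
      have "(cmod (f x + g x))\<^sup>2 \<le> (cmod (f x) + cmod (g x))\<^sup>2"
        by (intro power_mono norm_triangle_ineq) auto
      also have "\<dots> \<le> 2 * (cmod (f x))\<^sup>2 + 2 * (cmod (g x))\<^sup>2"
        using sum_squares_bound[of "cmod (f x)" "cmod (g x)"] by (simp add: power2_sum)
      finally show ?thesis .
    qed
    then show "AE x in lborel. norm ((cmod (f x + g x))\<^sup>2)
        \<le> norm (2 * (cmod (f x))\<^sup>2 + 2 * (cmod (g x))\<^sup>2)"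
      by simp
  qed simp
  then show ?thesis by (simp add: square_int_def)
qed

lemma square_int_scale:
  assumes "square_int f"
  shows "square_int (\<lambda>x. c * f x)"
proof -
  have [measurable]: "f \<in> borel_measurable lborel"
    using assms by (auto simp: square_int_def)
  show ?thesis
    using assms by (auto simp: square_int_def norm_mult power_mult_distrib)
qed

lemma square_int_bounded_mult:
  assumes "square_int f" "m \<in> borel_measurable lborel" "AE x in lborel. cmod (m x) \<le> C"
  shows "square_int (\<lambda>x. m x * f x)"
proof -
  have [measurable]: "f \<in> borel_measurable lborel" "m \<in> borel_measurable lborel"
    using assms by (auto simp: square_int_def)
  have "integrable lborel (\<lambda>x. C\<^sup>2 * (cmod (f x))\<^sup>2)"
    using assms by (auto simp: square_int_def)
  then have "integrable lborel (\<lambda>x. (cmod (m x * f x))\<^sup>2)"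
  proof (rule Bochner_Integration.integrable_bound)
    show "AE x in lborel. norm ((cmod (m x * f x))\<^sup>2) \<le> norm (C\<^sup>2 * (cmod (f x))\<^sup>2)"
      using assms(3) by eventually_elim
        (simp add: norm_mult power_mult_distrib mult_right_mono power_mono)
  qed simp
  then show ?thesis by (simp add: square_int_def)
qed

lemma square_int_integrable_inner:
  assumes "square_int f" "square_int g"
  shows "integrable lborel (\<lambda>x. f x \<bullet> g x)"
proof -
  have [measurable]: "f \<in> borel_measurable lborel" "g \<in> borel_measurable lborel"
    using assms by (auto simp: square_int_def)
  have "integrable lborel (\<lambda>x. (cmod (f x))\<^sup>2 + (cmod (g x))\<^sup>2)"
    using assms by (auto simp: square_int_def)
  then show ?thesis
  proof (rule Bochner_Integration.integrable_bound)
    have "\<bar>f x \<bullet> g x\<bar> \<le> (cmod (f x))\<^sup>2 + (cmod (g x))\<^sup>2" for x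
    proof -
      have "\<bar>f x \<bullet> g x\<bar> \<le> cmod (f x) * cmod (g x)"
        by (rule Cauchy_Schwarz_ineq2)
      moreover have "0 \<le> cmod (f x) * cmod (g x)" by simp
      ultimately show ?thesis
        using sum_squares_bound[of "cmod (f x)" "cmod (g x)"] by linarith
    qed
    then show "AE x in lborel. norm (f x \<bullet> g x) \<le> norm ((cmod (f x))\<^sup>2 + (cmod (g x))\<^sup>2)"
      by simp
  qed simp
qed

instantiation l2 :: (euclidean_space) real_inner
begin

lift_definition zero_l2 :: "'a l2" is "\<lambda>_. 0"
  by (simp add: l2_rel_def square_int_def)

lift_definition plus_l2 :: "'a l2 \<Rightarrow> 'a l2 \<Rightarrow> 'a l2" is "\<lambda>f g x. f x + g x"
  by (auto simp: l2_rel_def square_int_add)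

lift_definition uminus_l2 :: "'a l2 \<Rightarrow> 'a l2" is "\<lambda>f x. - f x"
  by (auto simp: l2_rel_def square_int_def)

definition minus_l2 :: "'a l2 \<Rightarrow> 'a l2 \<Rightarrow> 'a l2" where
  "minus_l2 u v = u + - v"

lift_definition scaleR_l2 :: "real \<Rightarrow> 'a l2 \<Rightarrow> 'a l2" is "\<lambda>r f x. r *\<^sub>R f x"
  by (auto simp: l2_rel_def scaleR_conv_of_real square_int_scale)

text \<open>The real part of the usual Hermitian inner product, as \<open>f x \<bullet> g x = Re (f x * cnj (g x))\<close>;
  it induces the usual norm.\<close>

lift_definition inner_l2 :: "'a l2 \<Rightarrow> 'a l2 \<Rightarrow> real" is "\<lambda>f g. \<integral>x. f x \<bullet> g x \<partial>lborel"
  unfolding l2_rel_def square_int_def by (intro integral_cong_AE) auto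

definition norm_l2 :: "'a l2 \<Rightarrow> real" where
  "norm_l2 u = sqrt (inner u u)"

definition sgn_l2 :: "'a l2 \<Rightarrow> 'a l2" where
  "sgn_l2 u = scaleR (inverse (norm u)) u"

definition dist_l2 :: "'a l2 \<Rightarrow> 'a l2 \<Rightarrow> real" where
  "dist_l2 u v = norm (u - v)"

definition uniformity_l2 :: "('a l2 \<times> 'a l2) filter" where
  "uniformity_l2 = (INF e\<in>{0<..}. principal {(u, v). dist u v < e})"

definition open_l2 :: "'a l2 set \<Rightarrow> bool" where
  "open_l2 U \<longleftrightarrow> (\<forall>u\<in>U. eventually (\<lambda>(u', v). u' = u \<longrightarrow> v \<in> U) uniformity)"

instance
proof
  fix u v w :: "'a l2" and r s :: real
  show "u + v + w = u + (v + w)"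
    by transfer (auto simp: l2_rel_def add.assoc intro!: square_int_add)
  show "u + v = v + u"
    by transfer (auto simp: l2_rel_def add.commute intro!: square_int_add)
  show "0 + u = u"
    by transfer (auto simp: l2_rel_def)
  show "- u + u = 0"
    by transfer (auto simp: l2_rel_def square_int_def)
  show "u - v = u + - v"
    by (rule minus_l2_def)
  show "r *\<^sub>R (u + v) = r *\<^sub>R u + r *\<^sub>R v"
    by transfer (auto simp: l2_rel_def scaleR_conv_of_real distrib_left distrib_right mult.assoc
        intro!: square_int_add square_int_scale)
  show "(r + s) *\<^sub>R u = r *\<^sub>R u + s *\<^sub>R u"
    by transfer (auto simp: l2_rel_def scaleR_conv_of_real distrib_left distrib_right mult.assoc
        intro!: square_int_add square_int_scale)
  show "r *\<^sub>R s *\<^sub>R u = (r * s) *\<^sub>R u"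
    by transfer (auto simp: l2_rel_def scaleR_conv_of_real distrib_left distrib_right mult.assoc
        intro!: square_int_scale)
  show "1 *\<^sub>R u = u"
    by transfer (auto simp: l2_rel_def)
  show "sgn u = scaleR (inverse (norm u)) u" by (rule sgn_l2_def)
  show "dist u v = norm (u - v)" by (rule dist_l2_def)
  show "(uniformity :: ('a l2 \<times> 'a l2) filter) = (INF e\<in>{0<..}. principal {(x, y). dist x y < e})"
    by (rule uniformity_l2_def)
  show "open U \<longleftrightarrow> (\<forall>u\<in>U. eventually (\<lambda>(u', v). u' = u \<longrightarrow> v \<in> U) uniformity)" for U :: "'a l2 set"
    by (rule open_l2_def)
  show "inner u v = inner v u"
    by transfer (simp add: inner_commute)
  show "inner (u + v) w = inner u w + inner v w"
    by transfer (simp add: l2_rel_def inner_add_left square_int_integrable_inner)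
  show "inner (r *\<^sub>R u) v = r * inner u v"
    by transfer simp
  show "0 \<le> inner u u"
    by transfer simp
  show "inner u u = 0 \<longleftrightarrow> u = 0"
  proof transfer
    fix f :: "'a \<Rightarrow> complex" assume f: "l2_rel f f"
    then have "(\<integral>x. f x \<bullet> f x \<partial>lborel) = 0 \<longleftrightarrow> (AE x in lborel. f x \<bullet> f x = 0)"
      by (intro integral_nonneg_eq_0_iff_AE) (auto simp: l2_rel_def square_int_integrable_inner)
    with f show "((\<integral>x. f x \<bullet> f x \<partial>lborel) = 0) = l2_rel f (\<lambda>_. 0)"
      by (simp add: l2_rel_def square_int_def)
  qed
  show "norm u = sqrt (inner u u)" by (rule norm_l2_def)
qed

end

lift_definition scaleC_l2 :: "complex \<Rightarrow> 'a::euclidean_space l2 \<Rightarrow> 'a l2" is "\<lambda>c f x. c * f x"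
  by (auto simp: l2_rel_def square_int_scale)

definition bounded_operator :: "('a::euclidean_space l2 \<Rightarrow> 'a l2) \<Rightarrow> bool" where
  "bounded_operator T \<longleftrightarrow> bounded_linear T \<and> (\<forall>c u. T (scaleC_l2 c u) = scaleC_l2 c (T u))"


section \<open>The space \<open>L\<^sup>\<infinity>\<close>\<close>

definition ess_bounded :: "('a::euclidean_space \<Rightarrow> complex) \<Rightarrow> bool" where
  "ess_bounded f \<longleftrightarrow> f \<in> borel_measurable lborel \<and> (\<exists>C. AE x in lborel. cmod (f x) \<le> C)"

definition linf_rel :: "('a::euclidean_space \<Rightarrow> complex) \<Rightarrow> ('a \<Rightarrow> complex) \<Rightarrow> bool" where
  "linf_rel f g \<longleftrightarrow> ess_bounded f \<and> ess_bounded g \<and> (AE x in lborel. f x = g x)"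

quotient_type (overloaded) 'a linf = "'a::euclidean_space \<Rightarrow> complex" / partial: linf_rel
proof (rule part_equivpI)
  show "\<exists>f::'a \<Rightarrow> complex. linf_rel f f"
    by (rule exI[of _ "\<lambda>_. 0"]) (auto simp: linf_rel_def ess_bounded_def)
  show "symp (linf_rel :: ('a \<Rightarrow> complex) \<Rightarrow> _)"
    by (auto simp: symp_def linf_rel_def)
  show "transp (linf_rel :: ('a \<Rightarrow> complex) \<Rightarrow> _)"
    unfolding transp_def linf_rel_def by auto
qed

lemma ess_bounded_add:
  assumes "ess_bounded f" "ess_bounded g"
  shows "ess_bounded (\<lambda>x. f x + g x)"
proof -
  from assms obtain C D where "AE x in lborel. cmod (f x) \<le> C" "AE x in lborel. cmod (g x) \<le> D"
    by (auto simp: ess_bounded_def)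
  then have "AE x in lborel. cmod (f x + g x) \<le> C + D"
    by eventually_elim (rule norm_triangle_mono)
  then show ?thesis using assms by (auto simp: ess_bounded_def)
qed

lemma ess_bounded_mult:
  assumes "ess_bounded f" "ess_bounded g"
  shows "ess_bounded (\<lambda>x. f x * g x)"
proof -
  from assms obtain C D where "AE x in lborel. cmod (f x) \<le> C" "AE x in lborel. cmod (g x) \<le> D"
    by (auto simp: ess_bounded_def)
  then have "AE x in lborel. cmod (f x * g x) \<le> C * D"
    by eventually_elim (simp add: norm_mult mult_mono')
  then show ?thesis using assms by (auto simp: ess_bounded_def)
qed

lemma ess_bounded_const: "ess_bounded (\<lambda>_. c)"
  by (auto simp: ess_bounded_def)

lemma ess_bounded_exp:
  assumes "ess_bounded f"
  shows "ess_bounded (\<lambda>x. exp (f x))"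
proof -
  from assms obtain C where "AE x in lborel. cmod (f x) \<le> C"
    by (auto simp: ess_bounded_def)
  then have "AE x in lborel. cmod (exp (f x)) \<le> exp C"
    by eventually_elim (meson exp_le_cancel_iff norm_exp order_trans)
  moreover have "(\<lambda>x. exp (f x)) \<in> borel_measurable lborel"
    using assms by (auto simp: ess_bounded_def intro: borel_measurable_exp)
  ultimately show ?thesis unfolding ess_bounded_def by blast
qed

definition linf_norm_fun :: "('a::euclidean_space \<Rightarrow> complex) \<Rightarrow> real" where
  "linf_norm_fun f = real_of_ereal (esssup lborel (\<lambda>x. ereal (cmod (f x))))"

lemma ereal_linf_norm_fun:
  fixes f :: "'a::euclidean_space \<Rightarrow> complex"
  assumes "ess_bounded f"
  shows "ereal (linf_norm_fun f) = esssup lborel (\<lambda>x. ereal (cmod (f x)))"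
proof -
  have [measurable]: "f \<in> borel_measurable lborel" using assms by (auto simp: ess_bounded_def)
  obtain C where "AE x in lborel. cmod (f x) \<le> C"
    using assms by (auto simp: ess_bounded_def)
  then have 1: "esssup lborel (\<lambda>x. ereal (cmod (f x))) \<le> ereal C"
    by (intro esssup_I) auto
  have "esssup (lborel :: 'a measure) (\<lambda>x. 0) \<le> esssup lborel (\<lambda>x. ereal (cmod (f x)))"
    by (intro esssup_mono) auto
  then have "0 \<le> esssup lborel (\<lambda>x. ereal (cmod (f x)))"
    by (simp add: esssup_const)
  with 1 show ?thesis
    unfolding linf_norm_fun_def by (intro ereal_real') auto
qed

lemma AE_le_linf_norm_fun:
  assumes "ess_bounded f"
  shows "AE x in lborel. cmod (f x) \<le> linf_norm_fun f"
  using esssup_AE[of "\<lambda>x. ereal (cmod (f x))" lborel]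
  by (simp add: ereal_linf_norm_fun[OF assms, symmetric])

lemma linf_norm_fun_le:
  assumes "ess_bounded f" "AE x in lborel. cmod (f x) \<le> C"
  shows "linf_norm_fun f \<le> C"
proof -
  have [measurable]: "f \<in> borel_measurable lborel" using assms by (auto simp: ess_bounded_def)
  have "esssup lborel (\<lambda>x. ereal (cmod (f x))) \<le> ereal C"
    using assms by (intro esssup_I) auto
  then show ?thesis by (simp add: ereal_linf_norm_fun[OF assms(1), symmetric])
qed

lemma linf_norm_fun_nonneg:
  fixes f :: "'a::euclidean_space \<Rightarrow> complex"
  assumes "ess_bounded f"
  shows "0 \<le> linf_norm_fun f"
proof -
  have "AE x in (lborel :: 'a measure). 0 \<le> linf_norm_fun f"
    using AE_le_linf_norm_fun[OF assms] by eventually_elim (meson norm_ge_zero order_trans)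
  then show ?thesis
    by (simp add: eventually_const_iff ae_filter_eq_bot_iff)
qed

lemma linf_norm_fun_scale_le:
  assumes "ess_bounded f"
  shows "linf_norm_fun (\<lambda>x. r *\<^sub>R f x) \<le> \<bar>r\<bar> * linf_norm_fun f"
proof (rule linf_norm_fun_le)
  show "ess_bounded (\<lambda>x. r *\<^sub>R f x)"
    using assms by (auto simp: scaleR_conv_of_real intro: ess_bounded_mult ess_bounded_const)
  show "AE x in lborel. cmod (r *\<^sub>R f x) \<le> \<bar>r\<bar> * linf_norm_fun f"
    using AE_le_linf_norm_fun[OF assms] by eventually_elim (simp add: mult_left_mono)
qed

instantiation linf :: (euclidean_space) real_normed_vector
begin

lift_definition zero_linf :: "'a linf" is "\<lambda>_. 0"
  by (simp add: linf_rel_def ess_bounded_const)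

lift_definition plus_linf :: "'a linf \<Rightarrow> 'a linf \<Rightarrow> 'a linf" is "\<lambda>f g x. f x + g x"
  by (auto simp: linf_rel_def ess_bounded_add)

lift_definition uminus_linf :: "'a linf \<Rightarrow> 'a linf" is "\<lambda>f x. - f x"
  by (auto simp: linf_rel_def ess_bounded_def)

definition minus_linf :: "'a linf \<Rightarrow> 'a linf \<Rightarrow> 'a linf" where
  "minus_linf u v = u + - v"

lift_definition scaleR_linf :: "real \<Rightarrow> 'a linf \<Rightarrow> 'a linf" is "\<lambda>r f x. r *\<^sub>R f x"
  by (auto simp: linf_rel_def scaleR_conv_of_real ess_bounded_mult ess_bounded_const)

lift_definition norm_linf :: "'a linf \<Rightarrow> real" is linf_norm_fun
  unfolding linf_rel_def ess_bounded_def linf_norm_fun_def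
  by (intro arg_cong[where f = real_of_ereal] esssup_AE_cong) auto

definition sgn_linf :: "'a linf \<Rightarrow> 'a linf" where
  "sgn_linf u = scaleR (inverse (norm u)) u"

definition dist_linf :: "'a linf \<Rightarrow> 'a linf \<Rightarrow> real" where
  "dist_linf u v = norm (u - v)"

definition uniformity_linf :: "('a linf \<times> 'a linf) filter" where
  "uniformity_linf = (INF e\<in>{0<..}. principal {(u, v). dist u v < e})"

definition open_linf :: "'a linf set \<Rightarrow> bool" where
  "open_linf U \<longleftrightarrow> (\<forall>u\<in>U. eventually (\<lambda>(u', v). u' = u \<longrightarrow> v \<in> U) uniformity)"

instance
proof
  fix u v w :: "'a linf" and r s :: real
  show "u + v + w = u + (v + w)"
    by transfer (auto simp: linf_rel_def add.assoc intro!: ess_bounded_add)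
  show "u + v = v + u"
    by transfer (auto simp: linf_rel_def add.commute intro!: ess_bounded_add)
  show "0 + u = u"
    by transfer (auto simp: linf_rel_def)
  show "- u + u = 0"
    by transfer (auto simp: linf_rel_def ess_bounded_const)
  show "u - v = u + - v"
    by (rule minus_linf_def)
  show "r *\<^sub>R (u + v) = r *\<^sub>R u + r *\<^sub>R v"
    by transfer (auto simp: linf_rel_def scaleR_conv_of_real algebra_simps
        intro!: ess_bounded_add ess_bounded_mult ess_bounded_const)
  show "(r + s) *\<^sub>R u = r *\<^sub>R u + s *\<^sub>R u"
    by transfer (auto simp: linf_rel_def scaleR_conv_of_real algebra_simps
        intro!: ess_bounded_add ess_bounded_mult ess_bounded_const)
  show "r *\<^sub>R s *\<^sub>R u = (r * s) *\<^sub>R u"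
    by transfer (auto simp: linf_rel_def scaleR_conv_of_real algebra_simps
        intro!: ess_bounded_mult ess_bounded_const)
  show "1 *\<^sub>R u = u"
    by transfer (auto simp: linf_rel_def)
  show "sgn u = scaleR (inverse (norm u)) u" by (rule sgn_linf_def)
  show "dist u v = norm (u - v)" by (rule dist_linf_def)
  show "(uniformity :: ('a linf \<times> 'a linf) filter) = (INF e\<in>{0<..}. principal {(x, y). dist x y < e})"
    by (rule uniformity_linf_def)
  show "open U \<longleftrightarrow> (\<forall>u\<in>U. eventually (\<lambda>(u', v). u' = u \<longrightarrow> v \<in> U) uniformity)" for U :: "'a linf set"
    by (rule open_linf_def)
  show "norm u = 0 \<longleftrightarrow> u = 0"
  proof transfer
    fix f :: "'a \<Rightarrow> complex" assume "linf_rel f f"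
    then have f: "ess_bounded f" by (simp add: linf_rel_def)
    have "linf_norm_fun f = 0 \<longleftrightarrow> (AE x in lborel. f x = 0)"
    proof
      assume "linf_norm_fun f = 0"
      with AE_le_linf_norm_fun[OF f] show "AE x in lborel. f x = 0" by simp
    next
      assume "AE x in lborel. f x = 0"
      then have "linf_norm_fun f \<le> 0" by (intro linf_norm_fun_le f) auto
      with linf_norm_fun_nonneg[OF f] show "linf_norm_fun f = 0" by simp
    qed
    with f show "(linf_norm_fun f = 0) = linf_rel f (\<lambda>_. 0)"
      by (simp add: linf_rel_def ess_bounded_const)
  qed
  show "norm (u + v) \<le> norm u + norm v"
  proof transfer
    fix f g :: "'a \<Rightarrow> complex" assume "linf_rel f f" "linf_rel g g"
    then have fg: "ess_bounded f" "ess_bounded g" by (simp_all add: linf_rel_def)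
    have "AE x in lborel. cmod (f x + g x) \<le> linf_norm_fun f + linf_norm_fun g"
      using AE_le_linf_norm_fun[OF fg(1)] AE_le_linf_norm_fun[OF fg(2)]
      by eventually_elim (rule norm_triangle_mono)
    then show "linf_norm_fun (\<lambda>x. f x + g x) \<le> linf_norm_fun f + linf_norm_fun g"
      by (intro linf_norm_fun_le ess_bounded_add fg)
  qed
  show "norm (r *\<^sub>R u) = \<bar>r\<bar> * norm u"
  proof transfer
    fix r :: real and f :: "'a \<Rightarrow> complex" assume "linf_rel f f"
    then have f: "ess_bounded f" by (simp add: linf_rel_def)
    then have rf: "ess_bounded (\<lambda>x. r *\<^sub>R f x)"
      by (auto simp: scaleR_conv_of_real intro: ess_bounded_mult ess_bounded_const)
    show "linf_norm_fun (\<lambda>x. r *\<^sub>R f x) = \<bar>r\<bar> * linf_norm_fun f"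
    proof (cases "r = 0")
      case True
      then show ?thesis
        using linf_norm_fun_scale_le[OF f, of r] linf_norm_fun_nonneg[OF rf] by simp
    next
      case False
      have "linf_norm_fun f \<le> \<bar>inverse r\<bar> * linf_norm_fun (\<lambda>x. r *\<^sub>R f x)"
        using linf_norm_fun_scale_le[OF rf, of "inverse r"] False by simp
      then have "\<bar>r\<bar> * linf_norm_fun f \<le> linf_norm_fun (\<lambda>x. r *\<^sub>R f x)"
        using False by (simp add: field_simps)
      with linf_norm_fun_scale_le[OF f, of r] show ?thesis by simp
    qed
  qed
qed

end

lift_definition linf_exp :: "'a::euclidean_space linf \<Rightarrow> 'a linf" is "\<lambda>f x. exp (f x)"
  by (auto simp: linf_rel_def ess_bounded_exp)

lift_definition mult_op :: "'a::euclidean_space linf \<Rightarrow> 'a l2 \<Rightarrow> 'a l2" is "\<lambda>m f x. m x * f x"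
  by (auto simp: l2_rel_def linf_rel_def ess_bounded_def intro: square_int_bounded_mult)


section \<open>Weak derivatives and Sobolev spaces\<close>

text \<open>A list \<open>bs\<close> of standard basis vectors encodes the iterated partial derivative in these
  directions.\<close>

fun iter_partial :: "'a::euclidean_space list \<Rightarrow> ('a \<Rightarrow> real) \<Rightarrow> 'a \<Rightarrow> real" where
  "iter_partial [] \<phi> = \<phi>"
| "iter_partial (b # bs) \<phi> = (\<lambda>x. frechet_derivative (iter_partial bs \<phi>) (at x) b)"

text \<open>If all iterated partial derivatives are (totally) differentiable, they are in particular
  continuous, so this is \<open>C\<^sub>c\<^sup>\<infinity>\<close>.\<close>

definition test_functions :: "('a::euclidean_space \<Rightarrow> real) set" where
  "test_functions = {\<phi>. (\<forall>bs. set bs \<subseteq> Basis \<longrightarrow> iter_partial bs \<phi> differentiable_on UNIV)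
                        \<and> compact (closure {x. \<phi> x \<noteq> 0})}"

definition has_weak_deriv ::
    "'a::euclidean_space list \<Rightarrow> ('a \<Rightarrow> complex) \<Rightarrow> ('a \<Rightarrow> complex) \<Rightarrow> bool" where
  "has_weak_deriv bs f g \<longleftrightarrow>
     (\<forall>\<phi>\<in>test_functions. (\<integral>x. f x * of_real (iter_partial bs \<phi> x) \<partial>lborel)
        = (-1) ^ length bs * (\<integral>x. g x * of_real (\<phi> x) \<partial>lborel))"

definition derivs_upto :: "nat \<Rightarrow> 'a::euclidean_space list set" where
  "derivs_upto k = {bs. set bs \<subseteq> Basis \<and> length bs \<le> k}"

text \<open>Weak derivatives are unique as elements of \<open>L\<^sup>2\<close> or \<open>L\<^sup>\<infinity>\<close>, so the choice operator below
  is only applied to singletons whenever the derivative exists.\<close>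

definition weak_deriv_l2 :: "'a::euclidean_space list \<Rightarrow> 'a l2 \<Rightarrow> 'a l2" where
  "weak_deriv_l2 bs u = (SOME v. has_weak_deriv bs (rep_l2 u) (rep_l2 v))"

definition weak_deriv_linf :: "'a::euclidean_space list \<Rightarrow> 'a linf \<Rightarrow> 'a linf" where
  "weak_deriv_linf bs u = (SOME v. has_weak_deriv bs (rep_linf u) (rep_linf v))"

definition Hk_space :: "nat \<Rightarrow> 'a::euclidean_space l2 set" where
  "Hk_space k = {u. \<forall>bs\<in>derivs_upto k. \<exists>v. has_weak_deriv bs (rep_l2 u) (rep_l2 v)}"

text \<open>The sum runs over ordered tuples of directions, so a mixed derivative is counted once per
  ordering (for \<open>k = 2\<close> this is the Frobenius norm of the Hessian); this is equivalent to the sum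
  over multi-indices.\<close>

definition Hk_norm :: "nat \<Rightarrow> 'a::euclidean_space l2 \<Rightarrow> real" where
  "Hk_norm k u = sqrt (\<Sum>bs\<in>derivs_upto k. (norm (weak_deriv_l2 bs u))\<^sup>2)"

definition Wk_inf_space :: "nat \<Rightarrow> 'a::euclidean_space linf set" where
  "Wk_inf_space k = {u. \<forall>bs\<in>derivs_upto k. \<exists>v. has_weak_deriv bs (rep_linf u) (rep_linf v)}"

definition Wk_inf_norm :: "nat \<Rightarrow> 'a::euclidean_space linf \<Rightarrow> real" where
  "Wk_inf_norm k u = Max ((\<lambda>bs. norm (weak_deriv_linf bs u)) ` derivs_upto k)"


section \<open>Bounded uniformly continuous functions\<close>

text \<open>The target is a subspace \<open>Y\<close> of a vector space with its own norm \<open>N\<close>.\<close>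

definition BUC :: "'b::ab_group_add set \<Rightarrow> ('b \<Rightarrow> real) \<Rightarrow> (real \<Rightarrow> 'b) set" where
  "BUC Y N = {f. (\<forall>t. f t \<in> Y) \<and> (\<exists>M. \<forall>t. N (f t) \<le> M) \<and>
     (\<forall>\<epsilon>>0. \<exists>\<delta>>0. \<forall>s t. \<bar>t - s\<bar> < \<delta> \<longrightarrow> N (f t - f s) < \<epsilon>)}"

definition BUC1 :: "(real \<Rightarrow> 'b::real_normed_vector) set" where
  "BUC1 = {f. f \<in> BUC UNIV norm \<and>
     (\<exists>f'. (\<forall>t. (f has_vector_derivative f' t) (at t)) \<and> f' \<in> BUC UNIV norm)}"

lemma BUC_UNIV_norm:
  "f \<in> BUC UNIV norm \<longleftrightarrow> bounded (range f) \<and> uniformly_continuous_on UNIV f"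
proof -
  have "(\<exists>M. \<forall>t. norm (f t) \<le> M) \<longleftrightarrow> bounded (range f)"
    by (simp add: bounded_iff)
  moreover have "(\<forall>\<epsilon>>0. \<exists>\<delta>>0. \<forall>s t. \<bar>t - s\<bar> < \<delta> \<longrightarrow> norm (f t - f s) < \<epsilon>)
      \<longleftrightarrow> uniformly_continuous_on UNIV f"
    by (simp add: uniformly_continuous_on_def dist_norm)
  ultimately show ?thesis by (simp add: BUC_def)
qed


section \<open>The heat semigroup\<close>

definition heat_kernel :: "real \<Rightarrow> 'a::euclidean_space \<Rightarrow> real" where
  "heat_kernel t x = (4 * pi * t) powr (- (real DIM('a) / 2)) * exp (- (norm x)\<^sup>2 / (4 * t))"

lemma heat_kernel_nonneg: "0 \<le> heat_kernel t x"
  by (simp add: heat_kernel_def)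

lemma heat_kernel_minus_commute: "heat_kernel t (x - y) = heat_kernel t (y - x)"
  by (simp add: heat_kernel_def norm_minus_commute)

lemma borel_measurable_heat_kernel [measurable]: "heat_kernel t \<in> borel_measurable borel"
  unfolding heat_kernel_def[abs_def] by measurable

lemma heat_kernel_eq_prod:
  fixes x :: "'a::euclidean_space"
  assumes "t > 0"
  shows "heat_kernel t x = (\<Prod>b\<in>Basis. normal_density 0 (sqrt (2 * t)) (x \<bullet> b))"
proof -
  have "(\<Prod>b\<in>(Basis::'a set). 1 / sqrt (4 * pi * t)) = (4 * pi * t) powr (- (real DIM('a) / 2))"
  proof -
    have "(4 * pi * t) powr (- (real DIM('a) / 2)) = ((4 * pi * t) powr (- (1 / 2))) powr real DIM('a)"
      unfolding powr_powr by simp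
    also have "\<dots> = ((4 * pi * t) powr (- (1 / 2))) ^ DIM('a)"
      using assms by (intro powr_realpow) simp
    also have "(4 * pi * t) powr (- (1 / 2)) = 1 / sqrt (4 * pi * t)"
      using assms by (simp only: powr_minus_divide) (simp add: powr_half_sqrt)
    finally show ?thesis by simp
  qed
  moreover have "(\<Prod>b\<in>(Basis::'a set). exp (- (x \<bullet> b)\<^sup>2 / (4 * t))) = exp (- (norm x)\<^sup>2 / (4 * t))"
  proof -
    have "(norm x)\<^sup>2 = (\<Sum>b\<in>Basis. (x \<bullet> b)\<^sup>2)"
      unfolding power2_norm_eq_inner by (subst euclidean_inner) (simp add: power2_eq_square)
    then show ?thesis
      by (simp add: exp_sum[symmetric] sum_divide_distrib sum_negf)
  qed
  moreover have "normal_density 0 (sqrt (2 * t)) (x \<bullet> b)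
      = 1 / sqrt (4 * pi * t) * exp (- (x \<bullet> b)\<^sup>2 / (4 * t))" for b
    using assms by (simp add: normal_density_def)
  ultimately show ?thesis
    unfolding heat_kernel_def by (simp only: prod.distrib)
qed

lemma nn_integral_heat_kernel:
  fixes y :: "'a::euclidean_space"
  assumes "t > 0"
  shows "(\<integral>\<^sup>+x. ennreal (heat_kernel t (x - y)) \<partial>lborel) = 1"
proof -
  have "(\<integral>\<^sup>+x. ennreal (heat_kernel t (x - y)) \<partial>lborel)
      = (\<integral>\<^sup>+x. ennreal (heat_kernel t (x::'a)) \<partial>distr lborel borel ((+) (- y)))"
    by (subst nn_integral_distr) simp_all
  also have "\<dots> = (\<integral>\<^sup>+x. (\<Prod>b\<in>(Basis::'a set). ennreal (normal_density 0 (sqrt (2 * t)) (x \<bullet> b))) \<partial>lborel)"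
    using assms by (simp add: lborel_distr_plus heat_kernel_eq_prod prod_ennreal)
  also have "\<dots> = (\<Prod>b\<in>(Basis::'a set). (\<integral>\<^sup>+x. ennreal (normal_density 0 (sqrt (2 * t)) x) \<partial>lborel))"
    by (rule nn_integral_lborel_prod) auto
  also have "\<dots> = 1"
    using assms by (simp add: nn_integral_eq_integral)
  finally show ?thesis .
qed

lemma square_int_heat_convolution:
  fixes f :: "'a::euclidean_space \<Rightarrow> complex"
  assumes "t > 0" "square_int f"
  shows "square_int (\<lambda>x. \<integral>y. of_real (heat_kernel t (x - y)) * f y \<partial>lborel)"
proof -
  let ?K = "\<lambda>x y::'a. ennreal (heat_kernel t (x - y))"
  let ?g = "\<lambda>x. \<integral>y. of_real (heat_kernel t (x - y)) * f y \<partial>lborel"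
  have [measurable]: "f \<in> borel_measurable borel"
    using assms by (simp add: square_int_def)
  have g [measurable]: "?g \<in> borel_measurable lborel"
    by measurable
  have bound: "ennreal ((cmod (?g x))\<^sup>2) \<le> (\<integral>\<^sup>+y. ?K x y * ennreal ((cmod (f y))\<^sup>2) \<partial>lborel)" for x
  proof -
    let ?a = "\<lambda>y. ennreal (sqrt (heat_kernel t (x - y)))"
    have "ennreal (cmod (?g x)) \<le> (\<integral>\<^sup>+y. ?a y * (?a y * ennreal (cmod (f y))) \<partial>lborel)"
    proof (cases "integrable lborel (\<lambda>y. of_real (heat_kernel t (x - y)) * f y)")
      case True
      then have "ennreal (cmod (?g x))
          \<le> (\<integral>\<^sup>+y. ennreal (cmod (of_real (heat_kernel t (x - y)) * f y)) \<partial>lborel)"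
        by (rule integral_norm_bound_ennreal)
      also have "\<dots> = (\<integral>\<^sup>+y. ?a y * (?a y * ennreal (cmod (f y))) \<partial>lborel)"
        by (intro nn_integral_cong)
          (simp add: norm_mult heat_kernel_nonneg ennreal_mult[symmetric] mult.assoc[symmetric])
      finally show ?thesis .
    qed (simp add: not_integrable_integral_eq)
    then have "(ennreal (cmod (?g x)))\<^sup>2
        \<le> (\<integral>\<^sup>+y. ?a y * (?a y * ennreal (cmod (f y))) \<partial>lborel)\<^sup>2"
      by (rule power_mono) simp
    also have "\<dots> \<le> (\<integral>\<^sup>+y. (?a y)\<^sup>2 \<partial>lborel) * (\<integral>\<^sup>+y. (?a y * ennreal (cmod (f y)))\<^sup>2 \<partial>lborel)"
      by (rule Cauchy_Schwarz_nn_integral) measurable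
    also have "(\<integral>\<^sup>+y. (?a y)\<^sup>2 \<partial>lborel) = 1"
      using nn_integral_heat_kernel[OF assms(1), of x]
      by (simp add: ennreal_power heat_kernel_nonneg heat_kernel_minus_commute[of t x])
    also have "(\<integral>\<^sup>+y. (?a y * ennreal (cmod (f y)))\<^sup>2 \<partial>lborel)
        = (\<integral>\<^sup>+y. ?K x y * ennreal ((cmod (f y))\<^sup>2) \<partial>lborel)"
      by (simp add: power_mult_distrib ennreal_power heat_kernel_nonneg)
    finally show ?thesis by (simp add: ennreal_power)
  qed
  have "(\<integral>\<^sup>+x. ennreal ((cmod (?g x))\<^sup>2) \<partial>lborel)
      \<le> (\<integral>\<^sup>+x. (\<integral>\<^sup>+y. ?K x y * ennreal ((cmod (f y))\<^sup>2) \<partial>lborel) \<partial>lborel)"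
    by (intro nn_integral_mono bound)
  also have "\<dots> = (\<integral>\<^sup>+y. (\<integral>\<^sup>+x. ?K x y * ennreal ((cmod (f y))\<^sup>2) \<partial>lborel) \<partial>lborel)"
    by (rule lborel_pair.Fubini') measurable
  also have "\<dots> = (\<integral>\<^sup>+y. ennreal ((cmod (f y))\<^sup>2) \<partial>lborel)"
    by (simp add: nn_integral_multc nn_integral_heat_kernel[OF assms(1)])
  also have "\<dots> < \<infinity>"
    using assms(2) by (simp add: square_int_def integrable_iff_bounded)
  finally have "integrable lborel (\<lambda>x. (cmod (?g x))\<^sup>2)"
    by (intro integrableI_bounded) auto
  with g show ?thesis by (simp add: square_int_def)
qed

lift_definition heat :: "real \<Rightarrow> 'a::euclidean_space l2 \<Rightarrow> 'a l2" is
  "\<lambda>t f. if t > 0 then (\<lambda>x. \<integral>y. of_real (heat_kernel t (x - y)) * f y \<partial>lborel) else f"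
proof -
  fix t :: real and f g :: "'a \<Rightarrow> complex"
  assume fg: "l2_rel f g"
  then have [measurable]: "f \<in> borel_measurable borel" "g \<in> borel_measurable borel"
    by (simp_all add: l2_rel_def square_int_def)
  have "(\<integral>y. of_real (heat_kernel t (x - y)) * f y \<partial>lborel)
      = (\<integral>y. of_real (heat_kernel t (x - y)) * g y \<partial>lborel)" for x
    using fg by (intro integral_cong_AE) (auto simp: l2_rel_def)
  with fg show "l2_rel
      (if t > 0 then (\<lambda>x. \<integral>y. of_real (heat_kernel t (x - y)) * f y \<partial>lborel) else f)
      (if t > 0 then (\<lambda>x. \<integral>y. of_real (heat_kernel t (x - y)) * g y \<partial>lborel) else g)"
    by (simp add: l2_rel_def square_int_heat_convolution)
qed


section \<open>Evolution families and splitting products\<close>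

text \<open>\<open>W t s\<close> is only constrained for \<open>s \<le> t\<close>.\<close>

definition evolution_family :: "(real \<Rightarrow> real \<Rightarrow> 'a::euclidean_space l2 \<Rightarrow> 'a l2) \<Rightarrow> bool" where
  "evolution_family W \<longleftrightarrow>
     (\<forall>s t. s \<le> t \<longrightarrow> bounded_operator (W t s)) \<and>
     (\<forall>s r t. s \<le> r \<and> r \<le> t \<longrightarrow> W t r \<circ> W r s = W t s) \<and>
     (\<forall>t. W t t = id) \<and>
     (\<forall>u. continuous_on {(t, s). s \<le> t} (\<lambda>(t, s). W t s u))"

text \<open>The variation of constants formula. The integrand is continuous in \<open>r\<close> when \<open>V\<close> is
  continuous in \<open>L\<^sup>\<infinity>\<close>, so the gauge integral is the Riemann integral in \<open>L\<^sup>2\<close>.\<close>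

definition solves_perturbed_heat ::
    "(real \<Rightarrow> 'a::euclidean_space linf) \<Rightarrow> (real \<Rightarrow> real \<Rightarrow> 'a l2 \<Rightarrow> 'a l2) \<Rightarrow> bool" where
  "solves_perturbed_heat V W \<longleftrightarrow>
     (\<forall>s t u. s \<le> t \<longrightarrow>
        ((\<lambda>r. heat (t - r) (mult_op (V r) (W r s u))) has_integral (W t s u - heat (t - s) u)) {s..t})"

text \<open>\<open>ordered_prod U n = U (n - 1) \<circ> \<dots> \<circ> U 1 \<circ> U 0\<close>\<close>

primrec ordered_prod :: "(nat \<Rightarrow> 'b \<Rightarrow> 'b) \<Rightarrow> nat \<Rightarrow> 'b \<Rightarrow> 'b" where
  "ordered_prod U 0 = id"
| "ordered_prod U (Suc n) = U n \<circ> ordered_prod U n"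

end

theory Submission
  imports Defs
begin

text \<open>Regularity in \<open>H\<^sup>2\<close> is only used through bounds on first and second difference quotients.
  Such bounds are inherited by convolutions, and by products with functions whose difference
  quotients are bounded uniformly; and since the heat kernel is even, an average of second
  differences gives \<open>e\<^bsup>t\<Delta>\<^esup>u - u = O(t)\<close>. On a step of length \<open>h\<close> starting at \<open>s\<close>, both the evolution
  family and the splitting step therefore agree with \<open>e\<^bsup>h\<Delta>\<^esup>x + h V(s) x\<close> up to \<open>O(h\<^sup>2)\<close>, and
  multiplication by \<open>e\<^bsup>hV(s)\<^esup>\<close> enlarges the difference quotients by a factor of at most \<open>e\<^bsup>Ah\<^esup>\<close>.
  Telescoping the product against the uniformly bounded evolution family gives the global error.
  Weak derivatives are converted into difference quotients by testing, Fubini and the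
  fundamental lemma of the calculus of variations, so neither the Fourier transform nor the
  completeness of \<open>L\<^sup>2\<close> is needed.\<close>

subsection \<open>Smooth bump functions\<close>

text \<open>The decisive choice is which orbit has to be regular. Every local error is taken at a
  point of the splitting orbit, whose factors are explicit: heat steps preserve the
  difference-quotient bounds, and multiplications enlarge them in a controlled way. The exact
  evolution \<open>W\<close> enters only through Duhamel's formula and a bound on its norm.

  This is why a multiplication over a step of length h must cost a factor exp(A h) with A
  independent of h: up to n such factors multiply to at most exp(A t0), whereas a fixed factor above
  1 would grow with n.

  In the local expansion a commutator estimate for the Laplacian and V(s) is replaced by two
  comparisons with the same first-order term h V(s) x. Removing the heat semigroup from V(s) x costs
  O(h) because V(s) x inherits bounded second differences, which uses two spatial derivatives of V;
  freezing V(r) at V(s) costs O(h) because V is Lipschitz in time.\<close>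

definition inv_exp :: "nat \<Rightarrow> real \<Rightarrow> real" where
  "inv_exp k x = (if x > 0 then exp (- (1 / x)) / x ^ k else 0)"

lemma inv_exp_nonneg: "0 \<le> inv_exp k x"
  by (simp add: inv_exp_def)

text \<open>A single term of the exponential series at \<open>1 / x\<close>, the one of order
  \<open>Suc k\<close>, gives this. Linear decay at the origin is what differentiability at 0 will
  require.\<close>

lemma inv_exp_le: "inv_exp k x \<le> fact (Suc k) * \<bar>x\<bar>"
proof (cases "x > 0")
  case True
  have "(1 / x) ^ Suc k / fact (Suc k) \<le> exp (1 / x)"
  proof -
    have "(\<lambda>n. (1 / x) ^ n /\<^sub>R fact n) sums exp (1 / x)"
      by (rule exp_converges)
    then have "(\<Sum>n\<in>{Suc k}. (1 / x) ^ n /\<^sub>R fact n) \<le> (\<Sum>n. (1 / x) ^ n /\<^sub>R fact n)"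
      using True by (intro sum_le_suminf) (auto simp: sums_iff)
    also have "\<dots> = exp (1 / x)"
      by (simp add: exp_def)
    finally show ?thesis by (simp add: field_simps)
  qed
  then have "(1 / x) ^ Suc k \<le> exp (1 / x) * fact (Suc k)"
    by (simp only: pos_divide_le_eq fact_gt_zero)
  then have "exp (- (1 / x)) * (1 / x) ^ Suc k \<le> exp (- (1 / x)) * (exp (1 / x) * fact (Suc k))"
    by (intro mult_left_mono) auto
  also have "\<dots> = fact (Suc k)"
    by (simp only: mult.assoc[symmetric] exp_add[symmetric]) simp
  finally have "exp (- (1 / x)) * (1 / x) ^ Suc k * x \<le> fact (Suc k) * x"
    using True by (intro mult_right_mono) auto
  moreover have "exp (- (1 / x)) * (1 / x) ^ Suc k * x = exp (- (1 / x)) / x ^ k"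
    using True by (simp add: field_simps)
  ultimately show ?thesis using True by (simp add: inv_exp_def)
qed (simp add: inv_exp_def mult_nonneg_nonpos del: fact_Suc)

text \<open>The index \<open>k\<close> exists for this formula: differentiating
  \<open>exp (- (1 / x)) / x ^ k\<close> raises the power of \<open>1 / x\<close> by one or two, so
  derivatives stay in the span of the family.\<close>

lemma inv_exp_has_derivative:
  "(inv_exp k has_real_derivative inv_exp (k + 2) x - real k * inv_exp (k + 1) x) (at x)"
proof -
  consider "x > 0" | "x < 0" | "x = 0" by linarith
  then show ?thesis
  proof cases
    case 1
    have "((\<lambda>x. exp (- (1 / x)) / x ^ k) has_real_derivative inv_exp (k + 2) x - real k * inv_exp (k + 1) x) (at x)"
      using 1
      apply (auto intro!: derivative_eq_intros simp: inv_exp_def)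
      apply (cases k)
      apply (auto simp: field_simps power2_eq_square)
      done
    then show ?thesis
      by (rule has_field_derivative_transform_within_open[where S="{0<..}"]) (use 1 in \<open>auto simp: inv_exp_def\<close>)
  next
    case 2
    have "((\<lambda>x. 0) has_real_derivative 0) (at x)" by simp
    then have "(inv_exp k has_real_derivative 0) (at x)"
      by (rule has_field_derivative_transform_within_open[where S="{..<0}"]) (use 2 in \<open>auto simp: inv_exp_def\<close>)
    then show ?thesis using 2 by (simp add: inv_exp_def)
  next
    case 3
    \<comment> \<open>The difference quotient of \<open>inv_exp k\<close> at 0 is
      \<open>inv_exp (Suc k)\<close>, as raising the index absorbs the division by
      \<open>h\<close>.\<close>
    have "((\<lambda>h. inv_exp (Suc k) h) \<longlongrightarrow> 0) (at 0)"
    proof (rule Lim_null_comparison)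
      show "\<forall>\<^sub>F h in at 0. norm (inv_exp (Suc k) h) \<le> fact (Suc (Suc k)) * \<bar>h\<bar>"
        using inv_exp_le[of "Suc k"] by (simp add: inv_exp_nonneg)
      show "((\<lambda>h::real. fact (Suc (Suc k)) * \<bar>h\<bar>) \<longlongrightarrow> 0) (at 0)"
        by (auto intro!: tendsto_eq_intros)
    qed
    moreover have "inv_exp (Suc k) h = (inv_exp k (0 + h) - inv_exp k 0) / h" for h
      by (simp add: inv_exp_def)
    ultimately have "(inv_exp k has_real_derivative 0) (at 0)"
      by (simp add: DERIV_def)
    then show ?thesis using 3 by (simp add: inv_exp_def)
  qed
qed

text \<open>The derivative of an exponential factor is a combination of such factors, so this class is
  closed under partial derivatives; that makes its members smooth in the sense of
  \<open>test_functions\<close>.\<close>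

inductive bump_algebra :: "('a::euclidean_space \<Rightarrow> real) \<Rightarrow> bool" where
  const: "bump_algebra (\<lambda>x. c)"
| affine: "bump_algebra (\<lambda>x. inv_exp k (c * (x \<bullet> b) + d))"
| add: "bump_algebra f \<Longrightarrow> bump_algebra g \<Longrightarrow> bump_algebra (\<lambda>x. f x + g x)"
| mult: "bump_algebra f \<Longrightarrow> bump_algebra g \<Longrightarrow> bump_algebra (\<lambda>x. f x * g x)"

lemma bump_algebra_deriv:
  assumes "bump_algebra f"
  shows "\<exists>f'. (\<forall>x. (f has_derivative f' x) (at x)) \<and> (\<forall>v. bump_algebra (\<lambda>x. f' x v))"
  using assms
proof induction
  case (const c)
  show ?case
    by (rule exI[of _ "\<lambda>_ _. 0"]) (auto intro: bump_algebra.const)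
next
  case (affine k c b d)
  let ?y = "\<lambda>x. c * (x \<bullet> b) + d"
  \<comment> \<open>The derivative is written with \<open>+\<close> and the constant factor
    \<open>- real k\<close> so that it is literally an expression built by the introduction
    rules.\<close>
  let ?f' = "\<lambda>x v. (inv_exp (k + 2) (?y x) + (- real k) * inv_exp (k + 1) (?y x)) * (c * (v \<bullet> b))"
  have "((\<lambda>x. inv_exp k (?y x)) has_derivative ?f' x) (at x)" for x
  proof -
    have "(?y has_derivative (\<lambda>v. c * (v \<bullet> b))) (at x)"
      by (auto intro!: derivative_eq_intros)
    from has_derivative_compose[OF this inv_exp_has_derivative[of k "?y x", unfolded has_field_derivative_def]]
    show ?thesis by simp
  qed
  moreover have "bump_algebra (\<lambda>x. ?f' x v)" for v
    by (intro bump_algebra.intros)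
  ultimately show ?case by (intro exI[of _ ?f'] conjI allI) assumption+
next
  case (add f g)
  then obtain f' g' where "\<forall>x. (f has_derivative f' x) (at x)" "\<forall>v. bump_algebra (\<lambda>x. f' x v)"
    "\<forall>x. (g has_derivative g' x) (at x)" "\<forall>v. bump_algebra (\<lambda>x. g' x v)" by auto
  then show ?case
    by (intro exI[of _ "\<lambda>x v. f' x v + g' x v"] conjI allI
        has_derivative_add bump_algebra.add; simp)
next
  case (mult f g)
  then obtain f' g' where "\<forall>x. (f has_derivative f' x) (at x)" "\<forall>v. bump_algebra (\<lambda>x. f' x v)"
    "\<forall>x. (g has_derivative g' x) (at x)" "\<forall>v. bump_algebra (\<lambda>x. g' x v)" by auto
  with mult show ?case
    by (intro exI[of _ "\<lambda>x v. f x * g' x v + f' x v * g x"] conjI allI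
        has_derivative_mult bump_algebra.add bump_algebra.mult; simp)
qed

lemma bump_algebra_iter_partial:
  assumes "bump_algebra f"
  shows "bump_algebra (iter_partial bs f)"
proof (induction bs)
  case (Cons b bs)
  then obtain f' where f': "\<forall>x. (iter_partial bs f has_derivative f' x) (at x)" "\<forall>v. bump_algebra (\<lambda>x. f' x v)"
    using bump_algebra_deriv by blast
  then have "iter_partial (b # bs) f = (\<lambda>x. f' x b)"
    using frechet_derivative_at[of "iter_partial bs f"] by (simp add: fun_eq_iff) (metis)
  with f' show ?case by simp
qed (simp add: assms)

lemma bump_algebra_prod:
  assumes "finite A" "\<And>i. i \<in> A \<Longrightarrow> bump_algebra (f i)"
  shows "bump_algebra (\<lambda>x. \<Prod>i\<in>A. f i x)"
  using assms by (induction A rule: finite_induct) (simp_all add: bump_algebra.const bump_algebra.mult)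

text \<open>Rescaling the argument of \<open>exp (- 1 / y)\<close> by \<open>Suc n\<close> keeps the support equal to the box while
  the values on it increase to \<open>1\<close>.\<close>

definition box_bump :: "nat \<Rightarrow> 'a::euclidean_space \<Rightarrow> 'a \<Rightarrow> 'a \<Rightarrow> real" where
  "box_bump n a c x = (\<Prod>b\<in>Basis. inv_exp 0 (real (Suc n) * (x \<bullet> b) + (- real (Suc n) * (a \<bullet> b)))
      * inv_exp 0 (- real (Suc n) * (x \<bullet> b) + real (Suc n) * (c \<bullet> b)))"

lemma box_bump_eq_0: "x \<notin> box a c \<Longrightarrow> box_bump n a c x = 0"
proof -
  assume "x \<notin> box a c"
  then obtain b where "b \<in> Basis" "x \<bullet> b \<le> a \<bullet> b \<or> c \<bullet> b \<le> x \<bullet> b"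
    by (auto simp: mem_box not_less)
  then have "inv_exp 0 (real (Suc n) * (x \<bullet> b) + (- real (Suc n) * (a \<bullet> b)))
      * inv_exp 0 (- real (Suc n) * (x \<bullet> b) + real (Suc n) * (c \<bullet> b)) = 0"
    by (auto simp: inv_exp_def not_less mult_left_mono simp del: of_nat_Suc)
  with \<open>b \<in> Basis\<close> show ?thesis
    unfolding box_bump_def by (intro prod_zero) auto
qed

lemma inv_exp_0_le_1: "inv_exp 0 x \<le> 1"
  by (simp add: inv_exp_def)

lemma box_bump_bounds: "0 \<le> box_bump n a c x" "box_bump n a c x \<le> 1"
  unfolding box_bump_def
  by (auto intro!: prod_nonneg prod_le_1 mult_le_one simp: inv_exp_nonneg inv_exp_0_le_1)

lemma box_bump_tendsto: "(\<lambda>n. box_bump n a c x) \<longlonglongrightarrow> indicator (box a c) x"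
proof (cases "x \<in> box a c")
  case True
  have *: "(\<lambda>n. inv_exp 0 (real (Suc n) * y)) \<longlonglongrightarrow> 1" if "y > 0" for y
  proof -
    have "(\<lambda>n. exp (- (inverse (real (Suc n)) * inverse y))) \<longlonglongrightarrow> exp (- (0 * inverse y))"
      by (intro tendsto_intros LIMSEQ_inverse_real_of_nat)
    then show ?thesis
      using that by (simp add: inv_exp_def field_simps del: of_nat_Suc)
  qed
  have "(\<lambda>n. box_bump n a c x) \<longlonglongrightarrow> (\<Prod>b\<in>(Basis::'a set). 1 * 1)"
    unfolding box_bump_def
  proof (intro tendsto_prod tendsto_mult)
    fix b :: 'a assume "b \<in> Basis"
    with True have "a \<bullet> b < x \<bullet> b" "x \<bullet> b < c \<bullet> b" by (auto simp: mem_box)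
    with *[of "x \<bullet> b - a \<bullet> b"] *[of "c \<bullet> b - x \<bullet> b"]
    show "(\<lambda>n. inv_exp 0 (real (Suc n) * (x \<bullet> b) + (- real (Suc n) * (a \<bullet> b)))) \<longlonglongrightarrow> 1"
      "(\<lambda>n. inv_exp 0 (- real (Suc n) * (x \<bullet> b) + real (Suc n) * (c \<bullet> b))) \<longlonglongrightarrow> 1"
      by (simp_all add: algebra_simps del: of_nat_Suc)
  qed
  with True show ?thesis by simp
qed (simp add: box_bump_eq_0)

lemma box_bump_test: "box_bump n a c \<in> test_functions"
proof -
  have "bump_algebra (box_bump n a c)"
    unfolding box_bump_def[abs_def]
    by (intro bump_algebra_prod bump_algebra.mult bump_algebra.affine) auto
  then have "bump_algebra (iter_partial bs (box_bump n a c))" for bs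
    by (rule bump_algebra_iter_partial)
  then have "iter_partial bs (box_bump n a c) differentiable_on UNIV" for bs
    using bump_algebra_deriv by (metis differentiable_def differentiable_at_imp_differentiable_on)
  moreover have "closure {x. box_bump n a c x \<noteq> 0} \<subseteq> cbox a c"
  proof (rule closure_minimal)
    show "{x. box_bump n a c x \<noteq> 0} \<subseteq> cbox a c"
      using box_bump_eq_0 box_subset_cbox by blast
  qed auto
  then have "compact (closure {x. box_bump n a c x \<noteq> 0})"
    by (metis bounded_cbox bounded_subset closed_closure compact_eq_bounded_closed)
  ultimately show ?thesis by (simp add: test_functions_def)
qed

subsection \<open>Test functions\<close>

text \<open>\<open>frechet_derivative\<close> is a choice operator, so it suffices that both sides
  admit the same derivatives. The identity then also holds at points without a derivative, and
  \<open>iter_partial_shift\<close> becomes a plain induction.\<close>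

lemma frechet_derivative_shift:
  "frechet_derivative (\<lambda>x. f (x - a)) (at x) = frechet_derivative f (at (x - a))"
proof -
  have "((\<lambda>x. f (x - a)) has_derivative D) (at x) \<longleftrightarrow> (f has_derivative D) (at (x - a))" for D
  proof
    assume "((\<lambda>x. f (x - a)) has_derivative D) (at x)"
    then have "((\<lambda>x. f (x - a)) has_derivative D) (at ((x - a) + a))" by simp
    from has_derivative_compose[of "\<lambda>x. x + a" "\<lambda>v. v" "x - a" UNIV "\<lambda>x. f (x - a)" D, OF _ this]
    show "(f has_derivative D) (at (x - a))"
      by (simp add: has_derivative_add_const)
  next
    assume "(f has_derivative D) (at (x - a))"
    from has_derivative_compose[of "\<lambda>x. x - a" "\<lambda>v. v" x UNIV f D, OF _ this]
    show "((\<lambda>x. f (x - a)) has_derivative D) (at x)"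
      by (simp add: has_derivative_diff[OF has_derivative_ident has_derivative_const, simplified])
  qed
  then show ?thesis by (simp add: frechet_derivative_def)
qed

lemma iter_partial_shift: "iter_partial bs (\<lambda>x. f (x - a)) = (\<lambda>x. iter_partial bs f (x - a))"
  by (induction bs) (simp_all add: frechet_derivative_shift)

lemma test_functions_shift:
  assumes "\<phi> \<in> test_functions"
  shows "(\<lambda>x. \<phi> (x - a)) \<in> test_functions"
proof -
  have "iter_partial bs (\<lambda>x. \<phi> (x - a)) differentiable_on UNIV" if "set bs \<subseteq> Basis" for bs
  proof -
    have "iter_partial bs \<phi> differentiable (at y)" for y
      using assms that by (auto simp: test_functions_def differentiable_on_def)
    then have "(\<lambda>x. iter_partial bs \<phi> (x - a)) differentiable (at x)" for x
      by (intro differentiable_compose[of "iter_partial bs \<phi>" "\<lambda>x. x - a"]) (auto intro!: derivative_intros)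
    then show ?thesis
      by (simp add: iter_partial_shift differentiable_on_def)
  qed
  moreover have "{x. \<phi> (x - a) \<noteq> 0} = (+) a ` {x. \<phi> x \<noteq> 0}"
    by (auto simp: image_iff intro!: exI[of _ "_ - a"])
  then have "closure {x. \<phi> (x - a) \<noteq> 0} = (+) a ` closure {x. \<phi> x \<noteq> 0}"
    by (simp add: closure_translation)
  then have "compact (closure {x. \<phi> (x - a) \<noteq> 0})"
    using assms by (simp add: test_functions_def compact_translation)
  ultimately show ?thesis by (simp add: test_functions_def)
qed

lemma iter_partial_append: "iter_partial (as @ bs) f = iter_partial as (iter_partial bs f)"
  by (induction as) simp_all

text \<open>The complement of the closed support is open, so a partial derivative that vanishes
  there vanishes in a neighbourhood of each such point, and so does the next one.\<close>

lemma iter_partial_outside_support: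
  assumes "x \<notin> closure {x. \<phi> x \<noteq> 0}"
  shows "iter_partial bs \<phi> x = 0"
  using assms
proof (induction bs arbitrary: x)
  case Nil
  then show ?case using closure_subset[of "{x. \<phi> x \<noteq> 0}"] by auto
next
  case (Cons b bs)
  have "((\<lambda>_. 0) has_derivative (\<lambda>_. 0)) (at x)" by simp
  then have "(iter_partial bs \<phi> has_derivative (\<lambda>_. 0)) (at x)"
    by (rule has_derivative_transform_within_open[where s="- closure {x. \<phi> x \<noteq> 0}"])
      (use Cons in auto)
  then show ?case by (simp add: frechet_derivative_at[symmetric])
qed

lemma test_functions_iter_partial:
  assumes "\<phi> \<in> test_functions" "set bs \<subseteq> Basis"
  shows "iter_partial bs \<phi> \<in> test_functions"
proof -
  have "iter_partial cs (iter_partial bs \<phi>) differentiable_on UNIV" if "set cs \<subseteq> Basis" for cs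
  proof -
    have "iter_partial (cs @ bs) \<phi> differentiable_on UNIV"
      using assms that by (simp add: test_functions_def)
    then show ?thesis by (simp add: iter_partial_append)
  qed
  moreover have "closure {x. iter_partial bs \<phi> x \<noteq> 0} \<subseteq> closure {x. \<phi> x \<noteq> 0}"
    by (rule closure_minimal) (use iter_partial_outside_support in auto)
  then have "compact (closure {x. iter_partial bs \<phi> x \<noteq> 0})"
    using assms by (auto simp: test_functions_def compact_eq_bounded_closed intro: bounded_subset)
  ultimately show ?thesis by (simp add: test_functions_def)
qed

lemma test_functions_differentiable:
  assumes "\<phi> \<in> test_functions"
  shows "(\<phi> has_derivative frechet_derivative \<phi> (at x)) (at x)"
proof -
  have "\<forall>bs. set bs \<subseteq> Basis \<longrightarrow> iter_partial bs \<phi> differentiable_on UNIV"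
    using assms by (simp add: test_functions_def)
  from this[rule_format, of "[]"] have "\<phi> differentiable_on UNIV"
    by simp
  then show ?thesis
    by (simp add: differentiable_on_def frechet_derivative_works)
qed

lemma test_functions_continuous:
  assumes "\<phi> \<in> test_functions"
  shows "continuous_on UNIV \<phi>"
  using test_functions_differentiable[OF assms]
  by (meson continuous_at_imp_continuous_on has_derivative_continuous)

lemma test_functions_bounded_support:
  assumes "\<phi> \<in> test_functions"
  obtains R where "\<And>x. x \<notin> cball 0 R \<Longrightarrow> \<phi> x = 0"
proof -
  have "bounded {x. \<phi> x \<noteq> 0}"
    using assms by (auto simp: test_functions_def intro: bounded_subset[OF compact_imp_bounded closure_subset])
  then obtain R where "\<forall>x. \<phi> x \<noteq> 0 \<longrightarrow> norm x \<le> R"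
    unfolding bounded_iff by blast
  then show ?thesis using that[of R] by auto
qed

lemma test_functions_bounded:
  assumes "\<phi> \<in> test_functions"
  obtains C where "\<And>x. \<bar>\<phi> x\<bar> \<le> C"
proof -
  obtain R where R: "\<And>x. x \<notin> cball 0 R \<Longrightarrow> \<phi> x = 0"
    using test_functions_bounded_support[OF assms] by blast
  have "compact (\<phi> ` cball 0 R)"
    by (intro compact_continuous_image continuous_on_subset[OF test_functions_continuous[OF assms]]) auto
  from compact_imp_bounded[OF this]
  obtain C where C: "\<forall>y\<in>\<phi> ` cball 0 R. norm y \<le> C"
    unfolding bounded_iff by (rule exE)
  have "\<bar>\<phi> x\<bar> \<le> \<bar>C\<bar>" for x
  proof (cases "x \<in> cball 0 R")
    case True
    with C have "norm (\<phi> x) \<le> C" by blast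
    then show ?thesis by simp
  qed (simp add: R)
  then show ?thesis using that by blast
qed

lemma test_functions_measurable:
  "\<phi> \<in> test_functions \<Longrightarrow> \<phi> \<in> borel_measurable borel"
  using borel_measurable_continuous_onI test_functions_continuous by blast

lemma frechet_derivative_eq_sum:
  assumes "\<phi> \<in> test_functions"
  shows "frechet_derivative \<phi> (at x) z = (\<Sum>b\<in>Basis. (z \<bullet> b) * iter_partial [b] \<phi> x)"
proof -
  have "linear (frechet_derivative \<phi> (at x))"
    using test_functions_differentiable[OF assms] by (rule has_derivative_linear)
  then have "frechet_derivative \<phi> (at x) (\<Sum>b\<in>Basis. (z \<bullet> b) *\<^sub>R b)
    = (\<Sum>b\<in>Basis. (z \<bullet> b) * frechet_derivative \<phi> (at x) b)"
    by (simp add: linear_sum linear_scale)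
  then show ?thesis by (simp add: euclidean_representation)
qed

subsection \<open>Translation invariance\<close>

lemma integral_lborel_shift:
  fixes f :: "'a::euclidean_space \<Rightarrow> 'b::{banach, second_countable_topology}"
  assumes [measurable]: "f \<in> borel_measurable borel"
  shows "(\<integral>x. f (x + a) \<partial>lborel) = (\<integral>x. f x \<partial>lborel)"
proof -
  have "(\<integral>x. f x \<partial>lborel) = (\<integral>x. f x \<partial>distr lborel borel ((+) a))"
    by (simp add: lborel_distr_plus)
  also have "\<dots> = (\<integral>x. f (x + a) \<partial>lborel)"
    by (subst integral_distr) (simp_all add: add.commute)
  finally show ?thesis ..
qed

lemma nn_integral_lborel_shift:
  fixes f :: "'a::euclidean_space \<Rightarrow> ennreal"
  assumes [measurable]: "f \<in> borel_measurable borel"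
  shows "(\<integral>\<^sup>+x. f (x + a) \<partial>lborel) = (\<integral>\<^sup>+x. f x \<partial>lborel)"
proof -
  have "(\<integral>\<^sup>+x. f x \<partial>lborel) = (\<integral>\<^sup>+x. f x \<partial>distr lborel borel ((+) a))"
    by (simp add: lborel_distr_plus)
  also have "\<dots> = (\<integral>\<^sup>+x. f (x + a) \<partial>lborel)"
    by (subst nn_integral_distr) (simp_all add: add.commute)
  finally show ?thesis ..
qed

lemma integrable_lborel_shift:
  fixes f :: "'a::euclidean_space \<Rightarrow> 'b::{banach, second_countable_topology}"
  assumes "integrable lborel f"
  shows "integrable lborel (\<lambda>x. f (x + a))"
proof -
  have "integrable (distr lborel borel ((+) a)) f"
    using assms by (simp add: lborel_distr_plus)
  then show ?thesis
    by (subst (asm) integrable_distr_eq) (use assms in \<open>simp_all add: add.commute borel_measurable_integrable[of lborel f, simplified]\<close>)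
qed

lemma AE_lborel_shift:
  fixes a :: "'a::euclidean_space"
  assumes "AE x in lborel. P x"
  shows "AE x in lborel. P (x + a)"
proof -
  have "AE x in distr lborel borel ((+) a). P x"
    unfolding lborel_distr_plus by (rule assms)
  from AE_distrD[OF _ this] show ?thesis
    by (simp add: add.commute)
qed

subsection \<open>Locally integrable functions\<close>

text \<open>A common class for representatives from \<open>l2\<close> and \<open>linf\<close>: the
  passage from weak derivatives to differences is then carried out once for both.\<close>

definition locally_integrable :: "('a::euclidean_space \<Rightarrow> complex) \<Rightarrow> bool" where
  "locally_integrable f \<longleftrightarrow> f \<in> borel_measurable borel \<and>
     (\<forall>R. integrable lborel (\<lambda>x. indicat_real (cball 0 R) x *\<^sub>R f x))"

lemma locally_integrable_measurable: "locally_integrable f \<Longrightarrow> f \<in> borel_measurable borel"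
  by (simp add: locally_integrable_def)

lemma locally_integrable_mult_bound:
  assumes f: "locally_integrable f" and [measurable]: "g \<in> borel_measurable borel"
    and g: "\<And>x. \<bar>g x\<bar> \<le> C" "\<And>x. x \<notin> cball 0 R \<Longrightarrow> g x = 0"
  shows "norm (f x * of_real (g x)) \<le> C * norm (indicat_real (cball 0 R) x *\<^sub>R f x)"
proof (cases "x \<in> cball 0 R")
  case True
  have "norm (f x * of_real (g x)) = \<bar>g x\<bar> * cmod (f x)"
    by (simp add: norm_mult)
  also have "\<dots> \<le> C * cmod (f x)"
    by (intro mult_right_mono g) simp
  finally show ?thesis using True by simp
qed (simp add: g)

lemma integrable_locally_integrable_mult:
  assumes f: "locally_integrable f" and [measurable]: "g \<in> borel_measurable borel"
    and g: "\<And>x. \<bar>g x\<bar> \<le> C" "\<And>x. x \<notin> cball 0 R \<Longrightarrow> g x = 0"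
  shows "integrable lborel (\<lambda>x. f x * of_real (g x))"
proof -
  have [measurable]: "f \<in> borel_measurable borel"
    using f by (rule locally_integrable_measurable)
  have "integrable lborel (\<lambda>x. C * norm (indicat_real (cball 0 R) x *\<^sub>R f x))"
    using f by (intro integrable_mult_right integrable_norm) (simp add: locally_integrable_def)
  then show ?thesis
  proof (rule Bochner_Integration.integrable_bound)
    show "AE x in lborel. norm (f x * of_real (g x)) \<le> norm (C * norm (indicat_real (cball 0 R) x *\<^sub>R f x))"
      by (intro AE_I2 order_trans[OF locally_integrable_mult_bound[OF assms]]) (auto simp only: real_norm_def intro: abs_ge_self)
  qed simp
qed

lemma integrable_mult_test:
  assumes "locally_integrable f" "\<phi> \<in> test_functions"
  shows "integrable lborel (\<lambda>x. f x * of_real (\<phi> x))"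
proof -
  obtain R where "\<And>x. x \<notin> cball 0 R \<Longrightarrow> \<phi> x = 0"
    using test_functions_bounded_support[OF assms(2)] by blast
  moreover obtain C where "\<And>x. \<bar>\<phi> x\<bar> \<le> C"
    using test_functions_bounded[OF assms(2)] by blast
  ultimately show ?thesis
    using integrable_locally_integrable_mult[OF assms(1) test_functions_measurable[OF assms(2)]] by blast
qed

lemma locally_integrable_shift:
  assumes f: "locally_integrable f"
  shows "locally_integrable (\<lambda>x. f (x + a))"
  unfolding locally_integrable_def
proof (intro conjI allI)
  have [measurable]: "f \<in> borel_measurable borel"
    using f by (rule locally_integrable_measurable)
  show "(\<lambda>x. f (x + a)) \<in> borel_measurable borel" by simp
  fix R
  have "integrable lborel (\<lambda>x. f x * of_real (indicator (cball 0 R) (x - a)))"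
  proof (rule integrable_locally_integrable_mult[OF f])
    show "\<bar>indicat_real (cball 0 R) (x - a)\<bar> \<le> 1" for x by (simp add: indicator_def)
    show "indicat_real (cball 0 R) (x - a) = 0" if "x \<notin> cball 0 (R + norm a)" for x
      using that norm_triangle_ineq[of "x - a" a] by (auto simp: indicator_def)
    show "(\<lambda>x. indicat_real (cball 0 R) (x - a)) \<in> borel_measurable borel"
      by (rule measurable_compose[of "\<lambda>x. x - a" _ borel]) (simp_all add: borel_measurable_indicator)
  qed
  from integrable_lborel_shift[OF this, of a]
  show "integrable lborel (\<lambda>x. indicat_real (cball 0 R) x *\<^sub>R f (x + a))"
    by (simp add: scaleR_conv_of_real mult.commute)
qed

lemma locally_integrable_diff:
  "locally_integrable f \<Longrightarrow> locally_integrable g \<Longrightarrow> locally_integrable (\<lambda>x. f x - g x)"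
  by (auto simp: locally_integrable_def scaleR_diff_right)

lemma locally_integrable_sum:
  "(\<And>i. i \<in> A \<Longrightarrow> locally_integrable (f i)) \<Longrightarrow> locally_integrable (\<lambda>x. \<Sum>i\<in>A. f i x)"
  unfolding locally_integrable_def scaleR_sum_right
  by (intro conjI allI borel_measurable_sum Bochner_Integration.integrable_sum) auto

lemma locally_integrable_cmult:
  "locally_integrable f \<Longrightarrow> locally_integrable (\<lambda>x. c * f x)"
  by (auto simp: locally_integrable_def mult_scaleR_right[symmetric] simp del: mult_scaleR_right)

text \<open>The box bumps are bounded by 1, live in the box and converge to its indicator, so
  dominated convergence extends the hypothesis from test functions to indicators of boxes.\<close>

lemma box_integral_eq_0:
  assumes g: "locally_integrable g"
    and 0: "\<And>\<phi>. \<phi> \<in> test_functions \<Longrightarrow> (\<integral>x. g x * of_real (\<phi> x) \<partial>lborel) = 0"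
  shows "(\<integral>x. indicat_real (box a c) x *\<^sub>R g x \<partial>lborel) = 0"
proof -
  have [measurable]: "g \<in> borel_measurable borel"
    using g by (rule locally_integrable_measurable)
  obtain R where R: "box a c \<subseteq> cball 0 R"
    using bounded_subset_ballD[OF bounded_box[of a c], of 0] ball_subset_cball by blast
  have "(\<lambda>n. \<integral>x. g x * of_real (box_bump n a c x) \<partial>lborel)
      \<longlonglongrightarrow> (\<integral>x. indicat_real (box a c) x *\<^sub>R g x \<partial>lborel)"
  proof (rule integral_dominated_convergence[where w="\<lambda>x. norm (indicat_real (cball 0 R) x *\<^sub>R g x)"])
    show "(\<lambda>x. g x * of_real (box_bump n a c x)) \<in> borel_measurable lborel" for n
      using test_functions_measurable[OF box_bump_test] by measurable
    show "integrable lborel (\<lambda>x. norm (indicat_real (cball 0 R) x *\<^sub>R g x))"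
      using g by (intro integrable_norm) (simp add: locally_integrable_def)
    have "(\<lambda>n. g x * of_real (box_bump n a c x)) \<longlonglongrightarrow> g x * of_real (indicator (box a c) x)" for x
      by (intro tendsto_intros box_bump_tendsto)
    then show "AE x in lborel. (\<lambda>n. g x * of_real (box_bump n a c x)) \<longlonglongrightarrow> indicat_real (box a c) x *\<^sub>R g x"
      by (simp add: scaleR_conv_of_real mult.commute)
    have "norm (g x * of_real (box_bump n a c x)) \<le> 1 * norm (indicat_real (cball 0 R) x *\<^sub>R g x)" for n x
    proof (rule locally_integrable_mult_bound[OF g test_functions_measurable[OF box_bump_test]])
      show "\<bar>box_bump n a c y\<bar> \<le> 1" for y
        using box_bump_bounds[of n a c y] by simp
      show "box_bump n a c y = 0" if "y \<notin> cball 0 R" for y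
        using R that by (intro box_bump_eq_0) blast
    qed
    then show "AE x in lborel. norm (g x * of_real (box_bump n a c x)) \<le> norm (indicat_real (cball 0 R) x *\<^sub>R g x)" for n
      by simp
  qed simp
  then show ?thesis
    using 0[OF box_bump_test] by (simp add: LIMSEQ_const_iff)
qed

text \<open>Boxes form an intersection-stable generator of the Borel sets, so vanishing integrals
  over boxes propagate to all Borel sets by a Dynkin argument. Since \<open>g\<close> is only
  locally integrable, this is done for \<open>g\<close> cut off to a fixed box, where complements
  and countable unions are harmless; countably many boxes then exhaust the space.\<close>

lemma AE_eq_0_if_test_integrals:
  fixes g :: "'a::euclidean_space \<Rightarrow> complex"
  assumes g: "locally_integrable g"
    and 0: "\<And>\<phi>. \<phi> \<in> test_functions \<Longrightarrow> (\<integral>x. g x * of_real (\<phi> x) \<partial>lborel) = 0"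
  shows "AE x in lborel. g x = 0"
proof -
  have [measurable]: "g \<in> borel_measurable borel"
    using g by (rule locally_integrable_measurable)
  have box: "AE x in lborel. indicat_real (box a c) x *\<^sub>R g x = 0" for a c
  proof (rule sigma_finite_measure.density_zero[OF sigma_finite_lborel])
    obtain R where R: "box a c \<subseteq> cball 0 R"
      using bounded_subset_ballD[OF bounded_box[of a c], of 0] ball_subset_cball by blast
    have "integrable lborel (\<lambda>x. g x * of_real (indicator (box a c) x))"
      using R by (intro integrable_locally_integrable_mult[OF g, of _ 1 R]) (auto simp: indicator_def)
    then show int: "integrable lborel (\<lambda>x. indicat_real (box a c) x *\<^sub>R g x)"
      by (simp add: scaleR_conv_of_real mult.commute)
    fix A :: "'a set" assume "A \<in> sets lborel"
    then have A: "A \<in> sigma_sets UNIV (range (\<lambda>(a, b). box a b))"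
      by (simp add: borel_eq_box)
    have int': "integrable lborel (\<lambda>x. indicat_real A x *\<^sub>R (indicat_real (box a c) x *\<^sub>R g x))"
      if "A \<in> sets borel" for A
      using that by (intro integrable_mult_indicator[OF _ int]) simp
    have "Int_stable (range (\<lambda>(a::'a, b). box a b))"
      by (auto simp: Int_stable_def box_Int_box)
    moreover have "(range (\<lambda>(a::'a, b). box a b)) \<subseteq> Pow UNIV"
      by auto
    ultimately have "(\<integral>x. indicat_real A x *\<^sub>R (indicat_real (box a c) x *\<^sub>R g x) \<partial>lborel) = 0"
      using A
    proof (induction rule: sigma_sets_induct_disjoint)
      case (basic A)
      then show ?case
        using box_integral_eq_0[OF assms]
        by (auto simp: indicator_inter_arith[symmetric] scaleR_scaleR box_Int_box)
    next
      case empty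
      then show ?case by simp
    next
      case (compl A)
      then have [measurable]: "A \<in> sets borel" by (simp add: borel_eq_box)
      have "(\<integral>x. indicat_real (UNIV - A) x *\<^sub>R (indicat_real (box a c) x *\<^sub>R g x) \<partial>lborel)
        = (\<integral>x. indicat_real (box a c) x *\<^sub>R g x
            - indicat_real A x *\<^sub>R (indicat_real (box a c) x *\<^sub>R g x) \<partial>lborel)"
        by (intro Bochner_Integration.integral_cong) (auto simp: indicator_def)
      also have "\<dots> = 0"
        using int int'[of A] compl box_integral_eq_0[OF assms] by (subst Bochner_Integration.integral_diff) auto
      finally show ?case .
    next
      case (union F)
      then have [measurable]: "\<And>i. F i \<in> sets borel"
        by (simp add: borel_eq_box subset_eq)
      have "(\<integral>x. indicat_real (\<Union>i. F i) x *\<^sub>R (indicat_real (box a c) x *\<^sub>R g x) \<partial>lborel)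
        = (\<Sum>i. (\<integral>x. indicat_real (F i) x *\<^sub>R (indicat_real (box a c) x *\<^sub>R g x) \<partial>lborel))"
        using lebesgue_integral_countable_add[of F lborel "\<lambda>x. indicat_real (box a c) x *\<^sub>R g x"]
          union(1) int'[of "\<Union>i. F i"]
        by (auto simp: set_lebesgue_integral_def set_integrable_def disjoint_family_on_def)
      then show ?case using union by simp
    qed
    then show "set_lebesgue_integral lborel A (\<lambda>x. indicat_real (box a c) x *\<^sub>R g x) = 0"
      by (simp add: set_lebesgue_integral_def)
  qed
  let ?b = "\<lambda>n. box (- (real n *\<^sub>R (One::'a))) (real n *\<^sub>R One)"
  have "AE x in lborel. \<forall>n. indicat_real (?b n) x *\<^sub>R g x = 0"
    using box by (subst AE_all_countable) blast
  then show ?thesis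
  proof eventually_elim
    case (elim x)
    obtain n where "x \<in> ?b n"
      using UN_box_eq_UNIV by blast
    with elim show ?case by (auto simp: indicator_def split: if_splits)
  qed
qed

subsection \<open>Averages over the unit interval\<close>

text \<open>The uniform distribution on the unit interval. Treating it as a probability measure lets
  segment averages and heat averages share \<open>nn_integral_square_average\<close>.\<close>

definition unit_measure :: "real measure" where
  "unit_measure = density lborel (\<lambda>s. ennreal (indicator {0..1} s))"

lemma sets_unit_measure [simp, measurable_cong]: "sets unit_measure = sets borel"
  by (simp add: unit_measure_def)

lemma space_unit_measure [simp]: "space unit_measure = UNIV"
  by (simp add: unit_measure_def)

lemma prob_space_unit_measure: "prob_space unit_measure"
proof
  show "emeasure unit_measure (space unit_measure) = 1"
    by (simp add: unit_measure_def emeasure_density ennreal_indicator)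
qed

interpretation unit_measure: prob_space unit_measure
  by (rule prob_space_unit_measure)

lemma AE_unit_measure: "AE s in unit_measure. s \<in> {0..1}"
  unfolding unit_measure_def by (subst AE_density) (auto simp: indicator_def)

interpretation lborel_unit: pair_sigma_finite lborel unit_measure
  by standard

interpretation unit_lborel: pair_sigma_finite unit_measure lborel
  by standard

lemma integrable_lborel_unit:
  fixes k :: "real \<Rightarrow> 'a::euclidean_space \<Rightarrow> complex"
  assumes [measurable]: "(\<lambda>(s, x). k s x) \<in> borel_measurable (borel \<Otimes>\<^sub>M borel)"
    and int: "\<And>s. s \<in> {0..1} \<Longrightarrow> integrable lborel (k s)"
    and le: "\<And>s. s \<in> {0..1} \<Longrightarrow> (\<integral>x. norm (k s x) \<partial>lborel) \<le> B"
  shows "integrable (lborel \<Otimes>\<^sub>M unit_measure) (\<lambda>(x, s). k s x)"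
proof -
  have "integrable (unit_measure \<Otimes>\<^sub>M lborel) (\<lambda>(s, x). k s x)"
  proof (rule unit_lborel.Fubini_integrable)
    show "integrable unit_measure (\<lambda>s. \<integral>x. norm (case (s, x) of (s, x) \<Rightarrow> k s x) \<partial>lborel)"
    proof (rule unit_measure.integrable_const_bound[where B=B])
      show "AE s in unit_measure. norm (\<integral>x. norm (case (s, x) of (s, x) \<Rightarrow> k s x) \<partial>lborel) \<le> B"
        using AE_unit_measure by eventually_elim (auto intro: le)
    qed measurable
    show "AE s in unit_measure. integrable lborel (\<lambda>x. case (s, x) of (s, x) \<Rightarrow> k s x)"
      using AE_unit_measure by eventually_elim (auto intro: int)
  qed measurable
  from unit_lborel.integrable_product_swap[OF this] show ?thesis
    by (simp add: case_prod_beta')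
qed

text \<open>For \<open>s\<close> in the unit interval the translated supports stay in the ball of
  radius \<open>R + norm z\<close>, where \<open>F\<close> is integrable, so the L1 norms of the
  slices are bounded uniformly in \<open>s\<close>. The two integrands are related by the
  substitution \<open>x + s *\<^sub>R z\<close>; \<open>directional_difference\<close> applies
  Fubini to each of them.\<close>

lemma integrable_shear:
  fixes F :: "'a::euclidean_space \<Rightarrow> complex"
  assumes F: "locally_integrable F" and [measurable]: "g \<in> borel_measurable borel"
    and g: "\<And>x. \<bar>g x\<bar> \<le> C" "\<And>x. x \<notin> cball 0 R \<Longrightarrow> g x = 0"
  shows "integrable (lborel \<Otimes>\<^sub>M unit_measure) (\<lambda>(x, s). F (x + s *\<^sub>R z) * of_real (g x))"
    and "integrable (lborel \<Otimes>\<^sub>M unit_measure) (\<lambda>(x, s). F x * of_real (g (x - s *\<^sub>R z)))"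
proof -
  have [measurable]: "F \<in> borel_measurable borel"
    using F by (rule locally_integrable_measurable)
  let ?h = "\<lambda>x. norm (indicat_real (cball 0 (R + norm z)) x *\<^sub>R F x)"
  have h: "integrable lborel ?h"
    using F by (intro integrable_norm) (simp add: locally_integrable_def)
  have supp: "g (x - s *\<^sub>R z) = 0" if "s \<in> {0..1}" "x \<notin> cball 0 (R + norm z)" for s x
  proof (rule g(2))
    have "norm x \<le> norm (x - s *\<^sub>R z) + norm (s *\<^sub>R z)"
      using norm_triangle_ineq[of "x - s *\<^sub>R z" "s *\<^sub>R z"] by simp
    moreover have "norm (s *\<^sub>R z) \<le> norm z"
      using that by (simp add: mult_left_le_one_le)
    ultimately show "x - s *\<^sub>R z \<notin> cball 0 R"
      using that by auto
  qed
  have int: "integrable lborel (\<lambda>x. F x * of_real (g (x - s *\<^sub>R z)))" if "s \<in> {0..1}" for s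
    using g(1) supp[OF that] by (intro integrable_locally_integrable_mult[OF F]) auto
  have le: "(\<integral>x. norm (F x * of_real (g (x - s *\<^sub>R z))) \<partial>lborel) \<le> (\<integral>x. C * ?h x \<partial>lborel)"
    if "s \<in> {0..1}" for s
    using g(1) supp[OF that]
    by (intro integral_mono integrable_norm int that integrable_mult_right h
        locally_integrable_mult_bound[OF F]) auto
  show "integrable (lborel \<Otimes>\<^sub>M unit_measure) (\<lambda>(x, s). F x * of_real (g (x - s *\<^sub>R z)))"
    by (rule integrable_lborel_unit[OF _ int le]) measurable
  show "integrable (lborel \<Otimes>\<^sub>M unit_measure) (\<lambda>(x, s). F (x + s *\<^sub>R z) * of_real (g x))"
  proof (rule integrable_lborel_unit)
    fix s :: real assume s: "s \<in> {0..1}"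
    show "integrable lborel (\<lambda>x. F (x + s *\<^sub>R z) * of_real (g x))"
      using integrable_lborel_shift[OF int[OF s], of "s *\<^sub>R z"] by simp
    show "(\<integral>x. norm (F (x + s *\<^sub>R z) * of_real (g x)) \<partial>lborel) \<le> (\<integral>x. C * ?h x \<partial>lborel)"
      using le[OF s] integral_lborel_shift[of "\<lambda>x. norm (F x * of_real (g (x - s *\<^sub>R z)))" "s *\<^sub>R z"]
      by simp
  qed measurable
qed

lemma locally_integrable_average:
  assumes F: "locally_integrable F"
  shows "locally_integrable (\<lambda>x. \<integral>s. F (x + s *\<^sub>R z) \<partial>unit_measure)"
  unfolding locally_integrable_def
proof (intro conjI allI)
  have [measurable]: "F \<in> borel_measurable borel"
    using F by (rule locally_integrable_measurable)
  show "(\<lambda>x. \<integral>s. F (x + s *\<^sub>R z) \<partial>unit_measure) \<in> borel_measurable borel"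
    by measurable
  fix R
  have "integrable (lborel \<Otimes>\<^sub>M unit_measure) (\<lambda>(x, s). F (x + s *\<^sub>R z) * of_real (indicator (cball 0 R) x))"
    by (rule integrable_shear[OF F, of _ 1 R]) (auto simp: indicator_def)
  from lborel_unit.integrable_fst[OF this]
  have "integrable lborel (\<lambda>x. (\<integral>s. F (x + s *\<^sub>R z) \<partial>unit_measure) * of_real (indicator (cball 0 R) x))"
    by simp
  then show "integrable lborel (\<lambda>x. indicat_real (cball 0 R) x *\<^sub>R (\<integral>s. F (x + s *\<^sub>R z) \<partial>unit_measure))"
    by (simp add: scaleR_conv_of_real mult.commute)
qed

lemma integral_unit_directional_derivative:
  assumes \<phi>: "\<phi> \<in> test_functions"
    and cont: "continuous_on UNIV (\<lambda>x. frechet_derivative \<phi> (at x) z)"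
  shows "(\<integral>s. frechet_derivative \<phi> (at (x - s *\<^sub>R z)) z \<partial>unit_measure) = \<phi> x - \<phi> (x - z)"
proof -
  let ?D = "\<lambda>y. frechet_derivative \<phi> (at y) z"
  have [measurable]: "?D \<in> borel_measurable borel"
    using cont by (rule borel_measurable_continuous_onI)
  have "(\<integral>s. ?D (x - s *\<^sub>R z) \<partial>unit_measure) = (\<integral>s. indicator {0..1} s *\<^sub>R ?D (x - s *\<^sub>R z) \<partial>lborel)"
    unfolding unit_measure_def by (subst integral_density) (auto simp: indicator_def)
  also have "\<dots> = - \<phi> (x - 1 *\<^sub>R z) - (- \<phi> (x - 0 *\<^sub>R z))"
  proof (rule integral_FTC_Icc)
    fix s :: real
    have "((\<lambda>s. x - s *\<^sub>R z) has_derivative (\<lambda>h. - (h *\<^sub>R z))) (at s within {0..1})"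
      by (auto intro!: derivative_eq_intros)
    from has_derivative_compose[OF this test_functions_differentiable[OF \<phi>]]
    have "((\<lambda>s. \<phi> (x - s *\<^sub>R z)) has_derivative (\<lambda>h. frechet_derivative \<phi> (at (x - s *\<^sub>R z)) (- (h *\<^sub>R z)))) (at s within {0..1})" .
    moreover have "linear (frechet_derivative \<phi> (at (x - s *\<^sub>R z)))"
      using test_functions_differentiable[OF \<phi>] by (rule has_derivative_linear)
    ultimately have "((\<lambda>s. - \<phi> (x - s *\<^sub>R z)) has_derivative (\<lambda>h. h *\<^sub>R ?D (x - s *\<^sub>R z))) (at s within {0..1})"
      by (auto simp: linear_neg linear_scale dest: has_derivative_minus)
    then show "((\<lambda>s. - \<phi> (x - s *\<^sub>R z)) has_vector_derivative ?D (x - s *\<^sub>R z)) (at s within {0..1})"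
      by (simp add: has_vector_derivative_def)
    show "continuous_on {0..1} (\<lambda>s. ?D (x - s *\<^sub>R z))"
      by (intro continuous_on_compose2[OF cont] continuous_intros) auto
  qed simp
  finally show ?thesis by simp
qed

text \<open>The fundamental theorem of calculus along a segment, in weak form. Against a test
  function the translation of \<open>f\<close> is moved onto the test function, whose difference is
  an average of directional derivatives; Fubini and the hypothesis replace \<open>f\<close> by
  \<open>F\<close>, and translating back gives the average of \<open>F\<close>. The fundamental
  lemma turns this into an identity almost everywhere.\<close>

lemma directional_difference:
  fixes f F :: "'a::euclidean_space \<Rightarrow> complex"
  assumes f: "locally_integrable f" and F: "locally_integrable F"
    and D: "\<And>\<phi>. \<phi> \<in> test_functions \<Longrightarrow>
      (\<integral>x. f x * of_real (frechet_derivative \<phi> (at x) z) \<partial>lborel) = - (\<integral>x. F x * of_real (\<phi> x) \<partial>lborel)"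
  shows "AE x in lborel. f (x + z) - f x = (\<integral>s. F (x + s *\<^sub>R z) \<partial>unit_measure)"
proof -
  define G where "G x = (\<integral>s. F (x + s *\<^sub>R z) \<partial>unit_measure)" for x
  have G: "locally_integrable G"
    unfolding G_def[abs_def] by (rule locally_integrable_average[OF F])
  have [measurable]: "f \<in> borel_measurable borel" "F \<in> borel_measurable borel"
    using f F by (simp_all add: locally_integrable_measurable)
  have "AE x in lborel. f (x + z) - f x - G x = 0"
  proof (rule AE_eq_0_if_test_integrals)
    show "locally_integrable (\<lambda>x. f (x + z) - f x - G x)"
      by (intro locally_integrable_diff locally_integrable_shift f G)
    fix \<phi> :: "'a \<Rightarrow> real" assume \<phi>: "\<phi> \<in> test_functions"
    note [measurable] = test_functions_measurable[OF \<phi>]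
    have partial: "iter_partial [b] \<phi> \<in> test_functions" if "b \<in> Basis" for b
      using that by (intro test_functions_iter_partial \<phi>) auto
    define d where "d x = frechet_derivative \<phi> (at x) z" for x
    \<comment> \<open>Partial derivatives of a test function are test functions, so this finite sum
      yields continuity, boundedness and compact support of the directional derivative at
      once.\<close>
    have d: "d x = (\<Sum>b\<in>Basis. (z \<bullet> b) * iter_partial [b] \<phi> x)" for x
      unfolding d_def by (rule frechet_derivative_eq_sum[OF \<phi>])
    have d_cont: "continuous_on UNIV d"
      unfolding d[abs_def] by (intro continuous_intros test_functions_continuous partial)
    then have [measurable]: "d \<in> borel_measurable borel"
      by (rule borel_measurable_continuous_onI)
    obtain R where R: "\<And>x. x \<notin> cball 0 R \<Longrightarrow> \<phi> x = 0"
      using test_functions_bounded_support[OF \<phi>] by blast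
    obtain C where C: "\<And>x. \<bar>\<phi> x\<bar> \<le> C"
      using test_functions_bounded[OF \<phi>] by blast
    have d_R: "d x = 0" if "x \<notin> cball 0 R" for x
    proof -
      have "closure {x. \<phi> x \<noteq> 0} \<subseteq> cball 0 R"
        using R by (intro closure_minimal) force+
      then have "iter_partial [b] \<phi> x = 0" for b
        using that by (intro iter_partial_outside_support) auto
      then show ?thesis by (simp add: d del: iter_partial.simps)
    qed
    have "\<forall>b\<in>Basis. \<exists>C. \<forall>x. \<bar>iter_partial [b] \<phi> x\<bar> \<le> C"
      using test_functions_bounded[OF partial] by blast
    then obtain C' where C': "\<And>b x. b \<in> Basis \<Longrightarrow> \<bar>iter_partial [b] \<phi> x\<bar> \<le> C' b"
      by metis
    have d_C: "\<bar>d x\<bar> \<le> (\<Sum>b\<in>Basis. \<bar>z \<bullet> b\<bar> * C' b)" for x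
      unfolding d by (intro order_trans[OF sum_abs] sum_mono)
        (auto simp: abs_mult simp del: iter_partial.simps intro!: mult_left_mono C')
    have FTC: "(\<integral>s. d (x - s *\<^sub>R z) \<partial>unit_measure) = \<phi> x - \<phi> (x - z)" for x
      using integral_unit_directional_derivative[OF \<phi>] d_cont by (simp add: d_def[abs_def])
    have int_f: "integrable lborel (\<lambda>x. f x * of_real (\<phi> (x - a)))" for a
      by (intro integrable_mult_test f test_functions_shift \<phi>)
    have "(\<integral>x. f (x + z) * of_real (\<phi> x) \<partial>lborel) = (\<integral>x. f x * of_real (\<phi> (x - z)) \<partial>lborel)"
      using integral_lborel_shift[of "\<lambda>x. f x * of_real (\<phi> (x - z))" z] by simp
    then have "(\<integral>x. f (x + z) * of_real (\<phi> x) \<partial>lborel) - (\<integral>x. f x * of_real (\<phi> x) \<partial>lborel)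
      = (\<integral>x. f x * of_real (\<phi> (x - z)) - f x * of_real (\<phi> x) \<partial>lborel)"
      using int_f[of z] int_f[of 0] by simp
    also have "\<dots> = (\<integral>x. - (\<integral>s. f x * of_real (d (x - s *\<^sub>R z)) \<partial>unit_measure) \<partial>lborel)"
      by (simp add: FTC algebra_simps)
    also have "\<dots> = - (\<integral>x. (\<integral>s. f x * of_real (d (x - s *\<^sub>R z)) \<partial>unit_measure) \<partial>lborel)"
      by simp
    also have "\<dots> = - (\<integral>s. (\<integral>x. f x * of_real (d (x - s *\<^sub>R z)) \<partial>lborel) \<partial>unit_measure)"
      using integrable_shear(2)[OF f \<open>d \<in> borel_measurable borel\<close> d_C d_R, where z=z]
      by (subst lborel_unit.Fubini_integral) simp_all
    also have "\<dots> = - (\<integral>s. - (\<integral>x. F x * of_real (\<phi> (x - s *\<^sub>R z)) \<partial>lborel) \<partial>unit_measure)"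
      using D[OF test_functions_shift[OF \<phi>]] by (simp add: frechet_derivative_shift d_def)
    also have "\<dots> = (\<integral>s. (\<integral>x. F (x + s *\<^sub>R z) * of_real (\<phi> x) \<partial>lborel) \<partial>unit_measure)"
    proof -
      have "(\<integral>x. F x * of_real (\<phi> (x - s *\<^sub>R z)) \<partial>lborel) = (\<integral>x. F (x + s *\<^sub>R z) * of_real (\<phi> x) \<partial>lborel)" for s
        using integral_lborel_shift[of "\<lambda>x. F x * of_real (\<phi> (x - s *\<^sub>R z))" "s *\<^sub>R z"] by simp
      then show ?thesis by simp
    qed
    also have "\<dots> = (\<integral>x. (\<integral>s. F (x + s *\<^sub>R z) * of_real (\<phi> x) \<partial>unit_measure) \<partial>lborel)"
      using integrable_shear(1)[OF F test_functions_measurable[OF \<phi>] C R, where z=z]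
      by (subst lborel_unit.Fubini_integral) simp_all
    also have "\<dots> = (\<integral>x. G x * of_real (\<phi> x) \<partial>lborel)"
      by (simp add: G_def)
    finally have "(\<integral>x. f (x + z) * of_real (\<phi> x) \<partial>lborel) - (\<integral>x. f x * of_real (\<phi> x) \<partial>lborel)
      = (\<integral>x. G x * of_real (\<phi> x) \<partial>lborel)" .
    then show "(\<integral>x. (f (x + z) - f x - G x) * of_real (\<phi> x) \<partial>lborel) = 0"
      using f G by (simp add: left_diff_distrib integrable_mult_test locally_integrable_shift \<phi>)
  qed
  then show ?thesis by (simp add: G_def)
qed

lemma weak_deriv_difference:
  fixes f :: "'a::euclidean_space \<Rightarrow> complex"
  assumes f: "locally_integrable f" and v: "\<And>b. b \<in> Basis \<Longrightarrow> locally_integrable (v b)"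
    and D: "\<And>b. b \<in> Basis \<Longrightarrow> has_weak_deriv [b] f (v b)"
  shows "AE x in lborel. f (x + z) - f x
    = (\<integral>s. (\<Sum>b\<in>Basis. of_real (z \<bullet> b) * v b (x + s *\<^sub>R z)) \<partial>unit_measure)"
proof (rule directional_difference[OF f])
  show "locally_integrable (\<lambda>x. \<Sum>b\<in>Basis. of_real (z \<bullet> b) * v b x)"
    by (intro locally_integrable_sum locally_integrable_cmult v)
  fix \<phi> :: "'a \<Rightarrow> real" assume \<phi>: "\<phi> \<in> test_functions"
  have partial: "iter_partial [b] \<phi> \<in> test_functions" if "b \<in> Basis" for b
    using that by (intro test_functions_iter_partial \<phi>) auto
  have "(\<integral>x. f x * of_real (frechet_derivative \<phi> (at x) z) \<partial>lborel)
    = (\<integral>x. (\<Sum>b\<in>Basis. of_real (z \<bullet> b) * (f x * of_real (iter_partial [b] \<phi> x))) \<partial>lborel)"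
    unfolding frechet_derivative_eq_sum[OF \<phi>] by (simp add: sum_distrib_left mult_ac)
  also have "\<dots> = (\<Sum>b\<in>Basis. of_real (z \<bullet> b) * (\<integral>x. f x * of_real (iter_partial [b] \<phi> x) \<partial>lborel))"
    by (subst Bochner_Integration.integral_sum)
      (auto intro!: integrable_mult_right integrable_mult_test f partial simp del: iter_partial.simps)
  also have "\<dots> = (\<Sum>b\<in>Basis. of_real (z \<bullet> b) * (- (\<integral>x. v b x * of_real (\<phi> x) \<partial>lborel)))"
    using D \<phi> by (intro sum.cong) (auto simp: has_weak_deriv_def)
  also have "\<dots> = - (\<Sum>b\<in>Basis. \<integral>x. of_real (z \<bullet> b) * (v b x * of_real (\<phi> x)) \<partial>lborel)"
    by (simp add: sum_negf)
  also have "\<dots> = - (\<integral>x. (\<Sum>b\<in>Basis. of_real (z \<bullet> b) * v b x) * of_real (\<phi> x) \<partial>lborel)"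
    using integrable_mult_test[OF v \<phi>]
    by (subst Bochner_Integration.integral_sum[symmetric]) (auto simp: sum_distrib_right mult.assoc)
  finally show "(\<integral>x. f x * of_real (frechet_derivative \<phi> (at x) z) \<partial>lborel)
    = - (\<integral>x. (\<Sum>b\<in>Basis. of_real (z \<bullet> b) * v b x) * of_real (\<phi> x) \<partial>lborel)" .
qed

subsection \<open>Representatives\<close>

lemma square_int_rep_l2: "square_int (rep_l2 u)"
  using Quotient3_rep_reflp[OF Quotient3_l2, of u] by (simp add: l2_rel_def)

lemma abs_l2_rep: "abs_l2 (rep_l2 u) = u"
  by (rule Quotient3_abs_rep[OF Quotient3_l2])

lemma rep_l2_measurable [measurable]: "rep_l2 u \<in> borel_measurable borel"
  using square_int_rep_l2[of u] by (simp add: square_int_def)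

lemma rep_abs_l2:
  assumes "square_int f"
  shows "AE x in lborel. rep_l2 (abs_l2 f) x = f x"
proof -
  have "l2_rel f f" using assms by (simp add: l2_rel_def)
  then have "l2_rel (rep_l2 (abs_l2 f)) f"
    by (rule rep_abs_rsp_left[OF Quotient3_l2])
  then show ?thesis by (simp add: l2_rel_def)
qed

lemma l2_eqI:
  assumes "AE x in lborel. rep_l2 u x = rep_l2 v x"
  shows "u = v"
proof -
  have "l2_rel (rep_l2 u) (rep_l2 v)"
    using assms by (simp add: l2_rel_def square_int_rep_l2)
  then show ?thesis by (metis Quotient3_rel_rep Quotient3_l2)
qed

lemma rep_l2_add: "AE x in lborel. rep_l2 (u + v) x = rep_l2 u x + rep_l2 v x"
proof -
  have "u + v = abs_l2 (\<lambda>x. rep_l2 u x + rep_l2 v x)"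
    using plus_l2.abs_eq[of "rep_l2 u" "rep_l2 v"]
    by (simp add: abs_l2_rep l2_rel_def square_int_rep_l2)
  then show ?thesis
    using rep_abs_l2[OF square_int_add[OF square_int_rep_l2 square_int_rep_l2]] by simp
qed

lemma rep_l2_scaleR: "AE x in lborel. rep_l2 (r *\<^sub>R u) x = of_real r * rep_l2 u x"
proof -
  have "r *\<^sub>R u = abs_l2 (\<lambda>x. of_real r * rep_l2 u x)"
    using scaleR_l2.abs_eq[of "rep_l2 u" r]
    by (simp add: abs_l2_rep l2_rel_def square_int_rep_l2 scaleR_conv_of_real)
  then show ?thesis
    using rep_abs_l2[OF square_int_scale[OF square_int_rep_l2]] by simp
qed

lemma rep_l2_0: "AE x in lborel. rep_l2 0 x = 0"
  using rep_l2_scaleR[of 0 0] by simp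

lemma rep_l2_diff: "AE x in lborel. rep_l2 (u - v) x = rep_l2 u x - rep_l2 v x"
proof -
  have "u - v = u + (- 1) *\<^sub>R v" by simp
  then show ?thesis
    using rep_l2_add[of u "(- 1) *\<^sub>R v"] rep_l2_scaleR[of "- 1" v]
    by (auto elim: eventually_elim2)
qed

lemma rep_l2_sum:
  assumes "finite A"
  shows "AE x in lborel. rep_l2 (\<Sum>i\<in>A. f i) x = (\<Sum>i\<in>A. rep_l2 (f i) x)"
  using assms
proof (induction A rule: finite_induct)
  case (insert i A)
  then show ?case
    using insert.IH rep_l2_add[of "f i" "sum f A"] by (auto elim: eventually_elim2)
qed (simp add: rep_l2_0)

lemma norm_l2_eq_nn_integral: "ennreal ((norm u)\<^sup>2) = (\<integral>\<^sup>+x. ennreal ((cmod (rep_l2 u x))\<^sup>2) \<partial>lborel)"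
proof -
  have "inner u u = (\<integral>x. rep_l2 u x \<bullet> rep_l2 u x \<partial>lborel)"
    using inner_l2.abs_eq[of "rep_l2 u" "rep_l2 u"]
    by (simp add: abs_l2_rep l2_rel_def square_int_rep_l2)
  then have "(norm u)\<^sup>2 = (\<integral>x. (cmod (rep_l2 u x))\<^sup>2 \<partial>lborel)"
    by (simp add: power2_norm_eq_inner[of u] power2_norm_eq_inner[of "rep_l2 u _"])
  then show ?thesis
    using square_int_rep_l2[of u] by (simp add: nn_integral_eq_integral square_int_def)
qed

lemma norm_l2_leI:
  assumes "(\<integral>\<^sup>+x. ennreal ((cmod (rep_l2 u x))\<^sup>2) \<partial>lborel) \<le> ennreal (K\<^sup>2)" "0 \<le> K"
  shows "norm u \<le> K"
  using assms by (auto simp: norm_l2_eq_nn_integral[symmetric] intro: power2_le_imp_le)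

section \<open>Representatives of essentially bounded classes and multiplication operators\<close>

lemma ess_bounded_rep_linf: "ess_bounded (rep_linf v)"
  using Quotient3_rep_reflp[OF Quotient3_linf, of v] by (simp add: linf_rel_def)

lemma abs_linf_rep: "abs_linf (rep_linf v) = v"
  by (rule Quotient3_abs_rep[OF Quotient3_linf])

lemma rep_linf_measurable [measurable]: "rep_linf v \<in> borel_measurable borel"
  using ess_bounded_rep_linf[of v] by (simp add: ess_bounded_def)

lemma rep_abs_linf:
  assumes "ess_bounded f"
  shows "AE x in lborel. rep_linf (abs_linf f) x = f x"
proof -
  have "linf_rel f f" using assms by (simp add: linf_rel_def)
  then have "linf_rel (rep_linf (abs_linf f)) f"
    by (rule rep_abs_rsp_left[OF Quotient3_linf])
  then show ?thesis by (simp add: linf_rel_def)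
qed

lemma norm_linf_rep: "norm v = linf_norm_fun (rep_linf v)"
  using norm_linf.abs_eq[of "rep_linf v"] by (simp add: abs_linf_rep linf_rel_def ess_bounded_rep_linf)

lemma AE_rep_linf_le: "AE x in lborel. cmod (rep_linf v x) \<le> norm v"
  unfolding norm_linf_rep by (rule AE_le_linf_norm_fun[OF ess_bounded_rep_linf])

lemma norm_linf_leI:
  "(AE x in lborel. cmod (rep_linf v x) \<le> C) \<Longrightarrow> norm v \<le> C"
  unfolding norm_linf_rep by (rule linf_norm_fun_le[OF ess_bounded_rep_linf])

lemma rep_linf_add: "AE x in lborel. rep_linf (u + v) x = rep_linf u x + rep_linf v x"
proof -
  have "u + v = abs_linf (\<lambda>x. rep_linf u x + rep_linf v x)"
    using plus_linf.abs_eq[of "rep_linf u" "rep_linf v"]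
    by (simp add: abs_linf_rep linf_rel_def ess_bounded_rep_linf)
  then show ?thesis
    using rep_abs_linf[OF ess_bounded_add[OF ess_bounded_rep_linf ess_bounded_rep_linf]] by simp
qed

lemma rep_linf_scaleR: "AE x in lborel. rep_linf (r *\<^sub>R u) x = of_real r * rep_linf u x"
proof -
  have "r *\<^sub>R u = abs_linf (\<lambda>x. of_real r * rep_linf u x)"
    using scaleR_linf.abs_eq[of "rep_linf u" r]
    by (simp add: abs_linf_rep linf_rel_def ess_bounded_rep_linf scaleR_conv_of_real)
  then show ?thesis
    using rep_abs_linf[OF ess_bounded_mult[OF ess_bounded_const ess_bounded_rep_linf]] by simp
qed

lemma rep_linf_diff: "AE x in lborel. rep_linf (u - v) x = rep_linf u x - rep_linf v x"
proof -
  have "u - v = u + (- 1) *\<^sub>R v" by simp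
  then show ?thesis
    using rep_linf_add[of u "(- 1) *\<^sub>R v"] rep_linf_scaleR[of "- 1" v]
    by (auto elim: eventually_elim2)
qed

lemma rep_linf_exp: "AE x in lborel. rep_linf (linf_exp v) x = exp (rep_linf v x)"
proof -
  have "linf_exp v = abs_linf (\<lambda>x. exp (rep_linf v x))"
    using linf_exp.abs_eq[of "rep_linf v"]
    by (simp add: abs_linf_rep linf_rel_def ess_bounded_rep_linf)
  then show ?thesis
    using rep_abs_linf[OF ess_bounded_exp[OF ess_bounded_rep_linf]] by simp
qed

lemma rep_mult_op: "AE x in lborel. rep_l2 (mult_op m u) x = rep_linf m x * rep_l2 u x"
proof -
  have "mult_op m u = abs_l2 (\<lambda>x. rep_linf m x * rep_l2 u x)"
    using mult_op.abs_eq[of "rep_linf m" "rep_l2 u"]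
    by (simp add: abs_linf_rep linf_rel_def ess_bounded_rep_linf abs_l2_rep l2_rel_def square_int_rep_l2)
  moreover have "square_int (\<lambda>x. rep_linf m x * rep_l2 u x)"
    by (rule square_int_bounded_mult[OF square_int_rep_l2 _ AE_rep_linf_le]) simp
  ultimately show ?thesis
    using rep_abs_l2 by simp
qed

lemma norm_mult_op: "norm (mult_op m u) \<le> norm m * norm u"
proof (rule norm_l2_leI)
  have "(\<integral>\<^sup>+x. ennreal ((cmod (rep_l2 (mult_op m u) x))\<^sup>2) \<partial>lborel)
    \<le> (\<integral>\<^sup>+x. ennreal ((norm m)\<^sup>2) * ennreal ((cmod (rep_l2 u x))\<^sup>2) \<partial>lborel)"
  proof (rule nn_integral_mono_AE)
    show "AE x in lborel. ennreal ((cmod (rep_l2 (mult_op m u) x))\<^sup>2)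
        \<le> ennreal ((norm m)\<^sup>2) * ennreal ((cmod (rep_l2 u x))\<^sup>2)"
      using rep_mult_op[of m u] AE_rep_linf_le[of m]
    proof eventually_elim
      case (elim x)
      then show ?case
        by (simp add: norm_mult power_mult_distrib mult_right_mono power_mono flip: ennreal_mult)
    qed
  qed
  also have "\<dots> = ennreal ((norm m * norm u)\<^sup>2)"
    by (subst nn_integral_cmult)
      (simp_all add: norm_l2_eq_nn_integral[symmetric] power_mult_distrib ennreal_mult)
  finally show "(\<integral>\<^sup>+x. ennreal ((cmod (rep_l2 (mult_op m u) x))\<^sup>2) \<partial>lborel)
    \<le> ennreal ((norm m * norm u)\<^sup>2)" .
qed simp

lemma mult_op_diff_right: "mult_op m (u - v) = mult_op m u - mult_op m v"
  by (rule l2_eqI)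
    (use rep_mult_op[of m "u - v"] rep_mult_op[of m u] rep_mult_op[of m v] rep_l2_diff[of u v]
      rep_l2_diff[of "mult_op m u" "mult_op m v"] in \<open>eventually_elim, simp add: right_diff_distrib\<close>)

lemma mult_op_add_right: "mult_op m (u + v) = mult_op m u + mult_op m v"
  by (rule l2_eqI)
    (use rep_mult_op[of m "u + v"] rep_mult_op[of m u] rep_mult_op[of m v] rep_l2_add[of u v]
      rep_l2_add[of "mult_op m u" "mult_op m v"] in \<open>eventually_elim, simp add: distrib_left\<close>)

lemma mult_op_diff_left: "mult_op (m - k) u = mult_op m u - mult_op k u"
  by (rule l2_eqI)
    (use rep_mult_op[of "m - k" u] rep_mult_op[of m u] rep_mult_op[of k u] rep_linf_diff[of m k]
      rep_l2_diff[of "mult_op m u" "mult_op k u"] in \<open>eventually_elim, simp add: left_diff_distrib\<close>)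

lemma mult_op_add_left: "mult_op (m + k) u = mult_op m u + mult_op k u"
  by (rule l2_eqI)
    (use rep_mult_op[of "m + k" u] rep_mult_op[of m u] rep_mult_op[of k u] rep_linf_add[of m k]
      rep_l2_add[of "mult_op m u" "mult_op k u"] in \<open>eventually_elim, simp add: distrib_right\<close>)

lemma mult_op_scaleR_left: "mult_op (r *\<^sub>R m) u = r *\<^sub>R mult_op m u"
  by (rule l2_eqI)
    (use rep_mult_op[of "r *\<^sub>R m" u] rep_mult_op[of m u] rep_linf_scaleR[of r m]
      rep_l2_scaleR[of r "mult_op m u"] in \<open>eventually_elim, simp\<close>)

subsection \<open>Translations\<close>

lemma nn_integral_square_shift:
  assumes [measurable]: "f \<in> borel_measurable borel"
  shows "(\<integral>\<^sup>+x. ennreal ((cmod (f (x + z)))\<^sup>2) \<partial>lborel) = (\<integral>\<^sup>+x. ennreal ((cmod (f x))\<^sup>2) \<partial>lborel)"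
  using nn_integral_lborel_shift[of "\<lambda>x. ennreal ((cmod (f x))\<^sup>2)"] by simp

lemma square_int_shift:
  assumes "square_int f"
  shows "square_int (\<lambda>x. f (x + z))"
proof -
  have [measurable]: "f \<in> borel_measurable borel" using assms by (simp add: square_int_def)
  show ?thesis
    using assms integrable_lborel_shift[of "\<lambda>x. (cmod (f x))\<^sup>2" z] by (simp add: square_int_def)
qed

lift_definition l2_shift :: "'a::euclidean_space \<Rightarrow> 'a l2 \<Rightarrow> 'a l2" is "\<lambda>z f x. f (x + z)"
proof -
  fix z and f g :: "'a \<Rightarrow> complex" assume "l2_rel f g"
  then show "l2_rel (\<lambda>x. f (x + z)) (\<lambda>x. g (x + z))"
    unfolding l2_rel_def using AE_lborel_shift[where P="\<lambda>x. f x = g x"] square_int_shift by blast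
qed

lemma rep_l2_shift: "AE x in lborel. rep_l2 (l2_shift z u) x = rep_l2 u (x + z)"
proof -
  have "l2_shift z u = abs_l2 (\<lambda>x. rep_l2 u (x + z))"
    using l2_shift.abs_eq[of "rep_l2 u" z] by (simp add: abs_l2_rep l2_rel_def square_int_rep_l2)
  then show ?thesis
    using rep_abs_l2[OF square_int_shift[OF square_int_rep_l2]] by simp
qed

lemma norm_l2_shift [simp]: "norm (l2_shift z u) = norm u"
proof -
  have "(\<integral>\<^sup>+x. ennreal ((cmod (rep_l2 (l2_shift z u) x))\<^sup>2) \<partial>lborel)
    = (\<integral>\<^sup>+x. ennreal ((cmod (rep_l2 u (x + z)))\<^sup>2) \<partial>lborel)"
    by (rule nn_integral_cong_AE) (use rep_l2_shift[of z u] in \<open>eventually_elim, simp\<close>)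
  then have "ennreal ((norm (l2_shift z u))\<^sup>2) = ennreal ((norm u)\<^sup>2)"
    unfolding norm_l2_eq_nn_integral by (simp add: nn_integral_square_shift)
  then show ?thesis by (simp add: power2_eq_iff_nonneg)
qed

lemma l2_shift_diff: "l2_shift z (u - v) = l2_shift z u - l2_shift z v"
  by (rule l2_eqI)
    (use rep_l2_shift[of z "u - v"] rep_l2_shift[of z u] rep_l2_shift[of z v]
      AE_lborel_shift[OF rep_l2_diff[of u v], of z]
      rep_l2_diff[of "l2_shift z u" "l2_shift z v"] in \<open>eventually_elim, simp\<close>)

lemma l2_shift_minus_cancel: "l2_shift z (l2_shift (- z) u) = u"
  by (rule l2_eqI)
    (use rep_l2_shift[of z "l2_shift (- z) u"] AE_lborel_shift[OF rep_l2_shift[of "- z" u], of z]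
      in \<open>eventually_elim, simp\<close>)

lemma ess_bounded_shift:
  assumes "ess_bounded f"
  shows "ess_bounded (\<lambda>x. f (x + z))"
proof -
  have [measurable]: "f \<in> borel_measurable borel" using assms by (simp add: ess_bounded_def)
  obtain C where "AE x in lborel. cmod (f x) \<le> C" using assms by (auto simp: ess_bounded_def)
  from AE_lborel_shift[OF this, of z] show ?thesis by (auto simp: ess_bounded_def)
qed

lift_definition linf_shift :: "'a::euclidean_space \<Rightarrow> 'a linf \<Rightarrow> 'a linf" is "\<lambda>z f x. f (x + z)"
proof -
  fix z and f g :: "'a \<Rightarrow> complex" assume "linf_rel f g"
  then show "linf_rel (\<lambda>x. f (x + z)) (\<lambda>x. g (x + z))"
    unfolding linf_rel_def using AE_lborel_shift[where P="\<lambda>x. f x = g x"] ess_bounded_shift by blast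
qed

lemma rep_linf_shift: "AE x in lborel. rep_linf (linf_shift z u) x = rep_linf u (x + z)"
proof -
  have "linf_shift z u = abs_linf (\<lambda>x. rep_linf u (x + z))"
    using linf_shift.abs_eq[of "rep_linf u" z] by (simp add: abs_linf_rep linf_rel_def ess_bounded_rep_linf)
  then show ?thesis
    using rep_abs_linf[OF ess_bounded_shift[OF ess_bounded_rep_linf]] by simp
qed

lemma linf_eqI:
  assumes "AE x in lborel. rep_linf u x = rep_linf v x"
  shows "u = v"
proof -
  have "linf_rel (rep_linf u) (rep_linf v)"
    using assms by (simp add: linf_rel_def ess_bounded_rep_linf)
  then show ?thesis by (metis Quotient3_rel_rep Quotient3_linf)
qed

lemma norm_linf_shift_le: "norm (linf_shift z v) \<le> norm v"
  by (rule norm_linf_leI)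
    (use rep_linf_shift[of z v] AE_lborel_shift[OF AE_rep_linf_le[of v], of z] in \<open>eventually_elim, simp\<close>)

lemma linf_shift_diff: "linf_shift z (u - v) = linf_shift z u - linf_shift z v"
  by (rule linf_eqI)
    (use rep_linf_shift[of z "u - v"] rep_linf_shift[of z u] rep_linf_shift[of z v]
      AE_lborel_shift[OF rep_linf_diff[of u v], of z]
      rep_linf_diff[of "linf_shift z u" "linf_shift z v"] in \<open>eventually_elim, simp\<close>)

lemma linf_shift_scaleR: "linf_shift z (r *\<^sub>R u) = r *\<^sub>R linf_shift z u"
  by (rule linf_eqI)
    (use rep_linf_shift[of z "r *\<^sub>R u"] rep_linf_shift[of z u]
      AE_lborel_shift[OF rep_linf_scaleR[of r u], of z]
      rep_linf_scaleR[of r "linf_shift z u"] in \<open>eventually_elim, simp\<close>)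

lemma linf_shift_exp: "linf_shift z (linf_exp u) = linf_exp (linf_shift z u)"
  by (rule linf_eqI)
    (use rep_linf_shift[of z "linf_exp u"] rep_linf_shift[of z u]
      AE_lborel_shift[OF rep_linf_exp[of u], of z]
      rep_linf_exp[of "linf_shift z u"] in \<open>eventually_elim, simp\<close>)

lemma linf_shift_minus_cancel: "linf_shift z (linf_shift (- z) u) = u"
  by (rule linf_eqI)
    (use rep_linf_shift[of z "linf_shift (- z) u"] AE_lborel_shift[OF rep_linf_shift[of "- z" u], of z]
      in \<open>eventually_elim, simp\<close>)

lemma l2_shift_mult_op: "l2_shift z (mult_op m u) = mult_op (linf_shift z m) (l2_shift z u)"
  by (rule l2_eqI)
    (use rep_l2_shift[of z "mult_op m u"] AE_lborel_shift[OF rep_mult_op[of m u], of z]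
      rep_linf_shift[of z m] rep_l2_shift[of z u] rep_mult_op[of "linf_shift z m" "l2_shift z u"]
      in \<open>eventually_elim, simp\<close>)

subsection \<open>Weak derivatives\<close>

lemma integrable_indicator_cball: "integrable lborel (indicat_real (cball (x::'a::euclidean_space) R))"
  using emeasure_bounded_finite[OF bounded_cball, of x R] by (intro integrable_real_indicator) auto

lemma locally_integrable_rep_l2: "locally_integrable (rep_l2 u)"
  unfolding locally_integrable_def
proof (intro conjI allI)
  fix R
  have "integrable lborel (\<lambda>x. indicat_real (cball 0 R) x + (cmod (rep_l2 u x))\<^sup>2)"
    using square_int_rep_l2[of u]
    by (intro Bochner_Integration.integrable_add integrable_indicator_cball) (auto simp: square_int_def)
  then show "integrable lborel (\<lambda>x. indicat_real (cball 0 R) x *\<^sub>R rep_l2 u x)"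
  proof (rule Bochner_Integration.integrable_bound)
    have "cmod c \<le> 1 + (cmod c)\<^sup>2" for c
      using sum_squares_bound[of 1 "cmod c"] norm_ge_zero[of c] unfolding power2_eq_square by linarith
    then show "AE x in lborel. norm (indicat_real (cball 0 R) x *\<^sub>R rep_l2 u x)
        \<le> norm (indicat_real (cball 0 R) x + (cmod (rep_l2 u x))\<^sup>2)"
      by (auto simp: indicator_def)
  qed (auto intro!: borel_measurable_scaleR borel_measurable_indicator)
qed simp

lemma locally_integrable_rep_linf: "locally_integrable (rep_linf v)"
  unfolding locally_integrable_def
proof (intro conjI allI)
  fix R
  have "integrable lborel (\<lambda>x. norm v * indicat_real (cball 0 R) x)"
    by (intro integrable_mult_right integrable_indicator_cball)
  then show "integrable lborel (\<lambda>x. indicat_real (cball 0 R) x *\<^sub>R rep_linf v x)"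
  proof (rule Bochner_Integration.integrable_bound)
    show "AE x in lborel. norm (indicat_real (cball 0 R) x *\<^sub>R rep_linf v x)
        \<le> norm (norm v * indicat_real (cball 0 R) x)"
      using AE_rep_linf_le[of v] by eventually_elim (auto simp: indicator_def)
  qed (auto intro!: borel_measurable_scaleR borel_measurable_indicator)
qed simp

lemma has_weak_deriv_cong_AE:
  assumes "has_weak_deriv bs f g"
    and "AE x in lborel. f x = f' x" "AE x in lborel. g x = g' x"
    and [measurable]: "f \<in> borel_measurable borel" "f' \<in> borel_measurable borel"
      "g \<in> borel_measurable borel" "g' \<in> borel_measurable borel"
    and "set bs \<subseteq> Basis"
  shows "has_weak_deriv bs f' g'"
  unfolding has_weak_deriv_def
proof
  fix \<phi> :: "'a \<Rightarrow> real" assume \<phi>: "\<phi> \<in> test_functions"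
  note [measurable] = test_functions_measurable[OF \<phi>]
    test_functions_measurable[OF test_functions_iter_partial[OF \<phi> \<open>set bs \<subseteq> Basis\<close>]]
  have "(\<integral>x. f' x * of_real (iter_partial bs \<phi> x) \<partial>lborel) = (\<integral>x. f x * of_real (iter_partial bs \<phi> x) \<partial>lborel)"
    using assms(2) by (intro integral_cong_AE) auto
  also have "\<dots> = (-1) ^ length bs * (\<integral>x. g x * of_real (\<phi> x) \<partial>lborel)"
    using assms(1) \<phi> by (simp add: has_weak_deriv_def)
  also have "(\<integral>x. g x * of_real (\<phi> x) \<partial>lborel) = (\<integral>x. g' x * of_real (\<phi> x) \<partial>lborel)"
    using assms(3) by (intro integral_cong_AE) auto
  finally show "(\<integral>x. f' x * of_real (iter_partial bs \<phi> x) \<partial>lborel)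
    = (-1) ^ length bs * (\<integral>x. g' x * of_real (\<phi> x) \<partial>lborel)" .
qed

lemma has_weak_deriv_shift:
  assumes "has_weak_deriv bs f g" "set bs \<subseteq> Basis"
    and [measurable]: "f \<in> borel_measurable borel" "g \<in> borel_measurable borel"
  shows "has_weak_deriv bs (\<lambda>x. f (x + a)) (\<lambda>x. g (x + a))"
  unfolding has_weak_deriv_def
proof
  fix \<phi> :: "'a \<Rightarrow> real" assume \<phi>: "\<phi> \<in> test_functions"
  note [measurable] = test_functions_measurable[OF \<phi>]
    test_functions_measurable[OF test_functions_iter_partial[OF \<phi> \<open>set bs \<subseteq> Basis\<close>]]
  have "(\<integral>x. f x * of_real (iter_partial bs \<phi> (x - a)) \<partial>lborel)
      = (-1) ^ length bs * (\<integral>x. g x * of_real (\<phi> (x - a)) \<partial>lborel)"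
    using assms(1)[unfolded has_weak_deriv_def, rule_format, OF test_functions_shift[OF \<phi>, of a]]
    by (simp add: iter_partial_shift)
  moreover have "(\<integral>x. f (x + a) * of_real (iter_partial bs \<phi> x) \<partial>lborel)
      = (\<integral>x. f x * of_real (iter_partial bs \<phi> (x - a)) \<partial>lborel)"
    using integral_lborel_shift[of "\<lambda>x. f x * of_real (iter_partial bs \<phi> (x - a))" a] by simp
  moreover have "(\<integral>x. g (x + a) * of_real (\<phi> x) \<partial>lborel) = (\<integral>x. g x * of_real (\<phi> (x - a)) \<partial>lborel)"
    using integral_lborel_shift[of "\<lambda>x. g x * of_real (\<phi> (x - a))" a] by simp
  ultimately show "(\<integral>x. f (x + a) * of_real (iter_partial bs \<phi> x) \<partial>lborel)
      = (-1) ^ length bs * (\<integral>x. g (x + a) * of_real (\<phi> x) \<partial>lborel)"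
    by simp
qed

lemma has_weak_deriv_diff:
  assumes "has_weak_deriv bs f g" "has_weak_deriv bs f' g'" "set bs \<subseteq> Basis"
    and "locally_integrable f" "locally_integrable g" "locally_integrable f'" "locally_integrable g'"
  shows "has_weak_deriv bs (\<lambda>x. f x - f' x) (\<lambda>x. g x - g' x)"
  unfolding has_weak_deriv_def
proof
  fix \<phi> :: "'a \<Rightarrow> real" assume \<phi>: "\<phi> \<in> test_functions"
  note \<psi> = test_functions_iter_partial[OF \<phi> assms(3)]
  show "(\<integral>x. (f x - f' x) * of_real (iter_partial bs \<phi> x) \<partial>lborel)
      = (-1) ^ length bs * (\<integral>x. (g x - g' x) * of_real (\<phi> x) \<partial>lborel)"
    using assms \<phi> by (simp add: left_diff_distrib integrable_mult_test[OF _ \<phi>]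
        integrable_mult_test[OF _ \<psi>] has_weak_deriv_def right_diff_distrib)
qed

text \<open>In \<open>iter_partial [b, c] \<phi>\<close> the derivative in direction
  \<open>b\<close> is the outermost one. The weak derivative \<open>v\<close> takes over exactly
  this one, leaving direction \<open>c\<close> to be tested against \<open>v\<close>.\<close>

lemma has_weak_deriv_Cons:
  assumes "has_weak_deriv [b] f v" "has_weak_deriv [b, c] f w" "c \<in> Basis"
  shows "has_weak_deriv [c] v w"
  unfolding has_weak_deriv_def
proof
  fix \<phi> :: "'a \<Rightarrow> real" assume \<phi>: "\<phi> \<in> test_functions"
  have "iter_partial [c] \<phi> \<in> test_functions"
    using assms(3) by (intro test_functions_iter_partial[OF \<phi>]) auto
  with assms(1) have "(\<integral>x. f x * of_real (iter_partial [b] (iter_partial [c] \<phi>) x) \<partial>lborel)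
      = - (\<integral>x. v x * of_real (iter_partial [c] \<phi> x) \<partial>lborel)"
    unfolding has_weak_deriv_def by (auto simp del: iter_partial.simps)
  then have "(\<integral>x. v x * of_real (iter_partial [c] \<phi> x) \<partial>lborel)
      = - (\<integral>x. f x * of_real (iter_partial [b] (iter_partial [c] \<phi>) x) \<partial>lborel)"
    by (simp only: minus_minus)
  moreover have "(\<integral>x. f x * of_real (iter_partial [b, c] \<phi> x) \<partial>lborel) = (\<integral>x. w x * of_real (\<phi> x) \<partial>lborel)"
    using assms(2) \<phi> unfolding has_weak_deriv_def by (auto simp del: iter_partial.simps)
  moreover have "iter_partial [b, c] \<phi> = iter_partial [b] (iter_partial [c] \<phi>)"
    by simp
  ultimately show "(\<integral>x. v x * of_real (iter_partial [c] \<phi> x) \<partial>lborel)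
      = (-1) ^ length [c] * (\<integral>x. w x * of_real (\<phi> x) \<partial>lborel)"
    by (simp del: iter_partial.simps)
qed

text \<open>The zeroth-order term of \<open>Hk_norm\<close> is itself obtained by choice; this
  identifies it with the function, so that \<open>Hk_norm\<close> dominates the \<open>L2\<close>
  norm.\<close>

lemma has_weak_deriv_Nil_AE:
  assumes "has_weak_deriv [] f g" "locally_integrable f" "locally_integrable g"
  shows "AE x in lborel. f x = g x"
proof -
  have "AE x in lborel. f x - g x = 0"
    using assms by (intro AE_eq_0_if_test_integrals locally_integrable_diff)
      (simp_all add: left_diff_distrib integrable_mult_test has_weak_deriv_def)
  then show ?thesis by simp
qed

subsection \<open>Difference quotients\<close>

text \<open>Jensen's inequality for the square, obtained from Cauchy-Schwarz against the constant 1,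
  followed by Tonelli. Where a slice is not integrable, its Bochner integral is 0 by convention and
  the pointwise bound is trivial.\<close>

lemma nn_integral_square_average:
  assumes "prob_space M" and [measurable]: "(\<lambda>(x, z). F x z) \<in> borel_measurable (lborel \<Otimes>\<^sub>M M)"
  shows "(\<integral>\<^sup>+x. ennreal ((cmod (\<integral>z. F x z \<partial>M))\<^sup>2) \<partial>(lborel :: 'a::euclidean_space measure))
    \<le> (\<integral>\<^sup>+z. (\<integral>\<^sup>+x. ennreal ((cmod (F x z))\<^sup>2) \<partial>lborel) \<partial>M)"
proof -
  interpret prob_space M by fact
  interpret pair_sigma_finite "lborel :: 'a measure" M by standard
  have "ennreal ((cmod (\<integral>z. F x z \<partial>M))\<^sup>2) \<le> (\<integral>\<^sup>+z. ennreal ((cmod (F x z))\<^sup>2) \<partial>M)" for x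
  proof -
    have [measurable]: "F x \<in> borel_measurable M" by measurable
    have "ennreal (cmod (\<integral>z. F x z \<partial>M)) \<le> (\<integral>\<^sup>+z. ennreal (cmod (F x z)) * 1 \<partial>M)"
    proof (cases "integrable M (F x)")
      case True
      then show ?thesis
        using integral_norm_bound_ennreal[of M "F x"] by simp
    qed (simp add: not_integrable_integral_eq)
    then have "(ennreal (cmod (\<integral>z. F x z \<partial>M)))\<^sup>2 \<le> (\<integral>\<^sup>+z. ennreal (cmod (F x z)) * 1 \<partial>M)\<^sup>2"
      by (rule power_mono) simp
    also have "\<dots> \<le> (\<integral>\<^sup>+z. (ennreal (cmod (F x z)))\<^sup>2 \<partial>M) * (\<integral>\<^sup>+z. 1\<^sup>2 \<partial>M)"
      by (rule Cauchy_Schwarz_nn_integral) measurable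
    finally show ?thesis by (simp add: ennreal_power emeasure_space_1)
  qed
  then have "(\<integral>\<^sup>+x. ennreal ((cmod (\<integral>z. F x z \<partial>M))\<^sup>2) \<partial>lborel)
      \<le> (\<integral>\<^sup>+x. (\<integral>\<^sup>+z. ennreal ((cmod (F x z))\<^sup>2) \<partial>M) \<partial>lborel)"
    by (rule nn_integral_mono)
  also have "\<dots> = (\<integral>\<^sup>+z. (\<integral>\<^sup>+x. ennreal ((cmod (F x z))\<^sup>2) \<partial>lborel) \<partial>M)"
    by (rule Fubini'[symmetric]) measurable
  finally show ?thesis .
qed

text \<open>The difference is an average of translates of the directional derivative along
  \<open>z\<close>, and averaging translates does not increase the norm.\<close>

lemma l2_first_difference:
  fixes u :: "'a::euclidean_space l2"
  assumes D: "\<And>b. b \<in> Basis \<Longrightarrow> has_weak_deriv [b] (rep_l2 u) (rep_l2 (v b))"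
  shows "norm (l2_shift z u - u) \<le> (\<Sum>b\<in>Basis. \<bar>z \<bullet> b\<bar> * norm (v b))"
proof -
  let ?f = "rep_l2 u" and ?s = "\<Sum>b\<in>Basis. (z \<bullet> b) *\<^sub>R v b"
  define F where "F x = (\<Sum>b\<in>Basis. of_real (z \<bullet> b) * rep_l2 (v b) x)" for x
  have [measurable]: "F \<in> borel_measurable borel" unfolding F_def[abs_def] by measurable
  have "AE x in lborel. \<forall>b\<in>Basis. rep_l2 ((z \<bullet> b) *\<^sub>R v b) x = of_real (z \<bullet> b) * rep_l2 (v b) x"
    by (rule AE_finite_allI) (auto intro: rep_l2_scaleR)
  moreover have "AE x in lborel. rep_l2 ?s x = (\<Sum>b\<in>Basis. rep_l2 ((z \<bullet> b) *\<^sub>R v b) x)"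
    by (rule rep_l2_sum) simp
  ultimately have F: "AE x in lborel. F x = rep_l2 ?s x"
    by eventually_elim (simp add: F_def)
  have "AE x in lborel. ?f (x + z) - ?f x = (\<integral>s. F (x + s *\<^sub>R z) \<partial>unit_measure)"
    unfolding F_def by (intro weak_deriv_difference locally_integrable_rep_l2 D)
  with rep_l2_diff[of "l2_shift z u" u] rep_l2_shift[of z u]
  have "AE x in lborel. rep_l2 (l2_shift z u - u) x = (\<integral>s. F (x + s *\<^sub>R z) \<partial>unit_measure)"
    by eventually_elim simp
  then have "(\<integral>\<^sup>+x. ennreal ((cmod (rep_l2 (l2_shift z u - u) x))\<^sup>2) \<partial>lborel)
    = (\<integral>\<^sup>+x. ennreal ((cmod (\<integral>s. F (x + s *\<^sub>R z) \<partial>unit_measure))\<^sup>2) \<partial>lborel)"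
    by (intro nn_integral_cong_AE) auto
  also have "\<dots> \<le> (\<integral>\<^sup>+s. (\<integral>\<^sup>+x. ennreal ((cmod (F (x + s *\<^sub>R z)))\<^sup>2) \<partial>lborel) \<partial>unit_measure)"
    by (rule nn_integral_square_average[OF prob_space_unit_measure]) measurable
  also have "\<dots> = (\<integral>\<^sup>+x. ennreal ((cmod (F x))\<^sup>2) \<partial>lborel)"
    by (simp add: nn_integral_square_shift unit_measure.emeasure_space_1[simplified])
  also have "\<dots> = (\<integral>\<^sup>+x. ennreal ((cmod (rep_l2 ?s x))\<^sup>2) \<partial>lborel)"
    using F by (intro nn_integral_cong_AE) auto
  also have "\<dots> = ennreal ((norm ?s)\<^sup>2)"
    by (simp add: norm_l2_eq_nn_integral)
  finally have "norm (l2_shift z u - u) \<le> norm ?s"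
    by (rule norm_l2_leI) simp
  also have "\<dots> \<le> (\<Sum>b\<in>Basis. norm ((z \<bullet> b) *\<^sub>R v b))"
    by (rule norm_sum)
  finally show ?thesis by simp
qed

lemma has_weak_deriv_l2_shift_diff:
  fixes u v :: "'a::euclidean_space l2"
  assumes "has_weak_deriv bs (rep_l2 u) (rep_l2 v)" "set bs \<subseteq> Basis"
  shows "has_weak_deriv bs (rep_l2 (u - l2_shift z u)) (rep_l2 (v - l2_shift z v))"
proof (rule has_weak_deriv_cong_AE)
  show "has_weak_deriv bs (\<lambda>x. rep_l2 u x - rep_l2 u (x + z)) (\<lambda>x. rep_l2 v x - rep_l2 v (x + z))"
    using assms by (intro has_weak_deriv_diff has_weak_deriv_shift locally_integrable_rep_l2
        locally_integrable_shift) auto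
  have aux: "AE x in lborel. rep_l2 w x - rep_l2 w (x + z) = rep_l2 (w - l2_shift z w) x" for w :: "'a l2"
    using rep_l2_diff[of w "l2_shift z w"] rep_l2_shift[of z w] by eventually_elim simp
  show "AE x in lborel. rep_l2 u x - rep_l2 u (x + z) = rep_l2 (u - l2_shift z u) x"
    "AE x in lborel. rep_l2 v x - rep_l2 v (x + z) = rep_l2 (v - l2_shift z v) x"
    by (rule aux)+
qed (use assms in auto)

text \<open>The second difference is the first difference of \<open>u - l2_shift (- z) u\<close>, whose weak
  derivatives are the corresponding first differences of those of \<open>u\<close>.\<close>

lemma l2_second_difference:
  fixes u :: "'a::euclidean_space l2"
  assumes D: "\<And>b. b \<in> Basis \<Longrightarrow> has_weak_deriv [b] (rep_l2 u) (rep_l2 (v b))"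
    and DD: "\<And>b c. b \<in> Basis \<Longrightarrow> c \<in> Basis \<Longrightarrow> has_weak_deriv [b, c] (rep_l2 u) (rep_l2 (w b c))"
  shows "norm (l2_shift z u + l2_shift (- z) u - 2 *\<^sub>R u)
    \<le> (\<Sum>b\<in>Basis. \<bar>z \<bullet> b\<bar> * (\<Sum>c\<in>Basis. \<bar>z \<bullet> c\<bar> * norm (w b c)))"
proof -
  let ?u = "u - l2_shift (- z) u"
  have eq: "l2_shift z ?u - ?u = l2_shift z u + l2_shift (- z) u - 2 *\<^sub>R u"
    by (simp add: l2_shift_diff l2_shift_minus_cancel scaleR_2)
  have "norm (l2_shift z ?u - ?u) \<le> (\<Sum>b\<in>Basis. \<bar>z \<bullet> b\<bar> * norm (v b - l2_shift (- z) (v b)))"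
    by (intro l2_first_difference has_weak_deriv_l2_shift_diff D) auto
  also have "\<dots> \<le> (\<Sum>b\<in>Basis. \<bar>z \<bullet> b\<bar> * (\<Sum>c\<in>Basis. \<bar>z \<bullet> c\<bar> * norm (w b c)))"
  proof (intro sum_mono mult_left_mono)
    fix b :: 'a assume b: "b \<in> Basis"
    have "norm (l2_shift (- z) (v b) - v b) \<le> (\<Sum>c\<in>Basis. \<bar>(- z) \<bullet> c\<bar> * norm (w b c))"
      using b by (intro l2_first_difference) (blast intro: has_weak_deriv_Cons D DD)
    then show "norm (v b - l2_shift (- z) (v b)) \<le> (\<Sum>c\<in>Basis. \<bar>z \<bullet> c\<bar> * norm (w b c))"
      by (simp add: norm_minus_commute)
  qed simp
  finally show ?thesis by (simp only: eq)
qed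

lemma linf_first_difference:
  fixes u :: "'a::euclidean_space linf"
  assumes D: "\<And>b. b \<in> Basis \<Longrightarrow> has_weak_deriv [b] (rep_linf u) (rep_linf (v b))"
  shows "norm (linf_shift z u - u) \<le> (\<Sum>b\<in>Basis. \<bar>z \<bullet> b\<bar> * norm (v b))"
proof -
  let ?f = "rep_linf u" and ?K = "\<Sum>b\<in>Basis. \<bar>z \<bullet> b\<bar> * norm (v b)"
  define F where "F x = (\<Sum>b\<in>Basis. of_real (z \<bullet> b) * rep_linf (v b) x)" for x
  have [measurable]: "F \<in> borel_measurable borel" unfolding F_def[abs_def] by measurable
  have "AE x in lborel. \<forall>b\<in>Basis. cmod (rep_linf (v b) x) \<le> norm (v b)"
    by (rule AE_finite_allI) (auto intro: AE_rep_linf_le)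
  then have F: "AE x in lborel. cmod (F x) \<le> ?K"
  proof eventually_elim
    case (elim x)
    then show ?case unfolding F_def
      by (intro order_trans[OF norm_sum] sum_mono) (auto simp: norm_mult intro!: mult_left_mono)
  qed
  have "AE s in unit_measure. AE x in lborel. cmod (F (x + s *\<^sub>R z)) \<le> ?K"
    by (rule AE_I2, rule AE_lborel_shift[where P="\<lambda>x. cmod (F x) \<le> ?K", OF F])
  \<comment> \<open>The null set of exceptional \<open>x\<close> may depend on \<open>s\<close>.
    Exchanging the quantifiers gives, for almost every \<open>x\<close>, a bound for almost every
    \<open>s\<close>, which is what estimating the average at that \<open>x\<close>
    requires.\<close>
  then have "AE x in lborel. AE s in unit_measure. cmod (F (x + s *\<^sub>R z)) \<le> ?K"
    by (subst lborel_unit.AE_commute) measurable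
  moreover have "AE x in lborel. ?f (x + z) - ?f x = (\<integral>s. F (x + s *\<^sub>R z) \<partial>unit_measure)"
    unfolding F_def by (intro weak_deriv_difference locally_integrable_rep_linf D)
  ultimately have "AE x in lborel. cmod (rep_linf (linf_shift z u - u) x) \<le> ?K"
    using rep_linf_diff[of "linf_shift z u" u] rep_linf_shift[of z u]
  proof eventually_elim
    case (elim x)
    have "cmod (\<integral>s. F (x + s *\<^sub>R z) \<partial>unit_measure) \<le> ?K"
    proof (cases "integrable unit_measure (\<lambda>s. F (x + s *\<^sub>R z))")
      case True
      have "cmod (\<integral>s. F (x + s *\<^sub>R z) \<partial>unit_measure) \<le> (\<integral>s. cmod (F (x + s *\<^sub>R z)) \<partial>unit_measure)"
        by (rule integral_norm_bound)
      also have "\<dots> \<le> ?K"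
        using True elim(1) by (intro unit_measure.integral_le_const integrable_norm)
      finally show ?thesis .
    qed (simp add: not_integrable_integral_eq sum_nonneg)
    with elim show ?case by simp
  qed
  then show ?thesis by (rule norm_linf_leI)
qed

lemma has_weak_deriv_linf_shift_diff:
  fixes u v :: "'a::euclidean_space linf"
  assumes "has_weak_deriv bs (rep_linf u) (rep_linf v)" "set bs \<subseteq> Basis"
  shows "has_weak_deriv bs (rep_linf (u - linf_shift z u)) (rep_linf (v - linf_shift z v))"
proof (rule has_weak_deriv_cong_AE)
  show "has_weak_deriv bs (\<lambda>x. rep_linf u x - rep_linf u (x + z)) (\<lambda>x. rep_linf v x - rep_linf v (x + z))"
    using assms by (intro has_weak_deriv_diff has_weak_deriv_shift locally_integrable_rep_linf
        locally_integrable_shift) auto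
  have aux: "AE x in lborel. rep_linf w x - rep_linf w (x + z) = rep_linf (w - linf_shift z w) x" for w :: "'a linf"
    using rep_linf_diff[of w "linf_shift z w"] rep_linf_shift[of z w] by eventually_elim simp
  show "AE x in lborel. rep_linf u x - rep_linf u (x + z) = rep_linf (u - linf_shift z u) x"
    "AE x in lborel. rep_linf v x - rep_linf v (x + z) = rep_linf (v - linf_shift z v) x"
    by (rule aux)+
qed (use assms in auto)

lemma linf_second_difference:
  fixes u :: "'a::euclidean_space linf"
  assumes D: "\<And>b. b \<in> Basis \<Longrightarrow> has_weak_deriv [b] (rep_linf u) (rep_linf (v b))"
    and DD: "\<And>b c. b \<in> Basis \<Longrightarrow> c \<in> Basis \<Longrightarrow> has_weak_deriv [b, c] (rep_linf u) (rep_linf (w b c))"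
  shows "norm (linf_shift z u + linf_shift (- z) u - 2 *\<^sub>R u)
    \<le> (\<Sum>b\<in>Basis. \<bar>z \<bullet> b\<bar> * (\<Sum>c\<in>Basis. \<bar>z \<bullet> c\<bar> * norm (w b c)))"
proof -
  let ?u = "u - linf_shift (- z) u"
  have eq: "linf_shift z ?u - ?u = linf_shift z u + linf_shift (- z) u - 2 *\<^sub>R u"
    by (simp add: linf_shift_diff linf_shift_minus_cancel scaleR_2)
  have "norm (linf_shift z ?u - ?u) \<le> (\<Sum>b\<in>Basis. \<bar>z \<bullet> b\<bar> * norm (v b - linf_shift (- z) (v b)))"
    by (intro linf_first_difference has_weak_deriv_linf_shift_diff D) auto
  also have "\<dots> \<le> (\<Sum>b\<in>Basis. \<bar>z \<bullet> b\<bar> * (\<Sum>c\<in>Basis. \<bar>z \<bullet> c\<bar> * norm (w b c)))"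
  proof (intro sum_mono mult_left_mono)
    fix b :: 'a assume b: "b \<in> Basis"
    have "norm (linf_shift (- z) (v b) - v b) \<le> (\<Sum>c\<in>Basis. \<bar>(- z) \<bullet> c\<bar> * norm (w b c))"
      using b by (intro linf_first_difference) (blast intro: has_weak_deriv_Cons D DD)
    then show "norm (v b - linf_shift (- z) (v b)) \<le> (\<Sum>c\<in>Basis. \<bar>z \<bullet> c\<bar> * norm (w b c))"
      by (simp add: norm_minus_commute)
  qed simp
  finally show ?thesis by (simp only: eq)
qed

subsection \<open>Bounds on difference quotients\<close>

text \<open>A quantitative substitute for an H2 bound. First differences are included because the
  product rule for second differences produces products of first differences.\<close>

definition l2_regular :: "real \<Rightarrow> 'a::euclidean_space l2 \<Rightarrow> bool" where
  "l2_regular K u \<longleftrightarrow> norm u \<le> K \<and> (\<forall>z. norm (l2_shift z u - u) \<le> K * norm z) \<and>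
     (\<forall>z. norm (l2_shift z u + l2_shift (- z) u - 2 *\<^sub>R u) \<le> K * (norm z)\<^sup>2)"

definition linf_regular :: "real \<Rightarrow> 'a::euclidean_space linf \<Rightarrow> bool" where
  "linf_regular K v \<longleftrightarrow> norm v \<le> K \<and> (\<forall>z. norm (linf_shift z v - v) \<le> K * norm z) \<and>
     (\<forall>z. norm (linf_shift z v + linf_shift (- z) v - 2 *\<^sub>R v) \<le> K * (norm z)\<^sup>2)"

lemma l2_regular_mono: "l2_regular K u \<Longrightarrow> K \<le> L \<Longrightarrow> l2_regular L u"
  unfolding l2_regular_def
  by (meson mult_right_mono norm_ge_zero order_trans zero_le_power2)

lemma sum_Basis_abs_inner_le:
  fixes z :: "'a::euclidean_space"
  assumes "\<And>b. b \<in> Basis \<Longrightarrow> c b \<le> K" "0 \<le> K"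
  shows "(\<Sum>b\<in>Basis. \<bar>z \<bullet> b\<bar> * c b) \<le> real DIM('a) * (norm z * K)"
proof -
  have "(\<Sum>b\<in>(Basis::'a set). \<bar>z \<bullet> b\<bar> * c b) \<le> (\<Sum>b\<in>(Basis::'a set). norm z * K)"
    using assms by (intro sum_mono) (smt (verit) Basis_le_norm abs_ge_zero mult_left_mono mult_right_mono)
  then show ?thesis by simp
qed

lemma DIM_le_power2: "real DIM('a::euclidean_space) \<le> (real DIM('a))\<^sup>2" "1 \<le> (real DIM('a))\<^sup>2"
proof -
  have "1 \<le> real DIM('a)" using DIM_positive[where 'a='a] by linarith
  then show "real DIM('a) \<le> (real DIM('a))\<^sup>2" "1 \<le> (real DIM('a))\<^sup>2"
    by (simp_all add: power2_eq_square mult_le_cancel_left1 one_le_power[where n=2, unfolded power2_eq_square])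
qed

lemma finite_derivs_upto: "finite (derivs_upto k :: 'a::euclidean_space list set)"
  unfolding derivs_upto_def by (rule finite_lists_length_le) simp

lemma sum_Basis_abs_inner_twice_le:
  fixes z :: "'a::euclidean_space"
  assumes N: "0 \<le> N" and w: "\<And>b c. b \<in> Basis \<Longrightarrow> c \<in> Basis \<Longrightarrow> n b c \<le> N"
  shows "(\<Sum>b\<in>Basis. \<bar>z \<bullet> b\<bar> * (\<Sum>c\<in>Basis. \<bar>z \<bullet> c\<bar> * n b c)) \<le> (real DIM('a))\<^sup>2 * N * (norm z)\<^sup>2"
proof -
  have "(\<Sum>b\<in>Basis. \<bar>z \<bullet> b\<bar> * (\<Sum>c\<in>Basis. \<bar>z \<bullet> c\<bar> * n b c))
      \<le> real DIM('a) * (norm z * (real DIM('a) * (norm z * N)))"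
    using N w by (intro sum_Basis_abs_inner_le) auto
  then show ?thesis by (simp add: power2_eq_square mult_ac)
qed

text \<open>The factor \<open>(real DIM('a))\<^sup>2\<close> counts the pairs of directions in a
  second difference, each component of \<open>z\<close> being at most \<open>norm z\<close>. As the
  dimension is at least 1, it also covers the orders zero and one, so one constant serves for all
  three bounds.\<close>

lemma Hk_space_2_regular:
  fixes u :: "'a::euclidean_space l2"
  assumes u: "u \<in> Hk_space 2"
  shows "l2_regular ((real DIM('a))\<^sup>2 * Hk_norm 2 u) u"
proof -
  have ex: "has_weak_deriv bs (rep_l2 u) (rep_l2 (weak_deriv_l2 bs u))" if "bs \<in> derivs_upto 2" for bs
    unfolding weak_deriv_l2_def using u that
    by (intro someI_ex[of "\<lambda>v. has_weak_deriv bs (rep_l2 u) (rep_l2 v)"]) (auto simp: Hk_space_def)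
  have le: "norm (weak_deriv_l2 bs u) \<le> Hk_norm 2 u" if "bs \<in> derivs_upto 2" for bs
    unfolding Hk_norm_def
    using member_le_sum[OF that _ finite_derivs_upto, of "\<lambda>bs. (norm (weak_deriv_l2 bs u))\<^sup>2"]
    by (intro real_le_rsqrt) simp
  have mem: "[] \<in> derivs_upto 2" "b \<in> Basis \<Longrightarrow> [b] \<in> derivs_upto 2"
    "b \<in> Basis \<Longrightarrow> c \<in> Basis \<Longrightarrow> [b, c] \<in> derivs_upto 2" for b c :: 'a
    by (auto simp: derivs_upto_def)
  have N: "0 \<le> Hk_norm 2 u" by (simp add: Hk_norm_def sum_nonneg)
  have "weak_deriv_l2 [] u = u"
    using has_weak_deriv_Nil_AE[OF ex[OF mem(1)] locally_integrable_rep_l2 locally_integrable_rep_l2]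
    by (intro l2_eqI) auto
  then have "norm u \<le> Hk_norm 2 u" using le[OF mem(1)] by simp
  also have "\<dots> \<le> (real DIM('a))\<^sup>2 * Hk_norm 2 u"
    using mult_right_mono[OF DIM_le_power2(2)[where 'a='a] N] by simp
  finally have 0: "norm u \<le> (real DIM('a))\<^sup>2 * Hk_norm 2 u" .
  have 1: "norm (l2_shift z u - u) \<le> (real DIM('a))\<^sup>2 * Hk_norm 2 u * norm z" for z
  proof -
    have "norm (l2_shift z u - u) \<le> (\<Sum>b\<in>Basis. \<bar>z \<bullet> b\<bar> * norm (weak_deriv_l2 [b] u))"
      by (intro l2_first_difference ex mem)
    also have "\<dots> \<le> real DIM('a) * (norm z * Hk_norm 2 u)"
      by (intro sum_Basis_abs_inner_le le mem N)
    also have "\<dots> \<le> (real DIM('a))\<^sup>2 * (norm z * Hk_norm 2 u)"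
      using N by (intro mult_right_mono DIM_le_power2) auto
    finally show ?thesis by (simp add: mult_ac)
  qed
  have 2: "norm (l2_shift z u + l2_shift (- z) u - 2 *\<^sub>R u) \<le> (real DIM('a))\<^sup>2 * Hk_norm 2 u * (norm z)\<^sup>2" for z
  proof -
    have "norm (l2_shift z u + l2_shift (- z) u - 2 *\<^sub>R u)
      \<le> (\<Sum>b\<in>Basis. \<bar>z \<bullet> b\<bar> * (\<Sum>c\<in>Basis. \<bar>z \<bullet> c\<bar> * norm (weak_deriv_l2 [b, c] u)))"
      by (intro l2_second_difference[of u "\<lambda>b. weak_deriv_l2 [b] u"] ex mem)
    also have "\<dots> \<le> (real DIM('a))\<^sup>2 * Hk_norm 2 u * (norm z)\<^sup>2"
      by (intro sum_Basis_abs_inner_twice_le N le mem)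
    finally show ?thesis .
  qed
  show ?thesis using 0 1 2 by (simp add: l2_regular_def)
qed

text \<open>The bound on \<open>norm v\<close> is supplied separately: in the theorem it comes from
  the \<open>BUC1\<close> half of the assumption, and only the derivatives of order one and two are
  read off \<open>Wk_inf_norm\<close>.\<close>

lemma Wk_inf_space_2_regular:
  fixes v :: "'a::euclidean_space linf"
  assumes v: "v \<in> Wk_inf_space 2" and n: "norm v \<le> N" and W: "Wk_inf_norm 2 v \<le> N"
  shows "linf_regular ((real DIM('a))\<^sup>2 * N) v"
proof -
  have ex: "has_weak_deriv bs (rep_linf v) (rep_linf (weak_deriv_linf bs v))" if "bs \<in> derivs_upto 2" for bs
    unfolding weak_deriv_linf_def using v that
    by (intro someI_ex[of "\<lambda>w. has_weak_deriv bs (rep_linf v) (rep_linf w)"]) (auto simp: Wk_inf_space_def)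
  have le: "norm (weak_deriv_linf bs v) \<le> N" if "bs \<in> derivs_upto 2" for bs
  proof -
    have "norm (weak_deriv_linf bs v) \<le> Wk_inf_norm 2 v"
      unfolding Wk_inf_norm_def using that finite_derivs_upto by (intro Max_ge) auto
    with W show ?thesis by simp
  qed
  have mem: "b \<in> Basis \<Longrightarrow> [b] \<in> derivs_upto 2"
    "b \<in> Basis \<Longrightarrow> c \<in> Basis \<Longrightarrow> [b, c] \<in> derivs_upto 2" for b c :: 'a
    by (auto simp: derivs_upto_def)
  have N: "0 \<le> N" using n norm_ge_zero[of v] by linarith
  have 0: "norm v \<le> (real DIM('a))\<^sup>2 * N"
    using n mult_right_mono[OF DIM_le_power2(2)[where 'a='a] N] by simp
  have 1: "norm (linf_shift z v - v) \<le> (real DIM('a))\<^sup>2 * N * norm z" for z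
  proof -
    have "norm (linf_shift z v - v) \<le> (\<Sum>b\<in>Basis. \<bar>z \<bullet> b\<bar> * norm (weak_deriv_linf [b] v))"
      by (intro linf_first_difference ex mem)
    also have "\<dots> \<le> real DIM('a) * (norm z * N)"
      by (intro sum_Basis_abs_inner_le le mem N)
    also have "\<dots> \<le> (real DIM('a))\<^sup>2 * (norm z * N)"
      using N by (intro mult_right_mono DIM_le_power2) auto
    finally show ?thesis by (simp add: mult_ac)
  qed
  have 2: "norm (linf_shift z v + linf_shift (- z) v - 2 *\<^sub>R v) \<le> (real DIM('a))\<^sup>2 * N * (norm z)\<^sup>2" for z
  proof -
    have "norm (linf_shift z v + linf_shift (- z) v - 2 *\<^sub>R v)
      \<le> (\<Sum>b\<in>Basis. \<bar>z \<bullet> b\<bar> * (\<Sum>c\<in>Basis. \<bar>z \<bullet> c\<bar> * norm (weak_deriv_linf [b, c] v)))"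
      by (intro linf_second_difference[of v "\<lambda>b. weak_deriv_linf [b] v"] ex mem)
    also have "\<dots> \<le> (real DIM('a))\<^sup>2 * N * (norm z)\<^sup>2"
      by (intro sum_Basis_abs_inner_twice_le N le mem)
    finally show ?thesis .
  qed
  show ?thesis using 0 1 2 by (simp add: linf_regular_def)
qed

subsection \<open>Multiplication and exponentials\<close>

text \<open>The Leibniz rule for differences. The size \<open>A\<close> of the multiplier is kept
  apart from the bound \<open>B\<close> on its difference quotients: for a multiplier within O(h) of
  a constant in the sense of \<open>B\<close>, the growth factor is then \<open>A\<close> up to
  O(h). The coefficient 3 counts the two cross terms and the second difference of
  \<open>m\<close>.\<close>

lemma l2_regular_mult_op:
  fixes u :: "'a::euclidean_space l2"
  assumes u: "l2_regular N u" and m: "norm m \<le> A" and B: "0 \<le> B"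
    and m1: "\<And>z. norm (linf_shift z m - m) \<le> B * norm z"
    and m2: "\<And>z. norm (linf_shift z m + linf_shift (- z) m - 2 *\<^sub>R m) \<le> B * (norm z)\<^sup>2"
  shows "l2_regular ((A + 3 * B) * N) (mult_op m u)"
proof -
  have A: "0 \<le> A" using m norm_ge_zero order_trans by blast
  have u0: "norm u \<le> N" and u1: "\<And>z. norm (l2_shift z u - u) \<le> N * norm z"
    and u2: "\<And>z. norm (l2_shift z u + l2_shift (- z) u - 2 *\<^sub>R u) \<le> N * (norm z)\<^sup>2"
    using u by (auto simp: l2_regular_def)
  have N: "0 \<le> N" using u0 norm_ge_zero order_trans by blast
  have le: "norm (mult_op k w) \<le> a * b" if "norm k \<le> a" "norm w \<le> b" for k :: "'a linf" and w a b
    using that by (intro order_trans[OF norm_mult_op] mult_mono) (auto intro: order_trans[OF norm_ge_zero])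
  have 0: "norm (mult_op m u) \<le> (A + 3 * B) * N"
    using le[OF m u0] mult_nonneg_nonneg[OF B N] by (simp add: algebra_simps)
  have 1: "norm (l2_shift z (mult_op m u) - mult_op m u) \<le> (A + 3 * B) * N * norm z" for z
  proof -
    have "l2_shift z (mult_op m u) - mult_op m u
      = mult_op (linf_shift z m - m) (l2_shift z u) + mult_op m (l2_shift z u - u)"
      by (simp add: l2_shift_mult_op mult_op_diff_left mult_op_diff_right)
    then have "norm (l2_shift z (mult_op m u) - mult_op m u) \<le> B * norm z * N + A * (N * norm z)"
      using u0 by (simp only:) (intro norm_triangle_mono le m1 m u1, simp)
    also have "\<dots> \<le> (A + 3 * B) * N * norm z"
      using mult_nonneg_nonneg[OF mult_nonneg_nonneg[OF B N] norm_ge_zero[of z]] by (simp add: algebra_simps)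
    finally show ?thesis .
  qed
  have 2: "norm (l2_shift z (mult_op m u) + l2_shift (- z) (mult_op m u) - 2 *\<^sub>R mult_op m u)
      \<le> (A + 3 * B) * N * (norm z)\<^sup>2" for z
  proof -
    have "l2_shift z (mult_op m u) + l2_shift (- z) (mult_op m u) - 2 *\<^sub>R mult_op m u
      = mult_op m (l2_shift z u + l2_shift (- z) u - 2 *\<^sub>R u)
        + mult_op (linf_shift z m - m) (l2_shift z u - u)
        + mult_op (linf_shift (- z) m - m) (l2_shift (- z) u - u)
        + mult_op (linf_shift z m + linf_shift (- z) m - 2 *\<^sub>R m) u"
      by (simp add: l2_shift_mult_op mult_op_diff_left mult_op_diff_right mult_op_add_left
          mult_op_add_right scaleR_2)
    moreover have "norm \<dots> \<le> A * (N * (norm z)\<^sup>2) + (B * norm z) * (N * norm z)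
        + (B * norm (- z)) * (N * norm (- z)) + (B * (norm z)\<^sup>2) * N"
      by (intro norm_triangle_mono le m m1 m2 u0 u1 u2)
    moreover have "A * (N * (norm z)\<^sup>2) + (B * norm z) * (N * norm z)
        + (B * norm (- z)) * (N * norm (- z)) + (B * (norm z)\<^sup>2) * N = (A + 3 * B) * N * (norm z)\<^sup>2"
      by (simp add: algebra_simps power2_eq_square)
    ultimately show ?thesis by simp
  qed
  show ?thesis using 0 1 2 by (simp add: l2_regular_def)
qed

lemma linf_regular_nonneg: "linf_regular K v \<Longrightarrow> 0 \<le> K"
  unfolding linf_regular_def by (meson norm_ge_zero order_trans)

lemma l2_regular_nonneg: "l2_regular K v \<Longrightarrow> 0 \<le> K"
  unfolding l2_regular_def by (meson norm_ge_zero order_trans)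

lemma l2_regular_mult_op_regular:
  assumes "l2_regular N u" "linf_regular K v"
  shows "l2_regular (4 * K * N) (mult_op v u)"
proof -
  have "l2_regular ((K + 3 * K) * N) (mult_op v u)"
    using assms linf_regular_nonneg[OF assms(2)] by (intro l2_regular_mult_op) (auto simp: linf_regular_def)
  then show ?thesis by simp
qed

section \<open>First and second differences of exponentials\<close>

lemma cmod_exp_minus_1_le: "cmod (exp w - 1) \<le> exp (cmod w) * cmod w"
  using Taylor_exp_field[of w 0] by simp

lemma cmod_exp_second_le: "cmod (exp w - 1 - w) \<le> exp (cmod w) * (cmod w)\<^sup>2"
  using Taylor_exp_field[of w 1] by (simp add: power2_eq_square diff_diff_eq)

lemma cmod_exp_le: "cmod w \<le> R \<Longrightarrow> cmod (exp w) \<le> exp R"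
  by (meson exp_le_cancel_iff norm_exp order_trans)

text \<open>After factoring out \<open>exp c\<close>, which is bounded by \<open>exp R\<close>, the
  remaining exponent \<open>a - c\<close> has modulus at most \<open>2 * R\<close>; together they
  give \<open>3 * R\<close>.\<close>

lemma cmod_exp_diff_le:
  assumes "cmod a \<le> R" "cmod c \<le> R"
  shows "cmod (exp a - exp c) \<le> exp (3 * R) * cmod (a - c)"
proof -
  have "cmod (a - c) \<le> 2 * R"
    using assms norm_triangle_ineq4[of a c] by linarith
  have "exp a - exp c = exp c * (exp (a - c) - 1)"
    by (simp add: exp_diff field_simps)
  then have "cmod (exp a - exp c) = cmod (exp c) * cmod (exp (a - c) - 1)"
    by (simp add: norm_mult)
  also have "\<dots> \<le> exp R * (exp (2 * R) * cmod (a - c))"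
    using \<open>cmod (a - c) \<le> 2 * R\<close>
    by (intro mult_mono cmod_exp_le assms order_trans[OF cmod_exp_minus_1_le] mult_right_mono) auto
  also have "\<dots> = exp (3 * R) * cmod (a - c)"
    by (simp flip: exp_add)
  finally show ?thesis .
qed

text \<open>With \<open>exp c\<close> factored out, the Taylor remainders at \<open>a - c\<close>
  and \<open>b - c\<close> are quadratic, and the two linear terms recombine into
  \<open>a + b - 2 * c\<close>, which is small for symmetric translates although each linear term
  alone is only of first order.\<close>

lemma cmod_exp_second_difference_le:
  assumes R: "cmod a \<le> R" "cmod b \<le> R" "cmod c \<le> R"
  shows "cmod (exp a + exp b - 2 * exp c)
    \<le> exp (3 * R) * (cmod (a + b - 2 * c) + (cmod (a - c))\<^sup>2 + (cmod (b - c))\<^sup>2)"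
proof -
  have le: "cmod (a - c) \<le> 2 * R" "cmod (b - c) \<le> 2 * R"
    using R norm_triangle_ineq4[of a c] norm_triangle_ineq4[of b c] by linarith+
  have R0: "0 \<le> R" using R(1) norm_ge_zero order_trans by blast
  have "exp a + exp b - 2 * exp c
      = exp c * ((exp (a - c) - 1 - (a - c)) + (exp (b - c) - 1 - (b - c)) + (a + b - 2 * c))"
    by (simp add: exp_diff field_simps)
  then have "cmod (exp a + exp b - 2 * exp c)
      = cmod (exp c) * cmod ((exp (a - c) - 1 - (a - c)) + (exp (b - c) - 1 - (b - c)) + (a + b - 2 * c))"
    by (simp add: norm_mult)
  also have "\<dots> \<le> exp R * (exp (2 * R) * (cmod (a - c))\<^sup>2 + exp (2 * R) * (cmod (b - c))\<^sup>2
      + exp (2 * R) * cmod (a + b - 2 * c))"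
  proof (intro mult_mono cmod_exp_le R norm_triangle_mono)
    show "cmod (exp (a - c) - 1 - (a - c)) \<le> exp (2 * R) * (cmod (a - c))\<^sup>2"
      "cmod (exp (b - c) - 1 - (b - c)) \<le> exp (2 * R) * (cmod (b - c))\<^sup>2"
      using le by (auto intro!: order_trans[OF cmod_exp_second_le] mult_right_mono)
    show "cmod (a + b - 2 * c) \<le> exp (2 * R) * cmod (a + b - 2 * c)"
      using R0 mult_right_mono[of 1 "exp (2 * R)" "cmod (a + b - 2 * c)"] by simp
  qed auto
  also have "\<dots> = (exp R * exp (2 * R)) * (cmod (a + b - 2 * c) + (cmod (a - c))\<^sup>2 + (cmod (b - c))\<^sup>2)"
    by (simp add: algebra_simps)
  also have "exp R * exp (2 * R) = exp (3 * R)"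
    by (simp flip: exp_add)
  finally show ?thesis .
qed

lemma norm_linf_exp_le: "norm (linf_exp v) \<le> exp (norm v)"
  by (rule norm_linf_leI)
    (use rep_linf_exp[of v] AE_rep_linf_le[of v] in \<open>eventually_elim, simp add: cmod_exp_le del: norm_exp_eq_Re\<close>)

lemma norm_linf_exp_diff_le:
  assumes "norm a \<le> R" "norm c \<le> R"
  shows "norm (linf_exp a - linf_exp c) \<le> exp (3 * R) * norm (a - c)"
proof (rule norm_linf_leI)
  show "AE x in lborel. cmod (rep_linf (linf_exp a - linf_exp c) x) \<le> exp (3 * R) * norm (a - c)"
    using rep_linf_exp[of a] rep_linf_exp[of c] AE_rep_linf_le[of a] AE_rep_linf_le[of c]
      AE_rep_linf_le[of "a - c"] rep_linf_diff[of a c] rep_linf_diff[of "linf_exp a" "linf_exp c"]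
  proof eventually_elim
    case (elim x)
    have "cmod (exp (rep_linf a x) - exp (rep_linf c x)) \<le> exp (3 * R) * cmod (rep_linf a x - rep_linf c x)"
      using elim assms by (intro cmod_exp_diff_le) auto
    also have "\<dots> \<le> exp (3 * R) * norm (a - c)"
      using elim by (intro mult_left_mono) auto
    finally show ?case using elim by simp
  qed
qed

lemma norm_linf_exp_second_difference_le:
  assumes "norm a \<le> R" "norm b \<le> R" "norm c \<le> R"
  shows "norm (linf_exp a + linf_exp b - 2 *\<^sub>R linf_exp c)
    \<le> exp (3 * R) * (norm (a + b - 2 *\<^sub>R c) + (norm (a - c))\<^sup>2 + (norm (b - c))\<^sup>2)"
proof (rule norm_linf_leI)
  let ?A = "rep_linf a" and ?B = "rep_linf b" and ?C = "rep_linf c"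
  have 1: "AE x in lborel. rep_linf (linf_exp a + linf_exp b - 2 *\<^sub>R linf_exp c) x
      = exp (?A x) + exp (?B x) - 2 * exp (?C x)"
    using rep_linf_exp[of a] rep_linf_exp[of b] rep_linf_exp[of c]
      rep_linf_diff[of "linf_exp a + linf_exp b" "2 *\<^sub>R linf_exp c"]
      rep_linf_add[of "linf_exp a" "linf_exp b"] rep_linf_scaleR[of 2 "linf_exp c"]
    by eventually_elim simp
  have 2: "AE x in lborel. rep_linf (a + b - 2 *\<^sub>R c) x = ?A x + ?B x - 2 * ?C x"
    using rep_linf_diff[of "a + b" "2 *\<^sub>R c"] rep_linf_add[of a b] rep_linf_scaleR[of 2 c]
    by eventually_elim simp
  have 3: "AE x in lborel. cmod (?A x) \<le> R \<and> cmod (?B x) \<le> R \<and> cmod (?C x) \<le> R"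
    using AE_rep_linf_le[of a] AE_rep_linf_le[of b] AE_rep_linf_le[of c]
    by eventually_elim (use assms in auto)
  show "AE x in lborel. cmod (rep_linf (linf_exp a + linf_exp b - 2 *\<^sub>R linf_exp c) x)
    \<le> exp (3 * R) * (norm (a + b - 2 *\<^sub>R c) + (norm (a - c))\<^sup>2 + (norm (b - c))\<^sup>2)"
    using 1 2 3 AE_rep_linf_le[of "a + b - 2 *\<^sub>R c"] AE_rep_linf_le[of "a - c"] AE_rep_linf_le[of "b - c"]
      rep_linf_diff[of a c] rep_linf_diff[of b c]
  proof eventually_elim
    case (elim x)
    have "cmod (exp (?A x) + exp (?B x) - 2 * exp (?C x))
      \<le> exp (3 * R) * (cmod (?A x + ?B x - 2 * ?C x) + (cmod (?A x - ?C x))\<^sup>2 + (cmod (?B x - ?C x))\<^sup>2)"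
      using elim by (intro cmod_exp_second_difference_le) auto
    also have "\<dots> \<le> exp (3 * R) * (norm (a + b - 2 *\<^sub>R c) + (norm (a - c))\<^sup>2 + (norm (b - c))\<^sup>2)"
      using elim by (intro mult_left_mono add_mono power_mono) auto
    finally show ?case using elim by simp
  qed
qed

text \<open>The quadratic Taylor remainder of the exponential, taken at almost every value of
  \<open>w\<close>; it gives the expansion of a multiplication step in
  \<open>local_error\<close>.\<close>

lemma norm_mult_op_exp_le:
  "norm (mult_op (linf_exp w) u - u - mult_op w u) \<le> exp (norm w) * (norm w)\<^sup>2 * norm u"
proof (rule norm_l2_leI)
  let ?K = "exp (norm w) * (norm w)\<^sup>2"
  let ?d = "mult_op (linf_exp w) u - u - mult_op w u"
  have "(\<integral>\<^sup>+x. ennreal ((cmod (rep_l2 ?d x))\<^sup>2) \<partial>lborel)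
    \<le> (\<integral>\<^sup>+x. ennreal (?K\<^sup>2) * ennreal ((cmod (rep_l2 u x))\<^sup>2) \<partial>lborel)"
  proof (rule nn_integral_mono_AE)
    show "AE x in lborel. ennreal ((cmod (rep_l2 ?d x))\<^sup>2) \<le> ennreal (?K\<^sup>2) * ennreal ((cmod (rep_l2 u x))\<^sup>2)"
      using rep_mult_op[of "linf_exp w" u] rep_mult_op[of w u] rep_linf_exp[of w] AE_rep_linf_le[of w]
        rep_l2_diff[of "mult_op (linf_exp w) u - u" "mult_op w u"] rep_l2_diff[of "mult_op (linf_exp w) u" u]
    proof eventually_elim
      case (elim x)
      let ?w = "rep_linf w x"
      have "rep_l2 ?d x = (exp ?w - 1 - ?w) * rep_l2 u x"
        using elim by (simp add: algebra_simps)
      moreover have "cmod (exp ?w - 1 - ?w) \<le> ?K"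
        using elim by (intro order_trans[OF cmod_exp_second_le] mult_mono power_mono) auto
      ultimately have "cmod (rep_l2 ?d x) \<le> ?K * cmod (rep_l2 u x)"
        by (simp add: norm_mult mult_right_mono)
      then have "(cmod (rep_l2 ?d x))\<^sup>2 \<le> (?K * cmod (rep_l2 u x))\<^sup>2"
        by (rule power_mono) simp
      then show ?case
        by (simp add: power_mult_distrib flip: ennreal_mult)
    qed
  qed
  also have "\<dots> = ennreal ((?K * norm u)\<^sup>2)"
    by (subst nn_integral_cmult)
      (simp_all add: norm_l2_eq_nn_integral[symmetric] power_mult_distrib ennreal_mult)
  finally show "(\<integral>\<^sup>+x. ennreal ((cmod (rep_l2 ?d x))\<^sup>2) \<partial>lborel) \<le> ennreal ((?K * norm u)\<^sup>2)" .
qed simp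

text \<open>Differences of the multiplier are O(h), so \<open>l2_regular_mult_op\<close> gives the
  factor \<open>exp (h * K) + 3 * (h * Q)\<close>. By \<open>1 + y \<le> exp y\<close> it is
  absorbed into a single exponential whose exponent is linear in \<open>h\<close>, with a rate
  depending only on \<open>K\<close> and \<open>h0\<close>, so the factors of successive steps
  multiply without blowing up.\<close>

lemma l2_regular_mult_op_exp:
  assumes u: "l2_regular N u" and v: "linf_regular K v" and h: "0 \<le> h" "h \<le> h0"
  shows "l2_regular (exp (h * (K + 3 * (exp (3 * (h0 * K)) * K * (1 + 2 * (h0 * K))))) * N)
    (mult_op (linf_exp (h *\<^sub>R v)) u)"
proof -
  define E where "E = exp (3 * (h0 * K))"
  \<comment> \<open>\<open>h * Q\<close> bounds both difference quotients of the multiplier. The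
    summand \<open>2 * (h0 * K)\<close> comes from the two squared first differences of the
    exponent: each carries \<open>h\<^sup>2\<close>, and one power of \<open>h\<close> is traded for
    \<open>h0\<close>.\<close>
  define Q where "Q = E * K * (1 + 2 * (h0 * K))"
  have K: "0 \<le> K" by (rule linf_regular_nonneg[OF v])
  have N: "0 \<le> N" by (rule l2_regular_nonneg[OF u])
  have h0: "0 \<le> h0" using h by simp
  have E: "0 \<le> E" by (simp add: E_def)
  have Q: "0 \<le> Q" using K h0 E by (simp add: Q_def)
  have v0: "norm v \<le> K" and v1: "\<And>z. norm (linf_shift z v - v) \<le> K * norm z"
    and v2: "\<And>z. norm (linf_shift z v + linf_shift (- z) v - 2 *\<^sub>R v) \<le> K * (norm z)\<^sup>2"
    using v by (auto simp: linf_regular_def)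
  have hv: "norm (h *\<^sub>R v) \<le> h * K" using h v0 by (simp add: mult_left_mono)
  have hK: "h * K \<le> h0 * K" using h K by (intro mult_right_mono)
  have R: "norm (linf_shift z (h *\<^sub>R v)) \<le> h0 * K" "norm (h *\<^sub>R v) \<le> h0 * K" for z
    using norm_linf_shift_le[of z "h *\<^sub>R v"] hv hK by linarith+
  have d1: "norm (linf_shift z (h *\<^sub>R v) - h *\<^sub>R v) \<le> h * (K * norm z)" for z
  proof -
    have "linf_shift z (h *\<^sub>R v) - h *\<^sub>R v = h *\<^sub>R (linf_shift z v - v)"
      by (simp add: linf_shift_scaleR scaleR_diff_right)
    then show ?thesis using h v1[of z] by (simp add: mult_left_mono)
  qed
  have d2: "norm (linf_shift z (h *\<^sub>R v) + linf_shift (- z) (h *\<^sub>R v) - 2 *\<^sub>R (h *\<^sub>R v)) \<le> h * (K * (norm z)\<^sup>2)" for z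
  proof -
    have "linf_shift z (h *\<^sub>R v) + linf_shift (- z) (h *\<^sub>R v) - 2 *\<^sub>R (h *\<^sub>R v)
      = h *\<^sub>R (linf_shift z v + linf_shift (- z) v - 2 *\<^sub>R v)"
      by (simp add: linf_shift_scaleR scaleR_diff_right scaleR_add_right)
    then show ?thesis using h v2[of z] by (simp add: mult_left_mono)
  qed
  let ?m = "linf_exp (h *\<^sub>R v)"
  have m0: "norm ?m \<le> exp (h * K)"
    using norm_linf_exp_le[of "h *\<^sub>R v"] hv by (meson exp_le_cancel_iff order_trans)
  have m1: "norm (linf_shift z ?m - ?m) \<le> h * Q * norm z" for z
  proof -
    have "norm (linf_shift z ?m - ?m) \<le> E * (h * (K * norm z))"
      unfolding linf_shift_exp E_def
      by (intro order_trans[OF norm_linf_exp_diff_le[OF R]] mult_left_mono d1) simp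
    also have "\<dots> = h * (E * K * 1) * norm z" by simp
    also have "\<dots> \<le> h * Q * norm z"
      unfolding Q_def using h h0 K E by (intro mult_right_mono mult_left_mono) auto
    finally show ?thesis .
  qed
  have m2: "norm (linf_shift z ?m + linf_shift (- z) ?m - 2 *\<^sub>R ?m) \<le> h * Q * (norm z)\<^sup>2" for z
  proof -
    have "norm (linf_shift z ?m + linf_shift (- z) ?m - 2 *\<^sub>R ?m)
      \<le> E * (h * (K * (norm z)\<^sup>2) + (h * (K * norm z))\<^sup>2 + (h * (K * norm (- z)))\<^sup>2)"
      unfolding linf_shift_exp E_def
      by (intro order_trans[OF norm_linf_exp_second_difference_le[OF R(1) R(1) R(2)]]
          mult_left_mono add_mono power_mono d1 d2) auto
    also have "\<dots> = h * (E * K * (1 + 2 * (h * K))) * (norm z)\<^sup>2"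
      by (simp add: power2_eq_square algebra_simps)
    also have "\<dots> \<le> h * Q * (norm z)\<^sup>2"
      unfolding Q_def using h hK K E by (intro mult_right_mono mult_left_mono) auto
    finally show ?thesis .
  qed
  have "l2_regular ((exp (h * K) + 3 * (h * Q)) * N) (mult_op ?m u)"
    using h Q by (intro l2_regular_mult_op[OF u m0 _ m1 m2]) simp
  moreover have "exp (h * K) + 3 * (h * Q) \<le> exp (h * (K + 3 * Q))"
  proof -
    have "exp (h * K) + 3 * (h * Q) \<le> exp (h * K) + exp (h * K) * (3 * (h * Q))"
      using h K Q mult_right_mono[of 1 "exp (h * K)" "3 * (h * Q)"] by simp
    also have "\<dots> = exp (h * K) * (1 + 3 * (h * Q))" by (simp add: algebra_simps)
    also have "\<dots> \<le> exp (h * K) * exp (3 * (h * Q))"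
      by (intro mult_left_mono exp_ge_add_one_self) simp
    also have "\<dots> = exp (h * (K + 3 * Q))"
      by (simp add: algebra_simps flip: exp_add)
    finally show ?thesis .
  qed
  ultimately show ?thesis
    unfolding E_def[symmetric] Q_def[symmetric] using N by (blast intro: l2_regular_mono mult_right_mono)
qed

subsection \<open>The heat semigroup\<close>

text \<open>Turns convolution with the heat kernel into an average of the translates
  \<open>u (x + z)\<close> over a probability measure; the sign of \<open>z\<close> is immaterial
  because the kernel is even.\<close>

definition heat_measure :: "real \<Rightarrow> 'a::euclidean_space measure" where
  "heat_measure t = density lborel (\<lambda>z. ennreal (heat_kernel t z))"

lemma sets_heat_measure [simp, measurable_cong]: "sets (heat_measure t) = sets borel"
  by (simp add: heat_measure_def)

lemma space_heat_measure [simp]: "space (heat_measure t) = UNIV"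
  by (simp add: heat_measure_def)

lemma prob_space_heat_measure:
  assumes "t > 0"
  shows "prob_space (heat_measure t :: 'a::euclidean_space measure)"
proof
  show "emeasure (heat_measure t :: 'a measure) (space (heat_measure t)) = 1"
    using nn_integral_heat_kernel[OF assms, of "0::'a"]
    by (simp add: heat_measure_def emeasure_density)
qed

lemma heat_kernel_minus: "heat_kernel t (- z) = heat_kernel t z"
  by (simp add: heat_kernel_def)

lemma integral_heat_measure:
  fixes f :: "'a::euclidean_space \<Rightarrow> complex"
  assumes [measurable]: "f \<in> borel_measurable borel"
  shows "(\<integral>z. f z \<partial>heat_measure t) = (\<integral>z. of_real (heat_kernel t z) * f z \<partial>lborel)"
  unfolding heat_measure_def
  by (subst integral_density) (auto simp: heat_kernel_nonneg scaleR_conv_of_real)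

lemma lborel_distr_uminus_euclidean: "distr lborel borel uminus = (lborel :: 'a::euclidean_space measure)"
  by (subst (2) lborel_affine[of "- 1" 0]) (simp_all add: density_1 one_ennreal_def[symmetric])

lemma integral_heat_measure_minus:
  fixes f :: "'a::euclidean_space \<Rightarrow> complex"
  assumes [measurable]: "f \<in> borel_measurable borel"
  shows "(\<integral>z. f (- z) \<partial>heat_measure t) = (\<integral>z. f z \<partial>heat_measure t)"
proof -
  have "(\<integral>z. of_real (heat_kernel t z) * f z \<partial>lborel)
    = (\<integral>z. of_real (heat_kernel t z) * f z \<partial>distr lborel borel uminus)"
    by (simp add: lborel_distr_uminus_euclidean)
  also have "\<dots> = (\<integral>z. of_real (heat_kernel t z) * f (- z) \<partial>lborel)"
    by (subst integral_distr) (simp_all add: heat_kernel_minus)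
  finally show ?thesis by (simp add: integral_heat_measure)
qed

text \<open>An arbitrary square integrable representative is allowed so that differences and
  translates can be inserted as concrete functions, as in \<open>heat_diff\<close> and
  \<open>heat_shift\<close>.\<close>

lemma rep_heat_abs:
  fixes f :: "'a::euclidean_space \<Rightarrow> complex"
  assumes t: "t > 0" and f: "square_int f"
  shows "AE x in lborel. rep_l2 (heat t (abs_l2 f)) x = (\<integral>z. f (x + z) \<partial>heat_measure t)"
proof -
  have [measurable]: "f \<in> borel_measurable borel" using f by (simp add: square_int_def)
  have conv: "(\<integral>y. of_real (heat_kernel t (x - y)) * f y \<partial>lborel)
      = (\<integral>z. f (x + z) \<partial>heat_measure t)" for x
    using integral_lborel_shift[of "\<lambda>y. of_real (heat_kernel t (x - y)) * f y" x]
    by (simp add: integral_heat_measure heat_kernel_minus add.commute)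
  have "heat t (abs_l2 f) = abs_l2 (\<lambda>x. \<integral>z. f (x + z) \<partial>heat_measure t)"
    using heat.abs_eq[of f t] f t by (simp add: l2_rel_def conv)
  moreover have "square_int (\<lambda>x. \<integral>z. f (x + z) \<partial>heat_measure t)"
    using square_int_heat_convolution[OF t f] by (simp add: conv)
  ultimately show ?thesis using rep_abs_l2 by simp
qed

lemma rep_heat:
  "t > 0 \<Longrightarrow> AE x in lborel. rep_l2 (heat t u) x = (\<integral>z. rep_l2 u (x + z) \<partial>heat_measure t)"
  using rep_heat_abs[OF _ square_int_rep_l2, of t u] by (simp add: abs_l2_rep)

lemma heat_0: "heat 0 u = u"
  using heat.abs_eq[of "rep_l2 u" 0] by (simp add: abs_l2_rep l2_rel_def square_int_rep_l2)

text \<open>The kernel is both integrable and bounded. Since a modulus is at most 1 plus its square,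
  the constant part is controlled by the mass of the kernel and the square by its maximum. This
  works for every \<open>x\<close>, not only almost every one.\<close>

lemma integrable_heat_measure:
  fixes f :: "'a::euclidean_space \<Rightarrow> complex"
  assumes t: "t > 0" and f: "square_int f"
  shows "integrable (heat_measure t) (\<lambda>z. f (x + z))"
proof -
  have [measurable]: "f \<in> borel_measurable borel" using f by (simp add: square_int_def)
  let ?k = "heat_kernel t :: 'a \<Rightarrow> real" and ?C = "(4 * pi * t) powr (- (real DIM('a) / 2))"
  have k: "?k z \<le> ?C" for z
  proof -
    have "exp (- (norm z)\<^sup>2 / (4 * t)) \<le> 1" using t by simp
    then show ?thesis unfolding heat_kernel_def using mult_left_mono[of _ 1 ?C] by fastforce
  qed
  have "integrable lborel ?k"
    using nn_integral_heat_kernel[OF t, of "0::'a"]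
    by (intro integrableI_nonneg) (auto simp: heat_kernel_nonneg)
  moreover have "integrable lborel (\<lambda>z. ?C * (cmod (f (z + x)))\<^sup>2)"
    using f by (intro integrable_mult_right integrable_lborel_shift[of "\<lambda>z. (cmod (f z))\<^sup>2"]) (simp add: square_int_def)
  ultimately have "integrable lborel (\<lambda>z. ?k z + ?C * (cmod (f (z + x)))\<^sup>2)"
    by (rule Bochner_Integration.integrable_add)
  then have "integrable lborel (\<lambda>z. ?k z *\<^sub>R f (x + z))"
  proof (rule Bochner_Integration.integrable_bound)
    have "norm (?k z *\<^sub>R f (x + z)) \<le> norm (?k z + ?C * (cmod (f (z + x)))\<^sup>2)" for z
    proof -
      have "cmod (f (z + x)) \<le> 1 + (cmod (f (z + x)))\<^sup>2"
        using sum_squares_bound[of 1 "cmod (f (z + x))"] norm_ge_zero[of "f (z + x)"]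
        unfolding power2_eq_square by linarith
      then have "?k z * cmod (f (z + x)) \<le> ?k z * (1 + (cmod (f (z + x)))\<^sup>2)"
        by (rule mult_left_mono) (rule heat_kernel_nonneg)
      also have "\<dots> \<le> ?k z + ?C * (cmod (f (z + x)))\<^sup>2"
        using k[of z] by (simp add: distrib_left mult_right_mono)
      finally show ?thesis
        using heat_kernel_nonneg[of t z] by (simp add: add.commute)
    qed
    then show "AE z in lborel. norm (?k z *\<^sub>R f (x + z)) \<le> norm (?k z + ?C * (cmod (f (z + x)))\<^sup>2)"
      by simp
  qed simp
  then show ?thesis
    unfolding heat_measure_def by (subst integrable_density) (auto simp: heat_kernel_nonneg)
qed

lemma heat_diff:
  assumes "0 \<le> t"
  shows "heat t (u - v) = heat t u - heat t v"
proof (cases "t = 0")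
  case False
  with assms have t: "t > 0" by simp
  have si: "square_int (\<lambda>x. rep_l2 u x - rep_l2 v x)"
    using square_int_add[OF square_int_rep_l2[of u] square_int_scale[OF square_int_rep_l2[of v], of "- 1"]]
    by simp
  have "u - v = abs_l2 (\<lambda>x. rep_l2 u x - rep_l2 v x)"
    by (rule l2_eqI) (use rep_l2_diff[of u v] rep_abs_l2[OF si] in \<open>eventually_elim, simp\<close>)
  then have *: "AE x in lborel. rep_l2 (heat t (u - v)) x = (\<integral>z. rep_l2 u (x + z) - rep_l2 v (x + z) \<partial>heat_measure t)"
    using rep_heat_abs[OF t si] by simp
  show ?thesis
    by (intro l2_eqI) (use * rep_heat[OF t, of u] rep_heat[OF t, of v] rep_l2_diff[of "heat t u" "heat t v"]
      in \<open>eventually_elim, simp add: integrable_heat_measure[OF t square_int_rep_l2]\<close>)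
qed (simp add: heat_0)

lemma heat_shift:
  assumes "0 \<le> t"
  shows "heat t (l2_shift z u) = l2_shift z (heat t u)"
proof (cases "t = 0")
  case False
  with assms have t: "t > 0" by simp
  have eq: "l2_shift z u = abs_l2 (\<lambda>x. rep_l2 u (x + z))"
    using l2_shift.abs_eq[of "rep_l2 u" z] by (simp add: abs_l2_rep l2_rel_def square_int_rep_l2)
  have *: "AE x in lborel. rep_l2 (heat t (l2_shift z u)) x = (\<integral>y. rep_l2 u ((x + y) + z) \<partial>heat_measure t)"
    unfolding eq by (rule rep_heat_abs[OF t square_int_shift[OF square_int_rep_l2]])
  have **: "AE x in lborel. rep_l2 (heat t u) (x + z) = (\<integral>y. rep_l2 u ((x + z) + y) \<partial>heat_measure t)"
    by (rule AE_lborel_shift[OF rep_heat[OF t]])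
  show ?thesis
    by (intro l2_eqI) (use * ** rep_l2_shift[of z "heat t u"] in \<open>eventually_elim, simp add: add_ac\<close>)
qed (simp add: heat_0)

text \<open>An average of translations, each an isometry, is a contraction.\<close>

lemma norm_heat_le:
  assumes "0 \<le> t"
  shows "norm (heat t u) \<le> norm u"
proof (cases "t = 0")
  case False
  with assms have t: "t > 0" by simp
  interpret prob_space "heat_measure t :: 'a measure" by (rule prob_space_heat_measure[OF t])
  have "(\<integral>\<^sup>+x. ennreal ((cmod (rep_l2 (heat t u) x))\<^sup>2) \<partial>lborel)
    = (\<integral>\<^sup>+x. ennreal ((cmod (\<integral>z. rep_l2 u (x + z) \<partial>heat_measure t))\<^sup>2) \<partial>lborel)"
    using rep_heat[OF t, of u] by (intro nn_integral_cong_AE) auto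
  also have "\<dots> \<le> (\<integral>\<^sup>+z. (\<integral>\<^sup>+x. ennreal ((cmod (rep_l2 u (x + z)))\<^sup>2) \<partial>lborel) \<partial>heat_measure t)"
    by (rule nn_integral_square_average[OF prob_space_heat_measure[OF t]]) measurable
  also have "\<dots> = ennreal ((norm u)\<^sup>2)"
    by (simp add: nn_integral_square_shift norm_l2_eq_nn_integral emeasure_space_1[simplified])
  finally show ?thesis by (rule norm_l2_leI) simp
qed (simp add: heat_0)

text \<open>The semigroup commutes with translations and is a contraction, so the constant is
  preserved exactly and heat steps add nothing to the growth of \<open>K\<close>.\<close>

lemma l2_regular_heat:
  assumes t: "0 \<le> t" and u: "l2_regular K u"
  shows "l2_regular K (heat t u)"
proof -
  have "norm (l2_shift z (heat t u) - heat t u) \<le> norm (l2_shift z u - u)" for z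
    using norm_heat_le[OF t, of "l2_shift z u - u"] by (simp add: heat_diff[OF t] heat_shift[OF t])
  moreover have "norm (l2_shift z (heat t u) + l2_shift (- z) (heat t u) - 2 *\<^sub>R heat t u)
    \<le> norm (l2_shift z u + l2_shift (- z) u - 2 *\<^sub>R u)" for z
  proof -
    \<comment> \<open>The second difference is regrouped as a difference of two first differences,
      so that \<open>heat_diff\<close> alone carries it through the semigroup.\<close>
    have *: "l2_shift z u + l2_shift (- z) u - 2 *\<^sub>R u = (l2_shift z u - u) - (u - l2_shift (- z) u)"
      by (simp add: scaleR_2)
    have "l2_shift z (heat t u) + l2_shift (- z) (heat t u) - 2 *\<^sub>R heat t u
      = heat t ((l2_shift z u - u) - (u - l2_shift (- z) u))"
      by (simp add: heat_diff[OF t] heat_shift[OF t] scaleR_2)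
    then show ?thesis unfolding * using norm_heat_le[OF t] by (simp only:)
  qed
  ultimately show ?thesis
    using u norm_heat_le[OF t, of u] unfolding l2_regular_def by (meson order_trans)
qed

text \<open>With \<open>y = (norm z)\<^sup>2 / (8 * t)\<close>, the fourth power of
  \<open>norm z\<close> contributes 64 and the bound \<open>y\<^sup>2 \<le> 2 * exp y\<close>
  contributes 2; the power of 2 is the ratio of the normalising factors of the kernel at times
  \<open>t\<close> and \<open>2 * t\<close>.\<close>

definition heat_moment :: "'a::euclidean_space itself \<Rightarrow> real" where
  "heat_moment _ = 128 * 2 powr (real DIM('a) / 2)"

text \<open>Comparing with the kernel at time \<open>2 * t\<close>, which has mass \<open>1\<close>, replaces the computation of
  Gaussian moments.\<close>

lemma heat_kernel_fourth_moment:
  fixes z :: "'a::euclidean_space"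
  assumes t: "t > 0"
  shows "heat_kernel t z * (norm z) ^ 4 \<le> heat_moment TYPE('a) * t\<^sup>2 * heat_kernel (2 * t) z"
proof -
  define y where "y = (norm z)\<^sup>2 / (8 * t)"
  have y: "0 \<le> y" using t by (simp add: y_def)
  have z4: "(norm z) ^ 4 = 64 * t\<^sup>2 * y\<^sup>2"
    using t by (simp add: y_def power2_eq_square power4_eq_xxxx)
  have "y\<^sup>2 / 2 \<le> exp y"
    using exp_lower_Taylor_quadratic[OF y] y by linarith
  then have "y\<^sup>2 * exp (- (2 * y)) \<le> 2 * exp y * exp (- (2 * y))"
    by (intro mult_right_mono) auto
  also have "\<dots> = 2 * exp (- y)" by (simp flip: exp_add)
  finally have *: "64 * t\<^sup>2 * (y\<^sup>2 * exp (- (2 * y))) \<le> 64 * t\<^sup>2 * (2 * exp (- y))"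
    by (intro mult_left_mono) auto
  have e: "- (norm z)\<^sup>2 / (4 * t) = - (2 * y)" "- (norm z)\<^sup>2 / (4 * (2 * t)) = - y"
    using t by (simp_all add: y_def)
  let ?d = "real DIM('a) / 2"
  have "(4 * pi * (2 * t)) powr (- ?d) = 2 powr (- ?d) * (4 * pi * t) powr (- ?d)"
    using t powr_mult[of 2 "4 * pi * t" "- ?d"] by (simp add: mult_ac)
  then have p: "2 powr ?d * (4 * pi * (2 * t)) powr (- ?d) = (4 * pi * t) powr (- ?d)"
    by (simp add: powr_minus)
  have "heat_kernel t z * (norm z) ^ 4 = (4 * pi * t) powr (- ?d) * (64 * t\<^sup>2 * (y\<^sup>2 * exp (- (2 * y))))"
    unfolding heat_kernel_def e z4 by (simp add: mult_ac)
  also have "\<dots> \<le> (4 * pi * t) powr (- ?d) * (64 * t\<^sup>2 * (2 * exp (- y)))"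
    by (intro mult_left_mono *) simp
  also have "\<dots> = heat_moment TYPE('a) * t\<^sup>2 * heat_kernel (2 * t) z"
    unfolding heat_kernel_def e heat_moment_def p[symmetric] by (simp add: mult_ac)
  finally show ?thesis .
qed

text \<open>Second differences have norm at most \<open>K * (norm z)\<^sup>2\<close>. The average is
  estimated through squares, which calls for the fourth moment of the kernel; this is of order
  \<open>t\<^sup>2\<close>, and its square root gives the linear rate in \<open>t\<close> together
  with \<open>sqrt (heat_moment TYPE('a))\<close>.\<close>

lemma heat_minus_id_le:
  fixes u :: "'a::euclidean_space l2"
  assumes t: "0 \<le> t" and u: "l2_regular K u"
  shows "norm (heat t u - u) \<le> sqrt (heat_moment TYPE('a)) * t * K"
proof (cases "t = 0")
  case False
  with t have t: "t > 0" by simp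
  interpret prob_space "heat_measure t :: 'a measure" by (rule prob_space_heat_measure[OF t])
  have K: "0 \<le> K" by (rule l2_regular_nonneg[OF u])
  have hm: "0 \<le> heat_moment TYPE('a)" by (simp add: heat_moment_def)
  let ?u = "rep_l2 u"
  let ?D = "\<lambda>z x. (?u (x + z) + ?u (x - z) - 2 * ?u x) / 2"
  have int: "integrable (heat_measure t) (\<lambda>z. ?u (x + z))" "integrable (heat_measure t) (\<lambda>z. ?u (x - z))" for x
  proof -
    show int: "integrable (heat_measure t) (\<lambda>z. ?u (x + z))"
      by (rule integrable_heat_measure[OF t square_int_rep_l2])
    have "integrable (distr lborel borel uminus) (\<lambda>z. of_real (heat_kernel t z) * ?u (x + z))"
      using int unfolding lborel_distr_uminus_euclidean heat_measure_def
      by (subst (asm) integrable_density) (auto simp: heat_kernel_nonneg scaleR_conv_of_real)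
    then show "integrable (heat_measure t) (\<lambda>z. ?u (x - z))"
      unfolding heat_measure_def
      by (subst (asm) integrable_distr_eq, simp, simp, subst integrable_density)
        (auto simp: heat_kernel_nonneg scaleR_conv_of_real heat_kernel_minus)
  qed
  have *: "AE x in lborel. rep_l2 (heat t u - u) x = (\<integral>z. ?D z x \<partial>heat_measure t)"
    using rep_heat[OF t, of u] rep_l2_diff[of "heat t u" u]
  proof eventually_elim
    case (elim x)
    have "(\<integral>z. ?u (x - z) \<partial>heat_measure t) = (\<integral>z. ?u (x + z) \<partial>heat_measure t)"
      using integral_heat_measure_minus[of "\<lambda>z. ?u (x + z)" t] by simp
    then show ?case using elim int[of x] prob_space by simp
  qed
  have "(\<integral>\<^sup>+x. ennreal ((cmod (rep_l2 (heat t u - u) x))\<^sup>2) \<partial>lborel)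
    = (\<integral>\<^sup>+x. ennreal ((cmod (\<integral>z. ?D z x \<partial>heat_measure t))\<^sup>2) \<partial>lborel)"
    by (rule nn_integral_cong_AE) (use * in \<open>eventually_elim, simp only:\<close>)
  also have "\<dots> \<le> (\<integral>\<^sup>+z. (\<integral>\<^sup>+x. ennreal ((cmod (?D z x))\<^sup>2) \<partial>lborel) \<partial>heat_measure t)"
    by (rule nn_integral_square_average[OF prob_space_heat_measure[OF t]]) measurable
  also have "\<dots> \<le> (\<integral>\<^sup>+z. ennreal (K\<^sup>2 * (norm (z::'a)) ^ 4) \<partial>heat_measure t)"
  proof (rule nn_integral_mono)
    fix z :: 'a
    let ?d = "l2_shift z u + l2_shift (- z) u - 2 *\<^sub>R u"
    have "AE x in lborel. rep_l2 ?d x = 2 * ?D z x"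
      using rep_l2_diff[of "l2_shift z u + l2_shift (- z) u" "2 *\<^sub>R u"] rep_l2_scaleR[of 2 u]
        rep_l2_add[of "l2_shift z u" "l2_shift (- z) u"] rep_l2_shift[of z u] rep_l2_shift[of "- z" u]
      by eventually_elim simp
    then have "(\<integral>\<^sup>+x. ennreal ((cmod (?D z x))\<^sup>2) \<partial>lborel) \<le> (\<integral>\<^sup>+x. ennreal ((cmod (rep_l2 ?d x))\<^sup>2) \<partial>lborel)"
    proof (intro nn_integral_mono_AE, eventually_elim)
      case (elim x)
      \<comment> \<open>The factor 1/2 of the symmetrised average is discarded here.\<close>
      have "cmod (?D z x) \<le> cmod (2 * ?D z x)"
        unfolding norm_mult by simp
      then have "cmod (?D z x) \<le> cmod (rep_l2 ?d x)"
        by (simp only: elim)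
      then show ?case by (intro ennreal_leI power_mono) auto
    qed
    also have "\<dots> = ennreal ((norm ?d)\<^sup>2)"
      by (simp add: norm_l2_eq_nn_integral)
    also have "\<dots> \<le> ennreal ((K * (norm z)\<^sup>2)\<^sup>2)"
      using u by (intro ennreal_leI power_mono) (auto simp: l2_regular_def)
    finally show "(\<integral>\<^sup>+x. ennreal ((cmod (?D z x))\<^sup>2) \<partial>lborel) \<le> ennreal (K\<^sup>2 * (norm z) ^ 4)"
      by (simp add: power_mult_distrib flip: power_mult)
  qed
  also have "\<dots> = (\<integral>\<^sup>+z. ennreal (heat_kernel t z) * ennreal (K\<^sup>2 * (norm z) ^ 4) \<partial>(lborel::'a measure))"
    unfolding heat_measure_def by (subst nn_integral_density) auto
  also have "\<dots> \<le> (\<integral>\<^sup>+z. ennreal (K\<^sup>2 * (heat_moment TYPE('a) * t\<^sup>2)) * ennreal (heat_kernel (2 * t) (z - 0)) \<partial>(lborel::'a measure))"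
  proof (rule nn_integral_mono)
    fix z :: 'a
    have "K\<^sup>2 * (heat_kernel t z * (norm z) ^ 4) \<le> K\<^sup>2 * (heat_moment TYPE('a) * t\<^sup>2 * heat_kernel (2 * t) z)"
      by (intro mult_left_mono heat_kernel_fourth_moment t) simp
    then show "ennreal (heat_kernel t z) * ennreal (K\<^sup>2 * (norm z) ^ 4)
        \<le> ennreal (K\<^sup>2 * (heat_moment TYPE('a) * t\<^sup>2)) * ennreal (heat_kernel (2 * t) (z - 0))"
      using hm by (subst (1 2) ennreal_mult[symmetric]) (auto simp: heat_kernel_nonneg mult_ac intro!: ennreal_leI)
  qed
  also have "\<dots> = ennreal (K\<^sup>2 * (heat_moment TYPE('a) * t\<^sup>2)) * (\<integral>\<^sup>+z. ennreal (heat_kernel (2 * t) (z - 0)) \<partial>(lborel::'a measure))"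
    by (rule nn_integral_cmult) measurable
  also have "\<dots> = ennreal (K\<^sup>2 * (heat_moment TYPE('a) * t\<^sup>2))"
    using nn_integral_heat_kernel[of "2 * t" "0::'a"] t by simp
  also have "K\<^sup>2 * (heat_moment TYPE('a) * t\<^sup>2) = (sqrt (heat_moment TYPE('a)) * t * K)\<^sup>2"
    using hm by (simp add: power_mult_distrib)
  finally show ?thesis
    using K t hm by (intro norm_l2_leI) simp_all
qed (use l2_regular_nonneg[OF u] in \<open>simp add: heat_0\<close>)

subsection \<open>The evolution family\<close>

lemma BUC1_bounded_lipschitz:
  fixes V :: "real \<Rightarrow> 'b::real_normed_vector"
  assumes "V \<in> BUC1"
  shows "\<exists>B L. 0 \<le> B \<and> 0 \<le> L \<and> (\<forall>t. norm (V t) \<le> B) \<and> (\<forall>s t. norm (V t - V s) \<le> L * \<bar>t - s\<bar>)"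
proof -
  obtain V' where V': "\<And>t. (V has_vector_derivative V' t) (at t)" and V'_BUC: "V' \<in> BUC UNIV norm"
    and V_BUC: "V \<in> BUC UNIV norm"
    using assms by (auto simp: BUC1_def)
  obtain B where B: "\<And>t. norm (V t) \<le> B"
    using V_BUC by (auto simp: BUC_def)
  obtain L where L: "\<And>t. norm (V' t) \<le> L"
    using V'_BUC by (auto simp: BUC_def)
  have "norm (V t - V s) \<le> L * norm (t - s)" for s t
  proof (rule differentiable_bound[where S=UNIV and f'="\<lambda>t h. h *\<^sub>R V' t"])
    show "(V has_derivative (\<lambda>h. h *\<^sub>R V' t)) (at t within UNIV)" for t
      using V' by (simp add: has_vector_derivative_def)
    show "onorm (\<lambda>h. h *\<^sub>R V' t) \<le> L" for t
      using L[of t] by (intro onorm_bound) (auto simp: mult.commute[of L] mult_left_mono intro: order_trans[OF norm_ge_zero])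
  qed auto
  moreover have "0 \<le> B" "0 \<le> L"
    using order_trans[OF norm_ge_zero B] order_trans[OF norm_ge_zero L] by blast+
  ultimately show ?thesis using B by auto
qed

context
  fixes V :: "real \<Rightarrow> 'a::euclidean_space linf" and W :: "real \<Rightarrow> real \<Rightarrow> 'a l2 \<Rightarrow> 'a l2" and B :: real
  assumes W: "evolution_family W" and VW: "solves_perturbed_heat V W" and V_le: "\<And>t. norm (V t) \<le> B"
begin

lemma potential_bound_nonneg: "0 \<le> B"
  by (rule order_trans[OF norm_ge_zero V_le[of 0]])

lemma norm_mult_V_le: "norm (mult_op (V r) u) \<le> B * norm u"
  by (rule order_trans[OF norm_mult_op mult_right_mono[OF V_le norm_ge_zero]])

text \<open>The orbit bound is a parameter: it is the maximum of the orbit itself while boundedness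
  of \<open>W\<close> is being established, and the resulting uniform bound in
  \<open>local_error\<close>.\<close>

lemma evolution_minus_heat_le:
  assumes "s \<le> t" and M: "\<And>r. r \<in> {s..t} \<Longrightarrow> norm (W r s u) \<le> M"
  shows "norm (W t s u - heat (t - s) u) \<le> B * M * (t - s)"
proof -
  have M0: "0 \<le> M" using \<open>s \<le> t\<close> by (intro order_trans[OF norm_ge_zero M[of s]]) simp
  have "norm (W t s u - heat (t - s) u) \<le> (B * M) * measure lborel (cbox s t)"
  proof (rule has_integral_bound)
    show "((\<lambda>r. heat (t - r) (mult_op (V r) (W r s u))) has_integral (W t s u - heat (t - s) u)) (cbox s t)"
      using VW \<open>s \<le> t\<close> by (simp add: solves_perturbed_heat_def)
    fix r assume "r \<in> cbox s t"
    then have r: "r \<in> {s..t}" by simp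
    then have "norm (heat (t - r) (mult_op (V r) (W r s u))) \<le> B * norm (W r s u)"
      by (intro order_trans[OF norm_heat_le norm_mult_V_le]) simp
    also have "\<dots> \<le> B * M"
      using r by (intro mult_left_mono M potential_bound_nonneg)
    finally show "norm (heat (t - r) (mult_op (V r) (W r s u))) \<le> B * M" .
  qed (use M0 potential_bound_nonneg in simp)
  then show ?thesis using \<open>s \<le> t\<close> by simp
qed

lemma evolution_continuous_on: "continuous_on {s..t} (\<lambda>r. W r s u)"
proof -
  have "continuous_on {(t, s). s \<le> t} (\<lambda>(t, s). W t s u)"
    using W by (simp add: evolution_family_def)
  then have "continuous_on {s..t} ((\<lambda>(t, s). W t s u) \<circ> (\<lambda>r. (r, s)))"
    by (intro continuous_on_compose) (auto intro!: continuous_intros elim: continuous_on_subset)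
  then show ?thesis by (simp add: o_def)
qed

text \<open>On a short interval the supremum of the orbit is absorbed into the left-hand side of
  the Duhamel estimate; this avoids Gronwall's inequality for the gauge integral.\<close>

lemma evolution_bound_short:
  assumes "s \<le> t" "(t - s) * B \<le> 1 / 2"
  shows "norm (W t s u) \<le> 2 * norm u"
proof -
  obtain q where q: "q \<in> {s..t}" and sup: "\<And>r. r \<in> {s..t} \<Longrightarrow> norm (W r s u) \<le> norm (W q s u)"
    using continuous_attains_sup[of "{s..t}" "\<lambda>r. norm (W r s u)",
        OF _ _ continuous_on_norm[OF evolution_continuous_on]] assms(1) by auto
  have "norm (W q s u - heat (q - s) u) \<le> B * norm (W q s u) * (q - s)"
    using q by (intro evolution_minus_heat_le sup) auto
  also have "\<dots> = ((q - s) * B) * norm (W q s u)" by simp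
  also have "\<dots> \<le> 1 / 2 * norm (W q s u)"
  proof (rule mult_right_mono)
    have "(q - s) * B \<le> (t - s) * B"
      using q by (intro mult_right_mono potential_bound_nonneg) auto
    then show "(q - s) * B \<le> 1 / 2" using assms(2) by simp
  qed simp
  finally have "norm (W q s u - heat (q - s) u) \<le> 1 / 2 * norm (W q s u)" .
  moreover have "norm (W q s u) \<le> norm (W q s u - heat (q - s) u) + norm (heat (q - s) u)"
    using norm_triangle_ineq[of "W q s u - heat (q - s) u" "heat (q - s) u"] by simp
  moreover have "norm (heat (q - s) u) \<le> norm u"
    using q by (intro norm_heat_le) auto
  ultimately have "norm (W q s u) \<le> 2 * norm u" by simp
  then show ?thesis using sup[of t] assms(1) by auto
qed

text \<open>The interval is cut into pieces of a length on which
  \<open>evolution_bound_short\<close> applies, each costing a factor 2. Their number depends only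
  on \<open>T\<close> and \<open>B\<close>, so the bound is uniform in \<open>s\<close> and
  \<open>u\<close>.\<close>

lemma evolution_bound:
  shows "\<exists>M\<ge>1. \<forall>s t u. s \<le> t \<longrightarrow> t - s \<le> T \<longrightarrow> norm (W t s u) \<le> M * norm u"
proof -
  \<comment> \<open>\<open>B + 1\<close> instead of \<open>B\<close> keeps the step length
    meaningful when the potential bound is 0.\<close>
  define \<delta> where "\<delta> = 1 / (2 * (B + 1))"
  have \<delta>: "0 < \<delta>" "\<delta> * B \<le> 1 / 2"
    using potential_bound_nonneg by (auto simp: \<delta>_def field_simps)
  have ind: "norm (W t s u) \<le> 2 ^ k * norm u" if "s \<le> t" "t - s \<le> real k * \<delta>" for s t u and k :: nat
    using that
  proof (induction k arbitrary: t)
    case 0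
    then have "t = s" by simp
    then show ?case using W by (simp add: evolution_family_def)
  next
    case (Suc k)
    show ?case
    proof (cases "t - s \<le> \<delta>")
      case True
      then have "(t - s) * B \<le> \<delta> * B"
        by (intro mult_right_mono potential_bound_nonneg)
      then have "norm (W t s u) \<le> 2 * norm u"
        using \<delta> Suc.prems by (intro evolution_bound_short) auto
      also have "\<dots> \<le> 2 ^ Suc k * norm u"
        by (intro mult_right_mono) auto
      finally show ?thesis .
    next
      case False
      let ?r = "t - \<delta>"
      have "W t s = W t ?r \<circ> W ?r s"
        using W False \<delta> by (simp add: evolution_family_def)
      then have "norm (W t s u) = norm (W t ?r (W ?r s u))" by simp
      also have "\<dots> \<le> 2 * norm (W ?r s u)"
        using \<delta> by (intro evolution_bound_short) auto
      also have "\<dots> \<le> 2 * (2 ^ k * norm u)"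
        using False Suc.prems by (intro mult_left_mono Suc.IH) (auto simp: algebra_simps)
      finally show ?thesis by simp
    qed
  qed
  obtain k :: nat where "T / \<delta> \<le> real k"
    using real_arch_simple by blast
  then have "T \<le> real k * \<delta>" using \<delta> by (simp add: field_simps)
  then show ?thesis using ind by (intro exI[of _ "2 ^ k"]) auto
qed

text \<open>Regularity is asked of the starting point \<open>x\<close> only, not of its orbit under
  \<open>W\<close>. The constant lists the replacements made: \<open>B * (B * M + c)\<close> for the
  orbit by \<open>x\<close> inside Duhamel's integral, \<open>L\<close> for \<open>V r\<close> by
  \<open>V s\<close>, \<open>4 * c * K\<close> for dropping the semigroup in front of
  \<open>V s\<close> times \<open>x\<close>, \<open>exp (h0 * B) * B\<^sup>2\<close> for the Taylor
  remainder of the multiplier, and \<open>B * c\<close> for \<open>heat h x\<close> by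
  \<open>x\<close> in its linear term.\<close>

lemma local_error:
  fixes K L M N h h0 :: real
  assumes x: "l2_regular N x" and v: "linf_regular K (V s)" and h: "0 \<le> h" "h \<le> h0"
    and L: "0 \<le> L" "\<And>r. norm (V r - V s) \<le> L * \<bar>r - s\<bar>"
    and M: "1 \<le> M" "\<And>r. r \<in> {s..s + h} \<Longrightarrow> norm (W r s x) \<le> M * norm x"
  defines "c \<equiv> sqrt (heat_moment TYPE('a))"
  shows "norm (W (s + h) s x - mult_op (linf_exp (h *\<^sub>R V s)) (heat h x))
    \<le> (B * (B * M + c) + L + 4 * c * K + exp (h0 * B) * B\<^sup>2 + B * c) * h\<^sup>2 * N"
proof -
  let ?v = "V s"
  have B: "0 \<le> B" by (rule potential_bound_nonneg)
  have N: "0 \<le> N" by (rule l2_regular_nonneg[OF x])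
  have K: "0 \<le> K" by (rule linf_regular_nonneg[OF v])
  have c: "0 \<le> c" by (simp add: c_def heat_moment_def)
  have xN: "norm x \<le> N" using x by (simp add: l2_regular_def)
  have W_le: "norm (W r s x) \<le> M * N" if "r \<in> {s..s + h}" for r
    using M(2)[OF that] mult_left_mono[OF xN, of M] M(1) by linarith
  define G where "G = B * (B * M + c) + L + 4 * c * K"
  have G: "0 \<le> G" unfolding G_def using B c K L(1) M(1) by (intro add_nonneg_nonneg mult_nonneg_nonneg) auto
  have "norm ((W (s + h) s x - heat (s + h - s) x) - h *\<^sub>R mult_op ?v x) \<le> (G * N * h) * measure lborel (cbox s (s + h))"
  proof (rule has_integral_bound)
    have "((\<lambda>r. mult_op ?v x) has_integral h *\<^sub>R mult_op ?v x) {s..s + h}"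
      using has_integral_const_real[of "mult_op ?v x" s "s + h"] h by simp
    moreover have "((\<lambda>r. heat (s + h - r) (mult_op (V r) (W r s x))) has_integral (W (s + h) s x - heat (s + h - s) x)) {s..s + h}"
      by (rule VW[unfolded solves_perturbed_heat_def, rule_format]) (use h in simp)
    ultimately show "((\<lambda>r. heat (s + h - r) (mult_op (V r) (W r s x)) - mult_op ?v x) has_integral
      ((W (s + h) s x - heat (s + h - s) x) - h *\<^sub>R mult_op ?v x)) (cbox s (s + h))"
      by (simp add: has_integral_diff)
    show "0 \<le> G * N * h" using G N h by simp
    fix r assume "r \<in> cbox s (s + h)"
    then have r: "s \<le> r" "r \<le> s + h" by auto
    let ?\<tau> = "s + h - r"
    have \<tau>: "0 \<le> ?\<tau>" "?\<tau> \<le> h" using r by auto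
    \<comment> \<open>Each of the three differences is O(h), so integrating over an interval of
      length \<open>h\<close> gives O(h^2).\<close>
    have "heat ?\<tau> (mult_op (V r) (W r s x)) - mult_op ?v x
      = (heat ?\<tau> (mult_op (V r) (W r s x)) - heat ?\<tau> (mult_op (V r) x))
        + (heat ?\<tau> (mult_op (V r) x) - heat ?\<tau> (mult_op ?v x))
        + (heat ?\<tau> (mult_op ?v x) - mult_op ?v x)"
      by simp
    also have "\<dots> = heat ?\<tau> (mult_op (V r) (W r s x - x)) + heat ?\<tau> (mult_op (V r - ?v) x)
        + (heat ?\<tau> (mult_op ?v x) - mult_op ?v x)"
      by (simp add: heat_diff[OF \<tau>(1)] mult_op_diff_right mult_op_diff_left)
    also have "norm \<dots> \<le> B * ((B * M + c) * N * h) + L * h * N + c * h * (4 * K * N)"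
    proof (intro norm_triangle_mono)
      have "norm (W r s x - x) \<le> norm (W r s x - heat (r - s) x) + norm (heat (r - s) x - x)"
        using norm_triangle_ineq[of "W r s x - heat (r - s) x" "heat (r - s) x - x"] by simp
      also have "\<dots> \<le> B * (M * N) * (r - s) + c * (r - s) * N"
        unfolding c_def using r by (intro add_mono evolution_minus_heat_le heat_minus_id_le x W_le) auto
      also have "\<dots> = (B * M + c) * N * (r - s)" by (simp add: algebra_simps)
      also have "\<dots> \<le> (B * M + c) * N * h"
        using r B c M(1) N by (intro mult_left_mono) auto
      finally have "norm (W r s x - x) \<le> (B * M + c) * N * h" .
      then show "norm (heat ?\<tau> (mult_op (V r) (W r s x - x))) \<le> B * ((B * M + c) * N * h)"
        by (intro order_trans[OF norm_heat_le[OF \<tau>(1)]] order_trans[OF norm_mult_V_le] mult_left_mono B)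
      have "norm (V r - ?v) \<le> L * h"
        using L(2)[of r] mult_left_mono[of "\<bar>r - s\<bar>" h L] L(1) r by simp
      then show "norm (heat ?\<tau> (mult_op (V r - ?v) x)) \<le> L * h * N"
        using L(1) h by (intro order_trans[OF norm_heat_le[OF \<tau>(1)]] order_trans[OF norm_mult_op] mult_mono xN) auto
      have "norm (heat ?\<tau> (mult_op ?v x) - mult_op ?v x) \<le> c * ?\<tau> * (4 * K * N)"
        unfolding c_def by (intro heat_minus_id_le \<tau>(1) l2_regular_mult_op_regular x v)
      also have "\<dots> \<le> c * h * (4 * K * N)"
        using \<tau> c K N by (intro mult_right_mono mult_left_mono) auto
      finally show "norm (heat ?\<tau> (mult_op ?v x) - mult_op ?v x) \<le> c * h * (4 * K * N)" .
    qed
    also have "\<dots> = G * N * h" by (simp add: G_def algebra_simps)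
    finally show "norm (heat ?\<tau> (mult_op (V r) (W r s x)) - mult_op ?v x) \<le> G * N * h" .
  qed
  then have 1: "norm ((W (s + h) s x - heat h x) - h *\<^sub>R mult_op ?v x) \<le> G * h\<^sup>2 * N"
    using h by (simp add: power2_eq_square mult_ac)
  let ?y = "heat h x"
  have y: "norm ?y \<le> N" using norm_heat_le[OF h(1), of x] xN by simp
  have 2: "norm (mult_op (linf_exp (h *\<^sub>R ?v)) ?y - ?y - h *\<^sub>R mult_op ?v x)
    \<le> (exp (h0 * B) * B\<^sup>2 + B * c) * h\<^sup>2 * N"
  proof -
    have hv: "norm (h *\<^sub>R ?v) \<le> h * B" using h V_le[of s] by (simp add: mult_left_mono)
    have hB: "h * B \<le> h0 * B" using h B by (intro mult_right_mono)
    have "mult_op (linf_exp (h *\<^sub>R ?v)) ?y - ?y - h *\<^sub>R mult_op ?v x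
      = (mult_op (linf_exp (h *\<^sub>R ?v)) ?y - ?y - mult_op (h *\<^sub>R ?v) ?y) + h *\<^sub>R mult_op ?v (?y - x)"
      by (simp add: mult_op_scaleR_left mult_op_diff_right scaleR_diff_right)
    also have "norm \<dots> \<le> exp (h0 * B) * (h * B)\<^sup>2 * N + h * (B * (c * h * N))"
    proof (rule norm_triangle_mono)
      show "norm (mult_op (linf_exp (h *\<^sub>R ?v)) ?y - ?y - mult_op (h *\<^sub>R ?v) ?y) \<le> exp (h0 * B) * (h * B)\<^sup>2 * N"
        using hv hB y N by (intro order_trans[OF norm_mult_op_exp_le] mult_mono power_mono) auto
      have "norm (mult_op ?v (?y - x)) \<le> B * (c * h * N)"
        unfolding c_def by (intro order_trans[OF norm_mult_V_le] mult_left_mono heat_minus_id_le h x B)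
      then show "norm (h *\<^sub>R mult_op ?v (?y - x)) \<le> h * (B * (c * h * N))"
        using h by (simp add: mult_left_mono)
    qed
    also have "\<dots> = (exp (h0 * B) * B\<^sup>2 + B * c) * h\<^sup>2 * N"
      by (simp add: power2_eq_square algebra_simps)
    finally show ?thesis .
  qed
  have "W (s + h) s x - mult_op (linf_exp (h *\<^sub>R ?v)) ?y
    = ((W (s + h) s x - ?y) - h *\<^sub>R mult_op ?v x) - (mult_op (linf_exp (h *\<^sub>R ?v)) ?y - ?y - h *\<^sub>R mult_op ?v x)"
    by simp
  also have "norm \<dots> \<le> G * h\<^sup>2 * N + (exp (h0 * B) * B\<^sup>2 + B * c) * h\<^sup>2 * N"
    by (rule order_trans[OF norm_triangle_ineq4 add_mono[OF 1 2]])
  also have "\<dots> = (B * (B * M + c) + L + 4 * c * K + exp (h0 * B) * B\<^sup>2 + B * c) * h\<^sup>2 * N"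
    by (simp add: G_def algebra_simps)
  finally show ?thesis .
qed

end

section \<open>From the local to the global error\<close>

theorem corollary5p3:
  fixes V :: "real \<Rightarrow> 'a::euclidean_space linf"
    and W :: "real \<Rightarrow> real \<Rightarrow> 'a l2 \<Rightarrow> 'a l2"
  assumes "V \<in> BUC (Wk_inf_space 2) (Wk_inf_norm 2) \<inter> BUC1"
    and "evolution_family W"
    and "solves_perturbed_heat V W"
  shows "\<forall>t0>0. \<exists>C>0. \<forall>u0\<in>Hk_space 2. \<forall>s t. s \<le> t \<and> t - s \<le> t0 \<longrightarrow>
           (\<forall>n::nat. n \<ge> 1 \<longrightarrow>
              norm (W t s u0 -
                ordered_prod
                  (\<lambda>p. mult_op (linf_exp (((t - s) / real n) *\<^sub>R V (s + real p * (t - s) / real n)))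
                        \<circ> heat ((t - s) / real n)) n u0)
              \<le> C * (t - s)\<^sup>2 / real n * Hk_norm 2 u0)"
proof (intro allI impI)
  fix t0 :: real assume t0: "t0 > 0"
  have "V \<in> BUC1" using assms(1) by simp
  then obtain B L where B: "0 \<le> B" "\<And>t. norm (V t) \<le> B"
    and L: "0 \<le> L" "\<And>s t. norm (V t - V s) \<le> L * \<bar>t - s\<bar>"
    using BUC1_bounded_lipschitz by metis
  obtain B' where B': "\<And>t. Wk_inf_norm 2 (V t) \<le> B'" and V_mem: "\<And>t. V t \<in> Wk_inf_space 2"
    using assms(1) by (auto simp: BUC_def)
  obtain M where M: "1 \<le> M" "\<And>s t u. s \<le> t \<Longrightarrow> t - s \<le> t0 \<Longrightarrow> norm (W t s u) \<le> M * norm u"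
    using evolution_bound[OF assms(2,3) B(2), where T = t0] by blast
  \<comment> \<open>The maximum merges the two halves of the assumption on \<open>V\<close>:
    \<open>B\<close> bounds the values, \<open>B'\<close> the spatial derivatives, both uniformly in
    time.\<close>
  define K where "K = (real DIM('a))\<^sup>2 * max B B'"
  have V_reg: "linf_regular K (V t)" for t
    unfolding K_def using B(2) B' by (intro Wk_inf_space_2_regular V_mem) (auto intro: max.coboundedI1 max.coboundedI2)
  have K: "0 \<le> K" by (rule linf_regular_nonneg[OF V_reg])
  define A where "A = K + 3 * (exp (3 * (t0 * K)) * K * (1 + 2 * (t0 * K)))"
  have A: "0 \<le> A" using K t0 by (simp add: A_def)
  define c where "c = sqrt (heat_moment TYPE('a))"
  define D where "D = B * (B * M + c) + L + 4 * c * K + exp (t0 * B) * B\<^sup>2 + B * c"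
  have "0 \<le> c" by (simp add: c_def heat_moment_def)
  then have D: "0 \<le> D"
    unfolding D_def using B(1) L(1) K M(1) by (intro add_nonneg_nonneg mult_nonneg_nonneg) auto
  \<comment> \<open>The dimension factor converts \<open>Hk_norm\<close> into the
    difference-quotient constant. The summand 1 makes \<open>C\<close> positive even when
    \<open>D\<close> vanishes.\<close>
  define C where "C = M * D * exp (t0 * A) * (real DIM('a))\<^sup>2 + 1"
  have C: "C > 0" unfolding C_def using M(1) D by (simp add: add_nonneg_pos)
  show "\<exists>C>0. \<forall>u0\<in>Hk_space 2. \<forall>s t. s \<le> t \<and> t - s \<le> t0 \<longrightarrow>
           (\<forall>n::nat. n \<ge> 1 \<longrightarrow>
              norm (W t s u0 -
                ordered_prod
                  (\<lambda>p. mult_op (linf_exp (((t - s) / real n) *\<^sub>R V (s + real p * (t - s) / real n)))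
                        \<circ> heat ((t - s) / real n)) n u0)
              \<le> C * (t - s)\<^sup>2 / real n * Hk_norm 2 u0)"
  proof (intro exI[of _ C] conjI C ballI allI impI)
    fix u0 :: "'a l2" and s t :: real and n :: nat
    assume u0: "u0 \<in> Hk_space 2" and st: "s \<le> t \<and> t - s \<le> t0" and n: "n \<ge> 1"
    define h where "h = (t - s) / real n"
    define \<tau> where "\<tau> p = s + real p * (t - s) / real n" for p :: nat
    define U where "U p = mult_op (linf_exp (h *\<^sub>R V (\<tau> p))) \<circ> heat h" for p
    have U_apply: "U p x = mult_op (linf_exp (h *\<^sub>R V (\<tau> p))) (heat h x)" for p x
      by (simp add: U_def)
    define N where "N = (real DIM('a))\<^sup>2 * Hk_norm 2 u0"
    have nh: "real n * h = t - s" using n by (simp add: h_def)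
    have h: "0 \<le> h" using st by (simp add: h_def)
    have "h \<le> t0"
    proof -
      have "1 * h \<le> real n * h" using n h by (intro mult_right_mono) auto
      then show ?thesis using nh st by simp
    qed
    have \<tau>_Suc: "\<tau> (Suc p) = \<tau> p + h" for p
      by (simp add: \<tau>_def h_def add_divide_distrib distrib_right)
    have \<tau>_eq: "\<tau> p = s + real p * h" for p
      by (simp add: \<tau>_def h_def)
    have \<tau>_le: "\<tau> p \<le> t" if "p \<le> n" for p
    proof -
      have "real p * h \<le> real n * h" using that h by (intro mult_right_mono) auto
      then show ?thesis using nh by (simp add: \<tau>_eq)
    qed
    have \<tau>_ge: "s \<le> \<tau> p" for p using h by (simp add: \<tau>_eq)
    have N: "0 \<le> N" "l2_regular N u0"
      unfolding N_def by (rule l2_regular_nonneg[OF Hk_space_2_regular[OF u0]], rule Hk_space_2_regular[OF u0])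
    \<comment> \<open>Only the multiplication enlarges the constant in each step, by
      \<open>exp (h * A)\<close>, so the exponents add up to the elapsed time times
      \<open>A\<close>.\<close>
    have reg: "l2_regular (exp (real p * h * A) * N) (ordered_prod U p u0)" for p
    proof (induction p)
      case (Suc p)
      have "l2_regular (exp (h * A) * (exp (real p * h * A) * N)) (U p (ordered_prod U p u0))"
        unfolding A_def
        by (subst U_apply) (intro l2_regular_mult_op_exp l2_regular_heat h V_reg \<open>h \<le> t0\<close> Suc.IH[unfolded A_def])
      moreover have "exp (h * A) * (exp (real p * h * A) * N) = exp (real (Suc p) * h * A) * N"
        by (simp add: distrib_right exp_add)
      ultimately show ?case by simp
    qed (simp add: N)
    \<comment> \<open>For the steps in question the elapsed time \<open>p * h\<close> is at most
      \<open>t0\<close>, so the exponential is replaced by its largest value and one bound serves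
      for all local errors.\<close>
    define E where "E = D * h\<^sup>2 * (exp (t0 * A) * N)"
    have E: "0 \<le> E" using D N by (simp add: E_def)
    have step: "norm (W (\<tau> (Suc p)) (\<tau> p) (ordered_prod U p u0) - ordered_prod U (Suc p) u0) \<le> E"
      if "p < n" for p
    proof -
      let ?x = "ordered_prod U p u0"
      have "norm (W (\<tau> p + h) (\<tau> p) ?x - mult_op (linf_exp (h *\<^sub>R V (\<tau> p))) (heat h ?x))
        \<le> D * h\<^sup>2 * (exp (real p * h * A) * N)"
        unfolding D_def c_def using \<open>h \<le> t0\<close>
        by (intro local_error[OF assms(2,3) B(2) reg V_reg h _ L M(1)] M(2)) auto
      also have "\<dots> \<le> E"
      proof -
        have "real p * h \<le> t0"
          using \<tau>_le[of p] st that by (simp add: \<tau>_eq)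
        then have "exp (real p * h * A) \<le> exp (t0 * A)"
          using A by (simp add: mult_right_mono)
        then show ?thesis
          unfolding E_def using D N by (intro mult_left_mono mult_right_mono) auto
      qed
      finally show ?thesis by (simp add: \<tau>_Suc U_def)
    qed
    \<comment> \<open>Propagating with \<open>W\<close> on the left uses its bound only once per term, so \<open>M\<close> is not compounded.\<close>
    have telescope: "norm (W t s u0 - W t (\<tau> p) (ordered_prod U p u0)) \<le> real p * (M * E)" if "p \<le> n" for p
      using that
    proof (induction p)
      case (Suc p)
      let ?x = "ordered_prod U p u0" and ?x' = "ordered_prod U (Suc p) u0"
      have le: "\<tau> p \<le> \<tau> (Suc p)" "\<tau> (Suc p) \<le> t"
        using h Suc.prems \<tau>_le[of "Suc p"] by (simp_all add: \<tau>_Suc)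
      have comp: "W t (\<tau> p) = W t (\<tau> (Suc p)) \<circ> W (\<tau> (Suc p)) (\<tau> p)"
        using assms(2) le by (simp add: evolution_family_def)
      have "linear (W t (\<tau> (Suc p)))"
        using assms(2) le by (auto simp: evolution_family_def bounded_operator_def bounded_linear.linear)
      then have "W t (\<tau> p) ?x - W t (\<tau> (Suc p)) ?x'
        = W t (\<tau> (Suc p)) (W (\<tau> (Suc p)) (\<tau> p) ?x - ?x')"
        by (simp only: comp o_apply linear_diff)
      also have "norm \<dots> \<le> M * norm (W (\<tau> (Suc p)) (\<tau> p) ?x - ?x')"
        using le st \<tau>_ge[of "Suc p"] by (intro M(2)) auto
      also have "\<dots> \<le> M * E"
        using step[of p] Suc.prems M(1) by (intro mult_left_mono) auto
      finally have "norm (W t (\<tau> p) ?x - W t (\<tau> (Suc p)) ?x') \<le> M * E" .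
      moreover have "norm (W t s u0 - W t (\<tau> p) ?x) \<le> real p * (M * E)"
        using Suc by simp
      ultimately have "norm ((W t s u0 - W t (\<tau> p) ?x) + (W t (\<tau> p) ?x - W t (\<tau> (Suc p)) ?x'))
        \<le> real p * (M * E) + M * E"
        by (intro norm_triangle_mono)
      then show ?case by (simp add: algebra_simps)
    qed (simp add: \<tau>_def)
    have "\<tau> n = t" using n by (simp add: \<tau>_def)
    then have "W t (\<tau> n) (ordered_prod U n u0) = ordered_prod U n u0"
      using assms(2) by (simp add: evolution_family_def)
    then have "norm (W t s u0 - ordered_prod U n u0) \<le> real n * (M * E)"
      using telescope[of n] by simp
    \<comment> \<open>The rate appears here: \<open>n\<close> local errors of size
      \<open>h\<^sup>2\<close>, with \<open>h = (t - s) / n\<close>, add up to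
      \<open>(t - s)\<^sup>2 / n\<close>.\<close>
    also have "\<dots> = M * D * exp (t0 * A) * (real n * h\<^sup>2) * N"
      by (simp add: E_def)
    also have "real n * h\<^sup>2 = (t - s)\<^sup>2 / real n"
      using n by (simp add: h_def power2_eq_square)
    also have "M * D * exp (t0 * A) * ((t - s)\<^sup>2 / real n) * N
      = (C - 1) * ((t - s)\<^sup>2 / real n * Hk_norm 2 u0)"
      by (simp add: C_def N_def)
    also have "\<dots> \<le> C * ((t - s)\<^sup>2 / real n * Hk_norm 2 u0)"
    proof (rule mult_right_mono)
      have "0 \<le> Hk_norm 2 u0" by (simp add: Hk_norm_def sum_nonneg)
      then show "0 \<le> (t - s)\<^sup>2 / real n * Hk_norm 2 u0" by simp
    qed simp
    finally have "norm (W t s u0 - ordered_prod U n u0) \<le> C * (t - s)\<^sup>2 / real n * Hk_norm 2 u0"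
      by (simp only: mult.assoc times_divide_eq_left times_divide_eq_right)
    then show "norm (W t s u0 -
                ordered_prod
                  (\<lambda>p. mult_op (linf_exp (((t - s) / real n) *\<^sub>R V (s + real p * (t - s) / real n)))
                        \<circ> heat ((t - s) / real n)) n u0)
              \<le> C * (t - s)\<^sup>2 / real n * Hk_norm 2 u0"
      by (simp only: U_def[abs_def] h_def \<tau>_def)
  qed
qed

end
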